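(* Let $g_\mu$ be the Robin Green's function of the upper half-plane, which satisfies $$\Delta g_\mu=0 \ \text{ in } \mathbb{H}_2,\qquad \partial_n g_\mu=0\ \text{ on } y_2=0,\ |y_1|\ge 1,\qquad \partial_n g_\mu+\mu g_\mu=0\ \text{ on } y_2=0,\ |y_1|<1,$$ $$g_\mu(\boldsymbol{y})\sim \ln|\boldsymbol{y}|+\mathcal{O}(1)\ \text{ as } |\boldsymbol{y}|\to\infty.$$ Then, for any $\mu\notin\bigcup_{k=0}^\infty\{-\mu_{2k}\}$, this Green's function admits the spectral expansion $$g_\mu(\boldsymbol{y})=g_\infty(\boldsymbol{y})+\pi\sum_{k=0}^\infty\frac{\Psi_{2k}(\infty)}{\mu_{2k}+\mu}\,\Psi_{2k}(\boldsymbol{y}).$$ As a consequence, the constant term $\mathcal{C}(\mu)$ in its asymptotic behavior at infinity, defined by $$g_\mu(\boldsymbol{y})\sim \ln|\boldsymbol{y}|+\mathcal{C}(\mu)+o(1)\quad\text{as } |\boldsymbol{y}|\to\infty,$$ is $$\mathcal{C}(\mu)=\ln 2+\frac{\pi}{2\mu}+\pi\sum_{k=1}^\infty\frac{[\Psi_{2k}(\infty)]^2}{\mu_{2k}+\mu}$$ for any $\mu\notin\bigcup_{k=0}^\infty\{-\mu_{2k}\}$.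
   Context: $\mathbb{H}_2=\mathbb{R}\times\mathbb{R}_+$ is the upper half-plane with points $\boldsymbol{y}=(y_1,y_2)$; $\partial_n$ is the outward normal derivative, i.e. $\partial_n=-\partial_{y_2}$ on $y_2=0$. The function $g_\infty$ is the Dirichlet Green's function satisfying: $\Delta g_\infty=0$ in $\mathbb{H}_2$; $\partial_n g_\infty=0$ on $y_2=0$, $|y_1|\ge1$; $g_\infty=0$ on $y_2=0$, $|y_1|<1$; $g_\infty\sim\ln|\boldsymbol{y}|+\mathcal{O}(1)$ as $|\boldsymbol{y}|\to\infty$. Its behavior at infinity is $g_\infty(\boldsymbol{y})\sim\ln|\boldsymbol{y}|+\ln 2+o(1)$, because the logarithmic capacity of the interval $(-1,1)$ is $1/2$. The pairs $(\mu_k,\Psi_k)$, $k=0,1,2,\dots$, are the eigenvalues and eigenfunctions of the auxiliary Steklov--Neumann problem in the upper half-plane: $\Delta\Psi_k=0$ in $\mathbb{H}_2$; $\partial_n\Psi_k=\mu_k\Psi_k$ on $y_2=0$, $|y_1|<1$; $\partial_n\Psi_k=0$ on $y_2=0$, $|y_1|\ge1$; $\Psi_k=\mathcal{O}(1)$ as $|\boldsymbol{y}|\to\infty$. The eigenvalues satisfy $0=\mu_0\le\mu_1\le\mu_2\le\dots\nearrow+\infty$, and the restrictions $\Psi_k(y_1,0)$ to $(-1,1)$ form a complete orthonormal basis of $L^2(-1,1)$: $\int_{-1}^1\Psi_j(y_1,0)\Psi_k(y_1,0)\,dy_1=\delta_{j,k}$, which fixes the normalization of the eigenfunctions; in particular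 $\Psi_0=1/\sqrt2$. By symmetry with respect to the vertical axis, eigenfunctions are either symmetric or antisymmetric: even indices label the symmetric ones, $\Psi_{2k}(-y_1,y_2)=\Psi_{2k}(y_1,y_2)$, and odd indices the antisymmetric ones, $\Psi_{2k+1}(-y_1,y_2)=-\Psi_{2k+1}(y_1,y_2)$. $\Psi_k(\infty)$ denotes the limiting value of $\Psi_k(\boldsymbol{y})$ as $|\boldsymbol{y}|\to\infty$.
   Formalization: The boundary conditions are imposed for |y_1|>1 and |y_1|<1 with continuity at (±1,0), where the normal derivative of g_∞ is infinite; if μ=-μ_{2k+1}, where g_μ is not unique, the expansion is claimed for the solution symmetric in y_1. *)

theory Defs
  imports "HOL-Analysis.Analysis" "HOL-Library.Landau_Symbols"
begin

definition halfplane :: "(real \<times> real) set" where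
  "halfplane = {y. snd y > 0}"

definition closed_halfplane :: "(real \<times> real) set" where
  "closed_halfplane = {y. snd y \<ge> 0}"

definition halfplane_infinity :: "(real \<times> real) filter" where
  "halfplane_infinity = inf at_infinity (principal closed_halfplane)"

text \<open>Continuous differentiability on \<open>S\<close>. The derivative is taken within \<open>S\<close>, so that on a
  set with boundary this means \<open>C\<^sup>1\<close> up to the boundary points that belong to \<open>S\<close>.\<close>

definition C1_on :: "(real \<times> real) set \<Rightarrow> (real \<times> real \<Rightarrow> real) \<Rightarrow> bool" where
  "C1_on S u \<longleftrightarrow> (\<exists>p q. continuous_on S p \<and> continuous_on S q \<and>
     (\<forall>y\<in>S. (u has_derivative (\<lambda>h. p y * fst h + q y * snd h)) (at y within S)))"

definition pderiv1 :: "(real \<times> real \<Rightarrow> real) \<Rightarrow> real \<times> real \<Rightarrow> real" where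
  "pderiv1 u y = deriv (\<lambda>s. u (s, snd y)) (fst y)"

definition pderiv2 :: "(real \<times> real \<Rightarrow> real) \<Rightarrow> real \<times> real \<Rightarrow> real" where
  "pderiv2 u y = deriv (\<lambda>t. u (fst y, t)) (snd y)"

definition laplacian :: "(real \<times> real \<Rightarrow> real) \<Rightarrow> real \<times> real \<Rightarrow> real" where
  "laplacian u y = pderiv1 (pderiv1 u) y + pderiv2 (pderiv2 u) y"

definition harmonic_on :: "(real \<times> real) set \<Rightarrow> (real \<times> real \<Rightarrow> real) \<Rightarrow> bool" where
  "harmonic_on S u \<longleftrightarrow> C1_on S u \<and> C1_on S (pderiv1 u) \<and> C1_on S (pderiv2 u) \<and>
     (\<forall>y\<in>S. laplacian u y = 0)"

text \<open>Classical harmonic functions in the upper half-plane: continuous up to the boundary, and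
  \<open>C\<^sup>1\<close> up to the boundary except at the two points \<open>(\<plusminus>1, 0)\<close> where the type of the boundary
  condition changes. In general the normal derivative does not exist there (for the Dirichlet
  Green's function it is infinite), so the boundary conditions below are imposed only for
  \<open>\<bar>x\<bar> < 1\<close> and \<open>\<bar>x\<bar> > 1\<close>. Continuity at \<open>(\<plusminus>1, 0)\<close> excludes singular solutions.\<close>

definition classical_harmonic :: "(real \<times> real \<Rightarrow> real) \<Rightarrow> bool" where
  "classical_harmonic u \<longleftrightarrow> harmonic_on halfplane u \<and> continuous_on closed_halfplane u \<and>
     C1_on (closed_halfplane - {(-1, 0), (1, 0)}) u"

definition has_normal_deriv :: "(real \<times> real \<Rightarrow> real) \<Rightarrow> real \<Rightarrow> real \<Rightarrow> bool" where
  "has_normal_deriv u d x \<longleftrightarrow> ((\<lambda>t. u (x, t)) has_real_derivative - d) (at 0 within {0..})"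

definition dirichlet_green :: "(real \<times> real \<Rightarrow> real) \<Rightarrow> bool" where
  "dirichlet_green g \<longleftrightarrow> classical_harmonic g \<and>
     (\<forall>x. \<bar>x\<bar> > 1 \<longrightarrow> has_normal_deriv g 0 x) \<and>
     (\<forall>x. \<bar>x\<bar> < 1 \<longrightarrow> g (x, 0) = 0) \<and>
     (\<lambda>y. g y - ln (norm y)) \<in> O[halfplane_infinity](\<lambda>_. 1)"

definition robin_green :: "real \<Rightarrow> (real \<times> real \<Rightarrow> real) \<Rightarrow> bool" where
  "robin_green \<mu> g \<longleftrightarrow> classical_harmonic g \<and>
     (\<forall>x. \<bar>x\<bar> > 1 \<longrightarrow> has_normal_deriv g 0 x) \<and>
     (\<forall>x. \<bar>x\<bar> < 1 \<longrightarrow> (\<exists>d. has_normal_deriv g d x \<and> d + \<mu> * g (x, 0) = 0)) \<and>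
     (\<lambda>y. g y - ln (norm y)) \<in> O[halfplane_infinity](\<lambda>_. 1)"

definition steklov_neumann :: "real \<Rightarrow> (real \<times> real \<Rightarrow> real) \<Rightarrow> bool" where
  "steklov_neumann \<mu> \<Psi> \<longleftrightarrow> classical_harmonic \<Psi> \<and>
     (\<forall>x. \<bar>x\<bar> > 1 \<longrightarrow> has_normal_deriv \<Psi> 0 x) \<and>
     (\<forall>x. \<bar>x\<bar> < 1 \<longrightarrow> has_normal_deriv \<Psi> (\<mu> * \<Psi> (x, 0)) x) \<and>
     \<Psi> \<in> O[halfplane_infinity](\<lambda>_. 1)"

definition orthonormal_basis :: "(nat \<Rightarrow> real \<Rightarrow> real) \<Rightarrow> bool" where
  "orthonormal_basis \<psi> \<longleftrightarrow>
     (\<forall>k. set_borel_measurable lborel {-1<..<1} (\<psi> k) \<and>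
          set_integrable lborel {-1<..<1} (\<lambda>x. (\<psi> k x)\<^sup>2)) \<and>
     (\<forall>j k. (LINT x:{-1<..<1}|lborel. \<psi> j x * \<psi> k x) = (if j = k then 1 else 0)) \<and>
     (\<forall>f :: real \<Rightarrow> real. set_borel_measurable lborel {-1<..<1} f \<longrightarrow>
        set_integrable lborel {-1<..<1} (\<lambda>x. (f x)\<^sup>2) \<longrightarrow>
        (\<lambda>n. LINT x:{-1<..<1}|lborel.
           (f x - (\<Sum>k<n. (LINT s:{-1<..<1}|lborel. f s * \<psi> k s) * \<psi> k x))\<^sup>2) \<longlonglongrightarrow> 0)"

text \<open>Parity with respect to the vertical axis. If \<open>\<mu> = - \<mu>\<^sub>2\<^sub>k\<^sub>+\<^sub>1\<close>, then multiples of the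
  odd eigenfunction \<open>\<Psi>\<^sub>2\<^sub>k\<^sub>+\<^sub>1\<close> may be added to a solution of the Robin problem, and the Robin
  Green's function is understood to be an even solution.\<close>

definition even_in_y1 :: "(real \<times> real \<Rightarrow> real) \<Rightarrow> bool" where
  "even_in_y1 u \<longleftrightarrow> (\<forall>y1 y2. y2 \<ge> 0 \<longrightarrow> u (- y1, y2) = u (y1, y2))"

definition odd_in_y1 :: "(real \<times> real \<Rightarrow> real) \<Rightarrow> bool" where
  "odd_in_y1 u \<longleftrightarrow> (\<forall>y1 y2. y2 \<ge> 0 \<longrightarrow> u (- y1, y2) = - u (y1, y2))"

text \<open>The requirement on \<open>\<Psi> 0\<close> only fixes its sign.\<close>

definition steklov_neumann_system :: "(nat \<Rightarrow> real) \<Rightarrow> (nat \<Rightarrow> real \<times> real \<Rightarrow> real) \<Rightarrow> bool" where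
  "steklov_neumann_system \<mu>s \<Psi> \<longleftrightarrow>
     (\<forall>k. steklov_neumann (\<mu>s k) (\<Psi> k)) \<and>
     \<mu>s 0 = 0 \<and> mono \<mu>s \<and> filterlim \<mu>s at_top sequentially \<and>
     orthonormal_basis (\<lambda>k x. \<Psi> k (x, 0)) \<and>
     (\<forall>y\<in>closed_halfplane. \<Psi> 0 y = 1 / sqrt 2) \<and>
     (\<forall>k. even_in_y1 (\<Psi> (2 * k))) \<and> (\<forall>k. odd_in_y1 (\<Psi> (2 * k + 1)))"

definition value_at_infinity :: "(real \<times> real \<Rightarrow> real) \<Rightarrow> real" where
  "value_at_infinity u = Lim halfplane_infinity u"

end

theory Submission
  imports Defs "HOL-Complex_Analysis.Complex_Analysis"
begin

text \<open>The inverse Joukowski map \<open>\<zeta>\<close> sends the half-plane to a half disc, infinity to \<open>0\<close> and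
  \<open>(cos \<theta>, 0)\<close> to \<open>cis (- \<theta>)\<close>, and \<open>g\<^sub>\<infinity> = - ln \<bar>\<zeta>\<bar>\<close>. A solution whose Neumann datum on \<open>(-1, 1)\<close>
  is a continuous \<open>h\<close> has the form \<open>a + (h\<^sub>0 / \<pi>) ln \<bar>\<zeta>\<bar> + \<Sum> w\<^sub>m h\<^sub>m Re \<zeta>\<^sup>m\<close> with \<open>w\<^sub>m = 2 / (\<pi> m)\<close> and
  \<open>h\<^sub>m\<close> the integral of \<open>h\<close> against the Chebyshev polynomial \<open>T\<^sub>m\<close>: both sides have the same Neumann
  data, and a Liouville theorem applies. Pairing such series gives Green's identity, hence
  \<open>(\<mu>\<^sub>k + \<mu>) c\<^sub>k = \<pi> \<Psi>\<^sub>k(\<infinity>)\<close> for the coefficients \<open>c\<^sub>k\<close> of \<open>g\<close> on the interval.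

  Convergence in \<open>L\<^sup>2(-1, 1)\<close> does not control values at infinity, because the equilibrium density
  is not square integrable. For the remainder \<open>d\<^sub>n\<close> of \<open>g - g\<^sub>\<infinity>\<close>, with Neumann coefficients \<open>\<eta>\<^sub>m\<close> and
  value \<open>x\<^sub>n\<close> at infinity, the same pairing yields \<open>\<Sum> w\<^sub>m \<eta>\<^sub>m\<^sup>2 = \<pi> x\<^sub>n + o(1)\<close>, while \<open>L\<^sup>2\<close> convergence
  forces \<open>\<eta>\<^sub>2\<^sub>N = 2 \<pi> N x\<^sub>n + o(1)\<close> for every fixed \<open>N\<close>. Hence \<open>x\<^sub>n \<longlonglongrightarrow> 0\<close>, the energy of \<open>d\<^sub>n\<close> tends to 0,
  and with it \<open>d\<^sub>n\<close> tends to 0 at every point of the open half-plane.\<close>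

section \<open>Laplacians along coordinate lines\<close>

definition has_laplacian_on ::
  "(real \<times> real) set \<Rightarrow> (real \<times> real \<Rightarrow> real) \<Rightarrow> (real \<times> real \<Rightarrow> real) \<Rightarrow> bool" where
  "has_laplacian_on S u f \<longleftrightarrow> (\<exists>u1 u2 u11 u22. \<forall>x t. (x, t) \<in> S \<longrightarrow>
     ((\<lambda>s. u (s, t)) has_real_derivative u1 (x, t)) (at x) \<and>
     ((\<lambda>s. u (x, s)) has_real_derivative u2 (x, t)) (at t) \<and>
     ((\<lambda>s. u1 (s, t)) has_real_derivative u11 (x, t)) (at x) \<and>
     ((\<lambda>s. u2 (x, s)) has_real_derivative u22 (x, t)) (at t) \<and>
     u11 (x, t) + u22 (x, t) = f (x, t))"

lemma has_laplacian_on_subset: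
  "has_laplacian_on S u f \<Longrightarrow> T \<subseteq> S \<Longrightarrow> has_laplacian_on T u f"
  unfolding has_laplacian_on_def by (meson subsetD)

lemma has_laplacian_on_add:
  assumes "has_laplacian_on S u f" "has_laplacian_on S v g"
  shows "has_laplacian_on S (\<lambda>y. u y + v y) (\<lambda>y. f y + g y)"
proof -
  obtain u1 u2 u11 u22 v1 v2 v11 v22 where
    u: "\<forall>x t. (x, t) \<in> S \<longrightarrow>
     ((\<lambda>s. u (s, t)) has_real_derivative u1 (x, t)) (at x) \<and>
     ((\<lambda>s. u (x, s)) has_real_derivative u2 (x, t)) (at t) \<and>
     ((\<lambda>s. u1 (s, t)) has_real_derivative u11 (x, t)) (at x) \<and>
     ((\<lambda>s. u2 (x, s)) has_real_derivative u22 (x, t)) (at t) \<and>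
     u11 (x, t) + u22 (x, t) = f (x, t)" and
    v: "\<forall>x t. (x, t) \<in> S \<longrightarrow>
     ((\<lambda>s. v (s, t)) has_real_derivative v1 (x, t)) (at x) \<and>
     ((\<lambda>s. v (x, s)) has_real_derivative v2 (x, t)) (at t) \<and>
     ((\<lambda>s. v1 (s, t)) has_real_derivative v11 (x, t)) (at x) \<and>
     ((\<lambda>s. v2 (x, s)) has_real_derivative v22 (x, t)) (at t) \<and>
     v11 (x, t) + v22 (x, t) = g (x, t)"
    using assms unfolding has_laplacian_on_def by blast
  show ?thesis
    unfolding has_laplacian_on_def
    apply (rule exI[of _ "\<lambda>y. u1 y + v1 y"], rule exI[of _ "\<lambda>y. u2 y + v2 y"],
        rule exI[of _ "\<lambda>y. u11 y + v11 y"], rule exI[of _ "\<lambda>y. u22 y + v22 y"])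
    apply (intro allI impI conjI)
    subgoal for x t using u v by (auto intro: DERIV_add[of "\<lambda>s. u (s, t)" _ _ _ "\<lambda>s. v (s, t)"])
    subgoal for x t using u v by (auto intro: DERIV_add[of "\<lambda>s. u (x, s)" _ _ _ "\<lambda>s. v (x, s)"])
    subgoal for x t using u v by (auto intro: DERIV_add[of "\<lambda>s. u1 (s, t)" _ _ _ "\<lambda>s. v1 (s, t)"])
    subgoal for x t using u v by (auto intro: DERIV_add[of "\<lambda>s. u2 (x, s)" _ _ _ "\<lambda>s. v2 (x, s)"])
    subgoal for x t using u v by (simp add: add.assoc add.left_commute)
    done
qed

lemma has_laplacian_on_cmult:
  assumes "has_laplacian_on S u f"
  shows "has_laplacian_on S (\<lambda>y. c * u y) (\<lambda>y. c * f y)"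
proof -
  obtain u1 u2 u11 u22 where
    u: "\<forall>x t. (x, t) \<in> S \<longrightarrow>
     ((\<lambda>s. u (s, t)) has_real_derivative u1 (x, t)) (at x) \<and>
     ((\<lambda>s. u (x, s)) has_real_derivative u2 (x, t)) (at t) \<and>
     ((\<lambda>s. u1 (s, t)) has_real_derivative u11 (x, t)) (at x) \<and>
     ((\<lambda>s. u2 (x, s)) has_real_derivative u22 (x, t)) (at t) \<and>
     u11 (x, t) + u22 (x, t) = f (x, t)"
    using assms unfolding has_laplacian_on_def by blast
  show ?thesis
    unfolding has_laplacian_on_def
    apply (rule exI[of _ "\<lambda>y. c * u1 y"], rule exI[of _ "\<lambda>y. c * u2 y"],
        rule exI[of _ "\<lambda>y. c * u11 y"], rule exI[of _ "\<lambda>y. c * u22 y"])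
    apply (intro allI impI conjI)
    subgoal for x t using u by (auto intro: DERIV_cmult[of "\<lambda>s. u (s, t)"])
    subgoal for x t using u by (auto intro: DERIV_cmult[of "\<lambda>s. u (x, s)"])
    subgoal for x t using u by (auto intro: DERIV_cmult[of "\<lambda>s. u1 (s, t)"])
    subgoal for x t using u by (auto intro: DERIV_cmult[of "\<lambda>s. u2 (x, s)"])
    subgoal for x t using u by (simp add: distrib_left[symmetric])
    done
qed

lemma open_halfplane: "open halfplane"
  unfolding halfplane_def by (intro open_Collect_less continuous_intros)

lemma closed_closed_halfplane: "closed closed_halfplane"
  unfolding closed_halfplane_def by (intro closed_Collect_le continuous_intros)

lemma C1_on_halfplane_partials:
  assumes "C1_on halfplane u" "(x, t) \<in> halfplane"
  shows "((\<lambda>s. u (s, t)) has_real_derivative pderiv1 u (x, t)) (at x)"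
    and "((\<lambda>s. u (x, s)) has_real_derivative pderiv2 u (x, t)) (at t)"
proof -
  obtain p q where "(u has_derivative (\<lambda>h. p (x, t) * fst h + q (x, t) * snd h)) (at (x, t) within halfplane)"
    using assms unfolding C1_on_def by blast
  hence u: "(u has_derivative (\<lambda>h. p (x, t) * fst h + q (x, t) * snd h)) (at (x, t))"
    using at_within_open[OF assms(2) open_halfplane] by simp
  have "((\<lambda>s. (s, t)) has_derivative (\<lambda>h. (h, 0))) (at x)"
    by (intro derivative_intros)
  from has_derivative_compose[OF this u]
  have 1: "((\<lambda>s. u (s, t)) has_real_derivative p (x, t)) (at x)"
    by (simp add: has_field_derivative_def mult_commute_abs)
  thus "((\<lambda>s. u (s, t)) has_real_derivative pderiv1 u (x, t)) (at x)"
    by (simp add: pderiv1_def DERIV_imp_deriv)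
  have "((\<lambda>s. (x, s)) has_derivative (\<lambda>h. (0, h))) (at t)"
    by (intro derivative_intros)
  from has_derivative_compose[OF this u]
  have 1: "((\<lambda>s. u (x, s)) has_real_derivative q (x, t)) (at t)"
    by (simp add: has_field_derivative_def mult_commute_abs)
  thus "((\<lambda>s. u (x, s)) has_real_derivative pderiv2 u (x, t)) (at t)"
    by (simp add: pderiv2_def DERIV_imp_deriv)
qed

lemma harmonic_on_has_laplacian_on:
  assumes "harmonic_on halfplane u"
  shows "has_laplacian_on halfplane u (\<lambda>_. 0)"
  unfolding has_laplacian_on_def
  apply (rule exI[of _ "pderiv1 u"], rule exI[of _ "pderiv2 u"],
      rule exI[of _ "pderiv1 (pderiv1 u)"], rule exI[of _ "pderiv2 (pderiv2 u)"])
  using assms unfolding harmonic_on_def laplacian_def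
  by (auto intro: C1_on_halfplane_partials)

lemma Re_holomorphic_has_laplacian_on:
  assumes "F holomorphic_on {z. Im z > 0}"
  shows "has_laplacian_on halfplane (\<lambda>y. Re (F (Complex (fst y) (snd y)))) (\<lambda>_. 0)"
proof -
  have o: "open {z. Im z > 0}" by (rule open_halfspace_Im_gt)
  have D: "((\<lambda>s. G (Complex s t)) has_vector_derivative deriv G (Complex x t)) (at x)"
          "((\<lambda>s. G (Complex x s)) has_vector_derivative \<i> * deriv G (Complex x t)) (at t)"
    if G: "G holomorphic_on {z. Im z > 0}" and t: "t > 0" for G x t
  proof -
    have d: "(G has_field_derivative deriv G (Complex x t)) (at (Complex x t))"
      using holomorphic_derivI[OF G o, of "Complex x t"] t by simp
    have "((\<lambda>s. Complex s t) has_vector_derivative 1) (at x)"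
      unfolding Complex_eq by (auto intro!: derivative_eq_intros)
    from field_vector_diff_chain_at[OF this, of G] d
    show "((\<lambda>s. G (Complex s t)) has_vector_derivative deriv G (Complex x t)) (at x)"
      by (simp add: o_def)
    have "((\<lambda>s. Complex x s) has_vector_derivative \<i>) (at t)"
      unfolding Complex_eq by (auto intro!: derivative_eq_intros)
    from field_vector_diff_chain_at[OF this, of G] d
    show "((\<lambda>s. G (Complex x s)) has_vector_derivative \<i> * deriv G (Complex x t)) (at t)"
      by (simp add: o_def)
  qed
  have Re: "((\<lambda>s. Re (f s)) has_real_derivative Re d) (at x)"
    and Im: "((\<lambda>s. Im (f s)) has_real_derivative Im d) (at x)"
    if "(f has_vector_derivative d) (at x)" for f :: "real \<Rightarrow> complex" and d x
    using bounded_linear.has_vector_derivative[OF bounded_linear_Re that]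
      bounded_linear.has_vector_derivative[OF bounded_linear_Im that]
    by (auto simp: has_real_derivative_iff_has_vector_derivative)
  have F': "deriv F holomorphic_on {z. Im z > 0}"
    using assms o by (rule holomorphic_deriv)
  let ?z = "\<lambda>y. Complex (fst y) (snd y)"
  show ?thesis
    unfolding has_laplacian_on_def
    apply (rule exI[of _ "\<lambda>y. Re (deriv F (?z y))"], rule exI[of _ "\<lambda>y. - Im (deriv F (?z y))"],
      rule exI[of _ "\<lambda>y. Re (deriv (deriv F) (?z y))"], rule exI[of _ "\<lambda>y. - Re (deriv (deriv F) (?z y))"])
    using Re[OF D(1)[OF assms]] Re[OF D(2)[OF assms]] Re[OF D(1)[OF F']]
      Im[OF D(2)[OF F'], THEN DERIV_minus]
    by (auto simp: halfplane_def)
qed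

definition log_sq :: "real \<Rightarrow> real \<times> real \<Rightarrow> real \<times> real \<Rightarrow> real" where
  "log_sq c q y = ln (c + ((fst y - fst q)\<^sup>2 + (snd y - snd q)\<^sup>2))"

lemma log_sq_has_laplacian_on:
  assumes "c \<ge> 0" "c > 0 \<or> q \<notin> S"
  shows "has_laplacian_on S (log_sq c q)
    (\<lambda>y. 4 * c / (c + ((fst y - fst q)\<^sup>2 + (snd y - snd q)\<^sup>2))\<^sup>2)"
proof -
  obtain a b where q: "q = (a, b)" by force
  define r where "r = (\<lambda>y::real\<times>real. c + ((fst y - a)\<^sup>2 + (snd y - b)\<^sup>2))"
  have pos: "c + ((x - a)\<^sup>2 + (t - b)\<^sup>2) > 0" if "(x, t) \<in> S" for x t
  proof (cases "c > 0")
    case False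
    hence "(x, t) \<noteq> (a, b)" using assms q that by auto
    hence "(x - a)\<^sup>2 + (t - b)\<^sup>2 > 0" by (auto simp: sum_power2_gt_zero_iff)
    thus ?thesis using assms by simp
  qed (simp add: add_pos_nonneg)
  have lap: "4 * c / (r y)\<^sup>2 =
    (2 * r y - 4 * (fst y - a)\<^sup>2) / (r y)\<^sup>2 + (2 * r y - 4 * (snd y - b)\<^sup>2) / (r y)\<^sup>2" for y
    unfolding add_divide_distrib[symmetric] by (simp add: r_def algebra_simps)
  show ?thesis
    unfolding has_laplacian_on_def
    apply (rule exI[of _ "\<lambda>y. 2 * (fst y - a) / r y"], rule exI[of _ "\<lambda>y. 2 * (snd y - b) / r y"],
      rule exI[of _ "\<lambda>y. (2 * r y - 4 * (fst y - a)\<^sup>2) / (r y)\<^sup>2"],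
      rule exI[of _ "\<lambda>y. (2 * r y - 4 * (snd y - b)\<^sup>2) / (r y)\<^sup>2"])
    apply (intro allI impI conjI)
        apply (use pos in \<open>auto simp: log_sq_def r_def q power2_eq_square intro!: derivative_eq_intros\<close>)[1]
        apply (use pos in \<open>auto simp: log_sq_def r_def q power2_eq_square intro!: derivative_eq_intros\<close>)[1]
    subgoal for x t
      unfolding r_def using pos[of x t]
      by (auto intro!: derivative_eq_intros simp: power2_eq_square) (simp add: algebra_simps)
    subgoal for x t
      unfolding r_def using pos[of x t]
      by (auto intro!: derivative_eq_intros simp: power2_eq_square) (simp add: algebra_simps)
    subgoal for x t using lap[of "(x, t)", symmetric] by (simp only: q r_def fst_conv snd_conv)
    done
qed

lemma no_max_of_pos_second_deriv:
  fixes f :: "real \<Rightarrow> real"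
  assumes e: "e > 0" and f: "\<And>s. \<bar>s - x\<bar> < e \<Longrightarrow> (f has_real_derivative f' s) (at s)"
    and f'': "(f' has_real_derivative c) (at x)" "c > 0"
    and max: "\<And>s. \<bar>s - x\<bar> < e \<Longrightarrow> f s \<le> f x"
  shows False
proof -
  have 0: "f' x = 0"
    using DERIV_local_max[of f "f' x" x e] f[of x] e max by (auto simp: abs_minus_commute)
  obtain d where d: "d > 0" "\<And>h. 0 < h \<Longrightarrow> h < d \<Longrightarrow> f' x < f' (x + h)"
    using DERIV_pos_inc_right[OF f''] by blast
  define h where "h = min d e / 2"
  have h: "0 < h" "h < d" "h < e" using d(1) e by (auto simp: h_def)
  obtain z where z: "z > x" "z < x + h" "f (x + h) - f x = (x + h - x) * f' z"
    using MVT2[of x "x + h" f f'] h f by force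
  have "f' z > 0" using d(2)[of "z - x"] z h 0 by auto
  hence "f (x + h) - f x > 0" using z(3) h by simp
  thus False using max[of "x + h"] h by auto
qed

lemma pos_laplacian_no_max:
  assumes S: "open S" "y \<in> S" and u: "has_laplacian_on S u f" and pos: "f y > 0"
    and max: "\<And>y'. y' \<in> S \<Longrightarrow> u y' \<le> u y"
  shows False
proof -
  obtain x t where y: "y = (x, t)" by force
  obtain e where e: "e > 0" "ball y e \<subseteq> S" using S openE by blast
  have in1: "(s, t) \<in> S" if "\<bar>s - x\<bar> < e" for s
    using e(2) that by (auto simp: y dist_Pair_Pair dist_real_def subset_iff abs_minus_commute)
  have in2: "(x, s) \<in> S" if "\<bar>s - t\<bar> < e" for s
    using e(2) that by (auto simp: y dist_Pair_Pair dist_real_def subset_iff abs_minus_commute)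
  obtain u1 u2 u11 u22 where
    D: "\<forall>x t. (x, t) \<in> S \<longrightarrow>
     ((\<lambda>s. u (s, t)) has_real_derivative u1 (x, t)) (at x) \<and>
     ((\<lambda>s. u (x, s)) has_real_derivative u2 (x, t)) (at t) \<and>
     ((\<lambda>s. u1 (s, t)) has_real_derivative u11 (x, t)) (at x) \<and>
     ((\<lambda>s. u2 (x, s)) has_real_derivative u22 (x, t)) (at t) \<and>
     u11 (x, t) + u22 (x, t) = f (x, t)"
    using u unfolding has_laplacian_on_def by blast
  have S': "(x, t) \<in> S" using S y by simp
  have "u11 (x, t) + u22 (x, t) > 0" using D S' pos y by auto
  then consider "u11 (x, t) > 0" | "u22 (x, t) > 0" by linarith
  thus False
  proof cases
    case 1
    show False
      by (rule no_max_of_pos_second_deriv[of e x "\<lambda>s. u (s, t)" "\<lambda>s. u1 (s, t)" "u11 (x, t)"])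
        (use e(1) D in1 S' 1 max y in auto)
  next
    case 2
    show False
      by (rule no_max_of_pos_second_deriv[of e t "\<lambda>s. u (x, s)" "\<lambda>s. u2 (x, s)" "u22 (x, t)"])
        (use e(1) D in2 S' 2 max y in auto)
  qed
qed

section \<open>A maximum principle for the mixed boundary value problem\<close>

lemma log_sq_continuous_on:
  assumes "c \<ge> 0" "c > 0 \<or> q \<notin> S"
  shows "continuous_on S (log_sq c q)"
proof -
  have pos: "c + ((fst y - fst q)\<^sup>2 + (snd y - snd q)\<^sup>2) \<noteq> 0" if "y \<in> S" for y
  proof (cases "c > 0")
    case True
    thus ?thesis using add_pos_nonneg[OF True sum_power2_ge_zero, of "fst y - fst q" "snd y - snd q"] by linarith
  next
    case False
    hence "fst y \<noteq> fst q \<or> snd y \<noteq> snd q" using assms that by (metis less_eq_real_def prod.expand)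
    hence "(fst y - fst q)\<^sup>2 + (snd y - snd q)\<^sup>2 > 0" by (auto simp: sum_power2_gt_zero_iff)
    thus ?thesis using assms by simp
  qed
  show ?thesis unfolding log_sq_def by (intro continuous_intros) (use pos in auto)
qed

definition barrier :: "real \<times> real \<Rightarrow> real \<times> real \<Rightarrow> real" where
  "barrier p y = ((log_sq 0 (1, 0) y + log_sq 0 (-1, 0) y) + (-6) * log_sq 0 p y)
     + 2 * log_sq 1 (0, 0) y"

lemma log_sq_le:
  assumes "c \<in> {0, 1}" "\<bar>q\<bar> \<le> 1" "r > 0" "(fst y - fst p)\<^sup>2 + (snd y - snd p)\<^sup>2 \<ge> r"
  shows "log_sq c (q, 0) y \<le>
    log_sq 0 p y + ln (2 + (1 + 2 * ((\<bar>fst p\<bar> + 1)\<^sup>2 + (snd p)\<^sup>2)) / r)"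
proof -
  define Q where "Q = (fst y - fst p)\<^sup>2 + (snd y - snd p)\<^sup>2"
  define k where "k = 1 + 2 * ((\<bar>fst p\<bar> + 1)\<^sup>2 + (snd p)\<^sup>2)"
  have Q: "Q > 0" "Q \<ge> r" using assms by (auto simp: Q_def)
  have k: "k \<ge> 1" by (simp add: k_def)
  have sq: "(a - b)\<^sup>2 \<le> 2 * (a - d)\<^sup>2 + 2 * (d - b)\<^sup>2" for a b d :: real
    using zero_le_power2[of "a + b - 2 * d"] by (simp add: power2_eq_square algebra_simps)
  have "(fst p - q)\<^sup>2 \<le> (\<bar>fst p\<bar> + 1)\<^sup>2"
    using assms(2) by (intro power2_le_iff_abs_le[THEN iffD2]) auto
  hence "c + ((fst y - q)\<^sup>2 + (snd y - 0)\<^sup>2) \<le> 2 * Q + k"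
    using sq[of "fst y" q "fst p"] sq[of "snd y" 0 "snd p"] assms(1)
    by (auto simp: Q_def k_def)
  moreover have "2 * Q + k \<le> 2 * Q + Q * (k / r)"
    using Q k assms(3) by (simp add: field_simps)
  ultimately have le: "c + ((fst y - q)\<^sup>2 + (snd y - 0)\<^sup>2) \<le> Q * (2 + k / r)"
    by (simp add: algebra_simps)
  have ge1: "1 \<le> Q * (2 + k / r)" using \<open>2 * Q + k \<le> _\<close> Q k by (simp add: algebra_simps)
  have "log_sq c (q, 0) y \<le> ln (Q * (2 + k / r))"
  proof (cases "c + ((fst y - q)\<^sup>2 + (snd y - 0)\<^sup>2) = 0")
    case True
    thus ?thesis using ge1 by (simp add: log_sq_def)
  next
    case False
    moreover have "c + ((fst y - q)\<^sup>2 + (snd y - 0)\<^sup>2) \<ge> 0" using assms(1) by auto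
    ultimately show ?thesis using le ge1 by (simp add: log_sq_def)
  qed
  also have "\<dots> = ln Q + ln (2 + k / r)"
    using Q k assms(3) by (intro ln_mult_pos) (auto intro: add_pos_nonneg)
  finally show ?thesis by (simp add: Q_def k_def log_sq_def)
qed

lemma barrier_bounds:
  assumes "r > 0"
  obtains k where
    "\<And>y. (fst y - fst p)\<^sup>2 + (snd y - snd p)\<^sup>2 \<ge> r \<Longrightarrow> barrier p y \<le> k"
    "\<And>y. (fst y - fst p)\<^sup>2 + (snd y - snd p)\<^sup>2 \<ge> r \<Longrightarrow> barrier p y \<le> k - 2 * log_sq 0 p y"
    "\<And>y. (fst y - fst p)\<^sup>2 + (snd y - snd p)\<^sup>2 \<ge> r \<Longrightarrow> barrier p y \<le> k + log_sq 0 (1, 0) y"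
    "\<And>y. (fst y - fst p)\<^sup>2 + (snd y - snd p)\<^sup>2 \<ge> r \<Longrightarrow> barrier p y \<le> k + log_sq 0 (-1, 0) y"
proof -
  define l where "l = ln (2 + (1 + 2 * ((\<bar>fst p\<bar> + 1)\<^sup>2 + (snd p)\<^sup>2)) / r)"
  define k where "k = max (max (4 * l) (4 * l - 2 * ln r)) (3 * l - 3 * ln r)"
  have *: "barrier p y \<le> k \<and> barrier p y \<le> k - 2 * log_sq 0 p y \<and>
      barrier p y \<le> k + log_sq 0 (1, 0) y \<and> barrier p y \<le> k + log_sq 0 (-1, 0) y"
    if y: "(fst y - fst p)\<^sup>2 + (snd y - snd p)\<^sup>2 \<ge> r" for y
  proof -
    have 1: "log_sq 0 (1, 0) y \<le> log_sq 0 p y + l" "log_sq 0 (-1, 0) y \<le> log_sq 0 p y + l"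
      "log_sq 1 (0, 0) y \<le> log_sq 0 p y + l"
      unfolding l_def using assms y by (intro log_sq_le; simp)+
    have "log_sq 0 p y \<ge> ln r" using y assms by (simp add: log_sq_def)
    thus ?thesis using 1 unfolding barrier_def k_def by linarith
  qed
  show ?thesis by (rule that[of k]) (use * in auto)
qed

lemma barrier_normal_deriv:
  assumes "\<bar>x\<bar> \<noteq> 1" "snd p > 0"
  shows "\<exists>l>0. ((\<lambda>t. barrier p (x, t)) has_real_derivative l) (at 0 within A)"
proof -
  have L: "((\<lambda>t. log_sq c q (x, t)) has_real_derivative
     - 2 * snd q / (c + ((x - fst q)\<^sup>2 + (snd q)\<^sup>2))) (at 0 within A)"
    if "c + ((x - fst q)\<^sup>2 + (snd q)\<^sup>2) > 0" for c q
    unfolding log_sq_def fst_conv snd_conv using that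
    by (auto intro!: derivative_eq_intros simp: power2_eq_square field_simps)
  have pos: "(x - fst p)\<^sup>2 + (snd p)\<^sup>2 > 0" using assms by (simp add: add_nonneg_pos)
  have x: "(x - 1)\<^sup>2 > 0" "(x + 1)\<^sup>2 > 0" using assms(1) by auto
  have D: "((\<lambda>t. barrier p (x, t)) has_real_derivative
     ((0 + 0) + (-6) * (- 2 * snd p / ((x - fst p)\<^sup>2 + (snd p)\<^sup>2))) + 2 * 0) (at 0 within A)"
    unfolding barrier_def
    using L[of 0 "(1,0)"] L[of 0 "(-1,0)"] L[of 0 p] L[of 1 "(0,0)"] pos x
    by (intro DERIV_add DERIV_cmult) (auto simp: add_pos_nonneg)
  thus ?thesis using pos assms(2) by (intro exI conjI) (auto intro!: divide_pos_pos)
qed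

lemma barrier_has_laplacian_on:
  "has_laplacian_on (halfplane - {p}) (barrier p)
     (\<lambda>y. 8 / (1 + ((fst y)\<^sup>2 + (snd y)\<^sup>2))\<^sup>2)"
proof -
  have L: "has_laplacian_on (halfplane - {p}) (log_sq 0 q) (\<lambda>y. 0)" if "q \<notin> halfplane - {p}" for q
    using log_sq_has_laplacian_on[of 0 q "halfplane - {p}"] that by simp
  have M: "has_laplacian_on (halfplane - {p}) (log_sq 1 (0, 0))
      (\<lambda>y. 4 / (1 + ((fst y)\<^sup>2 + (snd y)\<^sup>2))\<^sup>2)"
    using log_sq_has_laplacian_on[of 1 "(0, 0)" "halfplane - {p}"] by simp
  show ?thesis
    using has_laplacian_on_add[OF has_laplacian_on_add[OF has_laplacian_on_add[OF L[of "(1,0)"]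
       L[of "(-1,0)"]] has_laplacian_on_cmult[OF L[of p], of "-6"]] has_laplacian_on_cmult[OF M, of 2]]
    unfolding barrier_def[abs_def] by (simp add: halfplane_def)
qed

lemma barrier_continuous_on:
  assumes "(1, 0) \<notin> K" "(-1, 0) \<notin> K" "p \<notin> K"
  shows "continuous_on K (barrier p)"
  unfolding barrier_def[abs_def] using assms
  by (intro continuous_intros log_sq_continuous_on) auto

lemma halfplane_subset_closed: "halfplane \<subseteq> closed_halfplane"
  by (auto simp: halfplane_def closed_halfplane_def)

text \<open>The barrier tends to \<open>-\<infinity>\<close> at \<open>(\<plusminus>1, 0)\<close> and at infinity, is strictly subharmonic away from
  its pole \<open>p\<close>, and has strictly negative outward normal derivative. So \<open>E + \<delta> barrier\<close> can only be
  large near \<open>p\<close>; shrinking the excluded disc around \<open>p\<close> leaves \<open>E p\<close> itself.\<close>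

lemma halfplane_max_principle:
  fixes E :: "real \<times> real \<Rightarrow> real"
  assumes cont: "continuous_on closed_halfplane E"
    and lap: "has_laplacian_on halfplane E (\<lambda>_. 0)"
    and bd: "\<And>y. y \<in> closed_halfplane \<Longrightarrow> E y \<le> M"
    and bc: "\<And>x. \<bar>x\<bar> \<noteq> 1 \<Longrightarrow> E (x, 0) \<le> m \<or> (\<exists>d\<le>0. has_normal_deriv E d x)"
    and y0: "y0 \<in> halfplane" and p: "p \<in> halfplane"
  shows "E y0 \<le> max (E p) m"
proof (rule ccontr)
  assume neg: "\<not> E y0 \<le> max (E p) m"
  hence ne: "y0 \<noteq> p" by auto
  obtain M' where M': "max (E p) m < M'" "M' < E y0" using neg dense[of "max (E p) m" "E y0"] by (meson not_le)
  have "continuous_on halfplane E"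
    using cont halfplane_subset_closed by (rule continuous_on_subset)
  hence "isCont E p" using p open_halfplane continuous_on_eq_continuous_at by blast
  hence "\<forall>\<^sub>F y in at p. E y < M'"
    using M' unfolding isCont_def by (intro order_tendstoD(2)) auto
  then obtain r1 where r1: "r1 > 0" "\<And>y. dist y p < r1 \<Longrightarrow> y \<noteq> p \<Longrightarrow> E y < M'"
    unfolding eventually_at by auto
  define r where "r = min (r1 / 2) (dist y0 p)"
  have r: "r > 0" "r < r1" "r \<le> dist y0 p" using r1 ne by (auto simp: r_def)
  have Er: "E y < M'" if "dist y p \<le> r" for y
    using that r1(2)[of y] r M' by (cases "y = p") auto
  define Q where "Q = (\<lambda>y::real\<times>real. (fst y - fst p)\<^sup>2 + (snd y - snd p)\<^sup>2)"
  have Qd: "Q y = (dist y p)\<^sup>2" for y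
    by (simp add: Q_def dist_prod_def dist_real_def)
  define D1 where "D1 = (\<lambda>y::real\<times>real. (fst y - 1)\<^sup>2 + (snd y)\<^sup>2)"
  define D2 where "D2 = (\<lambda>y::real\<times>real. (fst y + 1)\<^sup>2 + (snd y)\<^sup>2)"
  have L: "log_sq 0 p y = ln (Q y)" "log_sq 0 (1, 0) y = ln (D1 y)" "log_sq 0 (-1, 0) y = ln (D2 y)" for y
    by (auto simp: log_sq_def Q_def D1_def D2_def)
  obtain k where k: "\<And>y. Q y \<ge> r\<^sup>2 \<Longrightarrow> barrier p y \<le> k"
    "\<And>y. Q y \<ge> r\<^sup>2 \<Longrightarrow> barrier p y \<le> k - 2 * ln (Q y)"
    "\<And>y. Q y \<ge> r\<^sup>2 \<Longrightarrow> barrier p y \<le> k + ln (D1 y)"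
    "\<And>y. Q y \<ge> r\<^sup>2 \<Longrightarrow> barrier p y \<le> k + ln (D2 y)"
  proof (rule barrier_bounds[of "r\<^sup>2" p])
    show "r\<^sup>2 > 0" using r(1) by simp
  next
    fix k
    assume "\<And>y. (fst y - fst p)\<^sup>2 + (snd y - snd p)\<^sup>2 \<ge> r\<^sup>2 \<Longrightarrow> barrier p y \<le> k"
      "\<And>y. (fst y - fst p)\<^sup>2 + (snd y - snd p)\<^sup>2 \<ge> r\<^sup>2 \<Longrightarrow> barrier p y \<le> k - 2 * log_sq 0 p y"
      "\<And>y. (fst y - fst p)\<^sup>2 + (snd y - snd p)\<^sup>2 \<ge> r\<^sup>2 \<Longrightarrow> barrier p y \<le> k + log_sq 0 (1, 0) y"
      "\<And>y. (fst y - fst p)\<^sup>2 + (snd y - snd p)\<^sup>2 \<ge> r\<^sup>2 \<Longrightarrow> barrier p y \<le> k + log_sq 0 (-1, 0) y"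
    thus thesis by (intro that[of k]) (simp_all only: L Q_def)
  qed
  have cQ: "continuous_on A Q" "continuous_on A D1" "continuous_on A D2" for A
    unfolding Q_def D1_def D2_def by (intro continuous_intros)+
  define \<delta> where "\<delta> = (E y0 - M') / (1 + \<bar>k - barrier p y0\<bar>)"
  have \<delta>: "\<delta> > 0" "\<delta> * (k - barrier p y0) < E y0 - M'"
  proof -
    show *: "\<delta> > 0" using M' by (simp add: \<delta>_def)
    have "\<delta> * (k - barrier p y0) < \<delta> * (1 + \<bar>k - barrier p y0\<bar>)"
      using * by (intro mult_strict_left_mono) auto
    also have "\<dots> = E y0 - M'" by (simp add: \<delta>_def)
    finally show "\<delta> * (k - barrier p y0) < E y0 - M'" .
  qed
  define F where "F = (\<lambda>y. E y + \<delta> * barrier p y)"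
  have F0: "M' + \<delta> * k < F y0" using \<delta> by (simp add: F_def algebra_simps)
  define T where "T = (F y0 - M) / \<delta> - k - 1"
  have T: "M + \<delta> * (k + T) < F y0" using \<delta>(1) by (simp add: T_def field_simps)
  have Fle: "F y \<le> M + \<delta> * v" if "y \<in> closed_halfplane" "barrier p y \<le> v" for y v
    using bd[OF that(1)] that(2) \<delta>(1) by (simp add: F_def add_mono)
  define \<rho> where "\<rho> = exp T"
  define R where "R = exp (- T / 2)"
  have far: "\<rho> < D1 y \<and> \<rho> < D2 y \<and> Q y < R \<or> y \<in> {(1, 0), (-1, 0)}"
    if "y \<in> closed_halfplane" "Q y \<ge> r\<^sup>2" "F y0 \<le> F y" for y
  proof -
    have "D1 y \<le> \<rho> \<Longrightarrow> y \<noteq> (1, 0) \<Longrightarrow> False"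
    proof -
      assume "D1 y \<le> \<rho>" "y \<noteq> (1, 0)"
      hence "D1 y > 0" by (cases y) (auto simp: D1_def sum_power2_gt_zero_iff)
      hence "ln (D1 y) \<le> T" using \<open>D1 y \<le> \<rho>\<close> unfolding \<rho>_def by (metis ln_exp ln_mono)
      hence "F y \<le> M + \<delta> * (k + T)" using k(3)[OF that(2)] by (intro Fle that) auto
      thus False using T that(3) by simp
    qed
    moreover have "D2 y \<le> \<rho> \<Longrightarrow> y \<noteq> (-1, 0) \<Longrightarrow> False"
    proof -
      assume "D2 y \<le> \<rho>" "y \<noteq> (-1, 0)"
      hence "D2 y > 0" by (cases y) (auto simp: D2_def sum_power2_gt_zero_iff)
      hence "ln (D2 y) \<le> T" using \<open>D2 y \<le> \<rho>\<close> unfolding \<rho>_def by (metis ln_exp ln_mono)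
      hence "F y \<le> M + \<delta> * (k + T)" using k(4)[OF that(2)] by (intro Fle that) auto
      thus False using T that(3) by simp
    qed
    moreover have "Q y \<ge> R \<Longrightarrow> False"
    proof -
      assume "Q y \<ge> R"
      hence "ln (Q y) \<ge> - T / 2" unfolding R_def by (metis exp_gt_zero ln_exp ln_mono)
      hence "F y \<le> M + \<delta> * (k + T)" using k(2)[OF that(2)] by (intro Fle that) auto
      thus False using T that(3) by simp
    qed
    ultimately show ?thesis by force
  qed
  define K where "K = {y \<in> closed_halfplane. \<rho> \<le> D1 y \<and> \<rho> \<le> D2 y \<and> r\<^sup>2 \<le> Q y \<and> Q y \<le> R}"
  have "\<rho> > 0" by (simp add: \<rho>_def)
  have Q0: "Q y0 \<ge> r\<^sup>2" using r by (simp add: Qd power_mono)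
  have y0K: "y0 \<in> K"
    using far[of y0] Q0 y0 unfolding K_def by (auto simp: halfplane_def closed_halfplane_def)
  have Keq: "K = closed_halfplane \<inter> {y. \<rho> \<le> D1 y} \<inter> {y. \<rho> \<le> D2 y} \<inter> {y. r\<^sup>2 \<le> Q y} \<inter> {y. Q y \<le> R}"
    by (auto simp: K_def)
  have "closed K"
    unfolding Keq by (intro closed_Int closed_closed_halfplane closed_Collect_le cQ continuous_on_const)
  moreover have "K \<subseteq> cball p (sqrt R)"
    unfolding K_def Qd by (auto simp: dist_commute real_le_rsqrt)
  ultimately have K: "compact K"
    by (meson bounded_cball bounded_subset compact_eq_bounded_closed)
  have notK: "(1, 0) \<notin> K" "(-1, 0) \<notin> K" "p \<notin> K"
    using \<open>\<rho> > 0\<close> r(1) by (auto simp: K_def D1_def D2_def Qd)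
  have "continuous_on K F"
    unfolding F_def using notK
    by (intro continuous_intros barrier_continuous_on continuous_on_subset[OF cont]) (auto simp: K_def)
  then obtain z where z: "z \<in> K" "\<And>y. y \<in> K \<Longrightarrow> F y \<le> F z"
    using continuous_attains_sup[OF K, of F] y0K by blast
  have zc: "z \<in> closed_halfplane" "Q z \<ge> r\<^sup>2" "F y0 \<le> F z" using z y0K by (auto simp: K_def)
  have strict: "\<rho> < D1 z" "\<rho> < D2 z" "Q z < R" using far[OF zc] z(1) notK by auto
  have small: "E z > M'"
  proof (rule ccontr)
    assume "\<not> E z > M'"
    hence "F z \<le> M' + \<delta> * k"
      unfolding F_def using k(1)[OF zc(2)] \<delta>(1) by (intro add_mono mult_left_mono) auto
    thus False using F0 zc by simp
  qed
  have "dist z p > r" using Er[of z] small by force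
  hence strict': "r\<^sup>2 < Q z" unfolding Qd using r(1) by (simp add: power_strict_mono)
  define U where "U = {y. \<rho> < D1 y} \<inter> {y. \<rho> < D2 y} \<inter> {y. r\<^sup>2 < Q y} \<inter> {y. Q y < R}"
  have U: "open U" "z \<in> U" "U \<inter> closed_halfplane \<subseteq> K"
    using strict strict' unfolding U_def K_def
    by (auto intro!: open_Int open_Collect_less cQ)
  show False
  proof (cases "z \<in> halfplane")
    case True
    have lapF: "has_laplacian_on (halfplane - {p}) F
        (\<lambda>y. 0 + \<delta> * (8 / (1 + ((fst y)\<^sup>2 + (snd y)\<^sup>2))\<^sup>2))"
      unfolding F_def
      by (intro has_laplacian_on_add has_laplacian_on_cmult barrier_has_laplacian_on
          has_laplacian_on_subset[OF lap]) auto
    have "p \<notin> U" using r(1) by (auto simp: U_def Qd)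
    show False
    proof (rule pos_laplacian_no_max)
      show "open (U \<inter> halfplane)" using U open_halfplane by blast
      show "z \<in> U \<inter> halfplane" using U True by blast
      show "has_laplacian_on (U \<inter> halfplane) F
        (\<lambda>y. 0 + \<delta> * (8 / (1 + ((fst y)\<^sup>2 + (snd y)\<^sup>2))\<^sup>2))"
        using \<open>p \<notin> U\<close> by (intro has_laplacian_on_subset[OF lapF]) auto
      have "1 + ((fst z)\<^sup>2 + (snd z)\<^sup>2) > 0" by (simp add: add_pos_nonneg)
      thus "0 + \<delta> * (8 / (1 + ((fst z)\<^sup>2 + (snd z)\<^sup>2))\<^sup>2) > 0" using \<delta>(1) by simp
      show "F y \<le> F z" if "y \<in> U \<inter> halfplane" for y
        using that z(2) U(3) halfplane_subset_closed by blast
    qed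
  next
    case False
    then obtain x where x: "z = (x, 0)"
      using zc(1) by (cases z) (auto simp: halfplane_def closed_halfplane_def)
    have x1: "\<bar>x\<bar> \<noteq> 1"
      using strict \<open>\<rho> > 0\<close> unfolding x D1_def D2_def by (auto simp: abs_if split: if_splits)
    have "\<not> E (x, 0) \<le> m" using small M' x by auto
    then obtain d where d: "d \<le> 0" "has_normal_deriv E d x" using bc[OF x1] by auto
    have "snd p > 0" using p by (simp add: halfplane_def)
    from barrier_normal_deriv[OF x1 this] obtain l where
      l: "l > 0" "((\<lambda>t. barrier p (x, t)) has_real_derivative l) (at 0 within {0..})" by blast
    have "((\<lambda>t. F (x, t)) has_real_derivative - d + \<delta> * l) (at 0 within {0..})"
      unfolding F_def using d(2) l(2) unfolding has_normal_deriv_def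
      by (intro DERIV_add DERIV_cmult)
    moreover have "- d + \<delta> * l > 0" using mult_pos_pos[OF \<delta>(1) l(1)] d(1) by linarith
    ultimately obtain e where e: "e > 0" "\<And>h. h > 0 \<Longrightarrow> 0 + h \<in> {0..} \<Longrightarrow> h < e \<Longrightarrow> F (x, 0) < F (x, 0 + h)"
      using has_real_derivative_pos_inc_right[of "\<lambda>t. F (x, t)"] by blast
    obtain e' where e': "e' > 0" "ball z e' \<subseteq> U" using U openE by blast
    define h where "h = min e e' / 2"
    have h: "h > 0" "h < e" "h < e'" using e(1) e'(1) by (auto simp: h_def)
    have "(x, h) \<in> U" using h by (intro subsetD[OF e'(2)]) (simp add: x dist_Pair_Pair dist_real_def)
    hence "(x, h) \<in> K" using U(3) h by (auto simp: closed_halfplane_def)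
    thus False using z(2) e(2)[of h] h x by force
  qed
qed

lemma halfplane_closure_eqI:
  assumes "continuous_on closed_halfplane u" "continuous_on closed_halfplane v"
    and "\<And>y. y \<in> halfplane \<Longrightarrow> u y = v y" and "y \<in> closed_halfplane"
  shows "u y = (v y :: real)"
proof -
  obtain x t where y: "y = (x, t)" by force
  have lim: "((\<lambda>s. w (x, t + s)) \<longlongrightarrow> w (x, t)) (at_right 0)" if "continuous_on closed_halfplane w"
    for w :: "real \<times> real \<Rightarrow> real"
  proof -
    have "continuous_on {0..} (\<lambda>s. w (x, t + s))"
      by (rule continuous_on_compose2[OF that])
        (use assms(4) y in \<open>auto intro!: continuous_intros simp: closed_halfplane_def\<close>)
    hence "((\<lambda>s. w (x, t + s)) \<longlongrightarrow> w (x, t + 0)) (at 0 within {0..})"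
      unfolding continuous_on_def by (metis atLeast_iff order_refl)
    thus ?thesis by (auto intro: tendsto_within_subset)
  qed
  have "eventually (\<lambda>s. u (x, t + s) = v (x, t + s)) (at_right 0)"
    unfolding eventually_at_right_field
    using assms(3,4) y by (intro exI[of _ 1]) (auto simp: halfplane_def closed_halfplane_def)
  hence "((\<lambda>s. v (x, t + s)) \<longlongrightarrow> u (x, t)) (at_right 0)"
    using lim[OF assms(1)] by (rule Lim_transform_eventually[rotated])
  thus ?thesis using lim[OF assms(2)] y tendsto_unique[of "at_right (0::real)"] by simp
qed

lemma halfplane_Liouville:
  fixes E :: "real \<times> real \<Rightarrow> real"
  assumes cont: "continuous_on closed_halfplane E"
    and lap: "has_laplacian_on halfplane E (\<lambda>_. 0)"
    and bd: "\<And>y. y \<in> closed_halfplane \<Longrightarrow> E y \<le> M"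
    and bc: "\<And>x. \<bar>x\<bar> \<noteq> 1 \<Longrightarrow> has_normal_deriv E 0 x"
  obtains c where "\<And>y. y \<in> closed_halfplane \<Longrightarrow> E y = c"
proof -
  have le: "E y \<le> E p" if "y \<in> halfplane" "p \<in> halfplane" for y p
    using halfplane_max_principle[OF cont lap bd, of "E p" y p] bc that by auto
  have "E y = E (0, 1)" if "y \<in> closed_halfplane" for y
    by (rule halfplane_closure_eqI[OF cont _ _ that])
      (use le[of _ "(0, 1)"] le[of "(0, 1)"] in \<open>auto intro!: antisym simp: halfplane_def\<close>)
  thus ?thesis by (rule that)
qed

lemma halfplane_Dirichlet_Neumann_nonpos:
  fixes E :: "real \<times> real \<Rightarrow> real"
  assumes cont: "continuous_on closed_halfplane E"
    and lap: "has_laplacian_on halfplane E (\<lambda>_. 0)"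
    and bd: "\<And>y. y \<in> closed_halfplane \<Longrightarrow> E y \<le> M"
    and bc: "\<And>x. \<bar>x\<bar> > 1 \<Longrightarrow> has_normal_deriv E 0 x" "\<And>x. \<bar>x\<bar> < 1 \<Longrightarrow> E (x, 0) = 0"
    and y: "y \<in> halfplane"
  shows "E y \<le> 0"
proof -
  have bc': "E (x, 0) \<le> 0 \<or> (\<exists>d\<le>0. has_normal_deriv E d x)" if "\<bar>x\<bar> \<noteq> 1" for x
    using bc(1)[of x] bc(2)[of x] that by (cases "\<bar>x\<bar>" "1::real" rule: linorder_cases) auto
  have le: "E y \<le> max (E (0, t)) 0" if "t > 0" for t
    using halfplane_max_principle[OF cont lap bd bc' y, of "(0, t)"] that
    by (simp add: halfplane_def)
  have "continuous_on {0..} (\<lambda>t. E (0, t))"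
    by (rule continuous_on_compose2[OF cont]) (auto intro!: continuous_intros simp: closed_halfplane_def)
  hence "((\<lambda>t. E (0, t)) \<longlongrightarrow> E (0, 0)) (at 0 within {0..})"
    unfolding continuous_on_def by (metis atLeast_iff order_refl)
  hence "((\<lambda>t. E (0, t)) \<longlongrightarrow> 0) (at_right 0)"
    using bc(2)[of 0] by (auto intro: tendsto_within_subset)
  hence "((\<lambda>t. max (E (0, t)) 0) \<longlongrightarrow> max 0 0) (at_right 0)" by (intro tendsto_max tendsto_const)
  moreover have "eventually (\<lambda>t. E y \<le> max (E (0, t)) 0) (at_right 0)"
    unfolding eventually_at_right_field using le by (intro exI[of _ 1]) auto
  ultimately show ?thesis using tendsto_lowerbound[of _ _ "at_right (0::real)" "E y"] by fastforce
qed

section \<open>The inverse Joukowski map\<close>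

text \<open>The branch of \<open>sqrt (1 - z\<^sup>2)\<close> with positive real part in the open upper half-plane; the
  rotation by \<open>- \<i>\<close> makes it continuous up to the real axis.\<close>

definition joukowski_sqrt :: "complex \<Rightarrow> complex" where
  "joukowski_sqrt z = csqrt (- \<i> * (z - 1)) * csqrt (- \<i> * (z + 1))"

definition joukowski_inv :: "complex \<Rightarrow> complex" where
  "joukowski_inv z = z - \<i> * joukowski_sqrt z"

lemma joukowski_sqrt_power2: "(joukowski_sqrt z)\<^sup>2 = 1 - z\<^sup>2"
  by (simp add: joukowski_sqrt_def power_mult_distrib) (simp add: power2_eq_square algebra_simps)

lemma csqrt_Re_ge_abs_Im: "Re a \<ge> 0 \<Longrightarrow> \<bar>Im (csqrt a)\<bar> \<le> Re (csqrt a)"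
  and csqrt_Re_gt_abs_Im: "Re a > 0 \<Longrightarrow> \<bar>Im (csqrt a)\<bar> < Re (csqrt a)"
proof -
  have *: "(Re (csqrt a))\<^sup>2 - (Im (csqrt a))\<^sup>2 = Re a"
    by (metis power2_csqrt Re_power2)
  have p: "Re (csqrt a) \<ge> 0" using csqrt_principal[of a] by auto
  show "Re a \<ge> 0 \<Longrightarrow> \<bar>Im (csqrt a)\<bar> \<le> Re (csqrt a)"
    using * p by (metis abs_le_square_iff abs_of_nonneg diff_ge_0_iff_ge)
  show "Re a > 0 \<Longrightarrow> \<bar>Im (csqrt a)\<bar> < Re (csqrt a)"
    using * p by (metis abs_le_square_iff abs_of_nonneg diff_gt_0_iff_gt not_le)
qed

lemma Re_joukowski_sqrt_pos:
  assumes "Im z > 0" shows "Re (joukowski_sqrt z) > 0"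
proof -
  define a b where "a = csqrt (- \<i> * (z - 1))" and "b = csqrt (- \<i> * (z + 1))"
  have "\<bar>Im a\<bar> < Re a" "\<bar>Im b\<bar> < Re b"
    using assms unfolding a_def b_def by (intro csqrt_Re_gt_abs_Im; simp)+
  hence "\<bar>Im a\<bar> * \<bar>Im b\<bar> < Re a * Re b" by (intro mult_strict_mono) auto
  hence "Im a * Im b < Re a * Re b" by (metis abs_ge_self abs_mult le_less_trans)
  thus ?thesis by (simp add: joukowski_sqrt_def a_def b_def)
qed

lemma Re_joukowski_sqrt_nonneg:
  assumes "Im z \<ge> 0" shows "Re (joukowski_sqrt z) \<ge> 0"
proof -
  define a b where "a = csqrt (- \<i> * (z - 1))" and "b = csqrt (- \<i> * (z + 1))"
  have "\<bar>Im a\<bar> \<le> Re a" "\<bar>Im b\<bar> \<le> Re b"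
    using assms unfolding a_def b_def by (intro csqrt_Re_ge_abs_Im; simp)+
  hence "\<bar>Im a\<bar> * \<bar>Im b\<bar> \<le> Re a * Re b" by (intro mult_mono) auto
  hence "Im a * Im b \<le> Re a * Re b" by (metis abs_ge_self abs_mult order_trans)
  thus ?thesis by (simp add: joukowski_sqrt_def a_def b_def)
qed

lemma joukowski_inv_equation: "joukowski_inv z * (2 * z - joukowski_inv z) = 1"
  using joukowski_sqrt_power2[of z]
  by (simp add: joukowski_inv_def power2_eq_square algebra_simps)

lemma joukowski_inv_nonzero: "joukowski_inv z \<noteq> 0"
  using joukowski_inv_equation[of z] by auto

lemma has_field_derivative_joukowski_sqrt:
  assumes "Im z > 0"
  shows "(joukowski_sqrt has_field_derivative - z / joukowski_sqrt z) (at z)"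
proof -
  have nz: "- \<i> * (z - 1) \<notin> \<real>\<^sub>\<le>\<^sub>0" "- \<i> * (z + 1) \<notin> \<real>\<^sub>\<le>\<^sub>0"
    using assms by (auto simp: complex_nonpos_Reals_iff)
  define a b where "a = csqrt (- \<i> * (z - 1))" and "b = csqrt (- \<i> * (z + 1))"
  have "(joukowski_sqrt has_field_derivative (- \<i> / (2 * a)) * b + (- \<i> / (2 * b)) * a) (at z)"
    unfolding joukowski_sqrt_def[abs_def] a_def b_def
    using nz by (auto intro!: derivative_eq_intros)
  moreover have "(- \<i> / (2 * a)) * b + (- \<i> / (2 * b)) * a = - z / joukowski_sqrt z"
  proof -
    have "a \<noteq> 0" "b \<noteq> 0" using nz by (auto simp: a_def b_def)
    hence "(- \<i> / (2 * a)) * b + (- \<i> / (2 * b)) * a = - \<i> * (b\<^sup>2 + a\<^sup>2) / (2 * (a * b))"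
      by (simp add: field_simps power2_eq_square)
    also have "b\<^sup>2 + a\<^sup>2 = - 2 * \<i> * z" by (simp add: a_def b_def algebra_simps)
    finally show ?thesis by (simp add: joukowski_sqrt_def a_def b_def)
  qed
  ultimately show ?thesis by simp
qed

lemma has_field_derivative_joukowski_inv:
  assumes "Im z > 0"
  shows "(joukowski_inv has_field_derivative \<i> * joukowski_inv z / joukowski_sqrt z) (at z)"
proof -
  have "joukowski_sqrt z \<noteq> 0" using Re_joukowski_sqrt_pos[OF assms] by auto
  hence "1 - \<i> * (- z / joukowski_sqrt z) = \<i> * joukowski_inv z / joukowski_sqrt z"
    by (simp add: joukowski_inv_def field_simps)
  moreover have "(joukowski_inv has_field_derivative 1 - \<i> * (- z / joukowski_sqrt z)) (at z)"
    unfolding joukowski_inv_def[abs_def]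
    by (intro DERIV_diff DERIV_ident DERIV_cmult has_field_derivative_joukowski_sqrt assms)
  ultimately show ?thesis by simp
qed

lemma joukowski_inv_halfplane:
  assumes "Im z > 0"
  shows "Im (joukowski_inv z) < 0" and "cmod (joukowski_inv z) < 1"
proof -
  define w where "w = joukowski_inv z"
  have w0: "w \<noteq> 0" by (simp add: w_def joukowski_inv_nonzero)
  have inv: "2 * z - w = inverse w"
    using joukowski_inv_equation[of z] by (simp add: w_def inverse_unique)
  have "2 * z - w - w = 2 * \<i> * joukowski_sqrt z" by (simp add: w_def joukowski_inv_def)
  hence "Im (inverse w) - Im w = 2 * Re (joukowski_sqrt z)" unfolding inv[symmetric] by (simp add: complex_eq_iff)
  hence pos: "Im (inverse w) > Im w" using Re_joukowski_sqrt_pos[OF assms] by simp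
  have Iminv: "Im (inverse w) = - Im w / (cmod w)\<^sup>2" by (simp add: cmod_power2)
  have cw: "(cmod w)\<^sup>2 > 0" using w0 by simp
  show neg: "Im (joukowski_inv z) < 0"
  proof (rule ccontr)
    assume "\<not> Im (joukowski_inv z) < 0"
    hence "Im w \<ge> 0" by (simp add: w_def)
    moreover from this have "Im (inverse w) \<le> 0" unfolding Iminv using cw by simp
    ultimately show False using pos by simp
  qed
  have "2 * Im z = Im w + Im (inverse w)" unfolding inv[symmetric] by simp
  also have "\<dots> = Im w * ((cmod w)\<^sup>2 - 1) / (cmod w)\<^sup>2" unfolding Iminv using cw by (simp add: field_simps)
  finally have "Im w * ((cmod w)\<^sup>2 - 1) / (cmod w)\<^sup>2 > 0" using assms by simp
  hence "Im w * ((cmod w)\<^sup>2 - 1) > 0" using cw by (simp add: zero_less_divide_iff)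
  hence "(cmod w)\<^sup>2 < 1" using neg by (simp add: w_def zero_less_mult_iff)
  thus "cmod (joukowski_inv z) < 1" by (simp add: w_def power_less_one_iff)
qed

lemma continuous_on_csqrt_Re_nonneg: "continuous_on {a. Re a \<ge> 0} csqrt"
  unfolding continuous_on_eq_continuous_within
proof
  fix a assume a: "a \<in> {a. Re a \<ge> 0}"
  show "continuous (at a within {a. Re a \<ge> 0}) csqrt"
  proof (cases "a = 0")
    case True
    have "((\<lambda>x. sqrt (cmod x)) \<longlongrightarrow> sqrt (cmod 0)) (at 0 within {a. Re a \<ge> 0})"
      by (intro tendsto_intros)
    hence "((\<lambda>x. cmod (csqrt x)) \<longlongrightarrow> 0) (at 0 within {a. Re a \<ge> 0})" by simp
    thus ?thesis unfolding True continuous_within using tendsto_norm_zero_iff by fastforce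
  next
    case False
    hence "a \<notin> \<real>\<^sub>\<le>\<^sub>0" using a by (auto simp: complex_nonpos_Reals_iff complex_eq_iff)
    thus ?thesis by (rule continuous_within_csqrt)
  qed
qed

lemma continuous_on_joukowski_sqrt: "continuous_on {z. Im z \<ge> 0} joukowski_sqrt"
  unfolding joukowski_sqrt_def[abs_def]
  by (intro continuous_intros continuous_on_compose2[OF continuous_on_csqrt_Re_nonneg]) auto

lemma continuous_on_joukowski_inv: "continuous_on {z. Im z \<ge> 0} joukowski_inv"
  unfolding joukowski_inv_def[abs_def]
  by (intro continuous_intros continuous_on_joukowski_sqrt)

lemma joukowski_inv_norm_le_1:
  assumes "Im z \<ge> 0"
  shows "cmod (joukowski_inv z) \<le> 1"
proof -
  have cl: "closure {z. Im z > 0} = {z. Im z \<ge> 0}"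
    using closure_halfspace_gt[of \<i> 0] by (simp add: inner_complex_def)
  show ?thesis
    by (rule continuous_on_closure_norm_le[of "{z. Im z > 0}"])
      (use continuous_on_joukowski_inv assms joukowski_inv_halfplane(2) in
        \<open>auto simp: cl less_imp_le\<close>)
qed

lemma joukowski_sqrt_cos:
  assumes "\<theta> \<in> {0..pi}"
  shows "joukowski_sqrt (of_real (cos \<theta>)) = of_real (sin \<theta>)"
proof -
  have "(joukowski_sqrt (of_real (cos \<theta>)))\<^sup>2 = (of_real (sin \<theta>))\<^sup>2"
    unfolding joukowski_sqrt_power2 of_real_power[symmetric] sin_squared_eq by simp
  hence "joukowski_sqrt (of_real (cos \<theta>)) = of_real (sin \<theta>) \<or>
      joukowski_sqrt (of_real (cos \<theta>)) = - of_real (sin \<theta>)"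
    by (simp only: power2_eq_iff)
  moreover have "sin \<theta> \<ge> 0" using assms by (simp add: sin_ge_zero)
  moreover have "Re (joukowski_sqrt (of_real (cos \<theta>))) \<ge> 0" by (rule Re_joukowski_sqrt_nonneg) simp
  ultimately show ?thesis by (auto simp del: of_real_minus)
qed

lemma joukowski_inv_cos:
  assumes "\<theta> \<in> {0..pi}"
  shows "joukowski_inv (of_real (cos \<theta>)) = cis (- \<theta>)"
  unfolding joukowski_inv_def joukowski_sqrt_cos[OF assms] by (simp add: complex_eq_iff)

lemma joukowski_sqrt_outside:
  assumes "\<bar>x\<bar> > 1"
  shows "Re (joukowski_sqrt (of_real x)) = 0" "joukowski_sqrt (of_real x) \<noteq> 0"
proof -
  define s where "s = joukowski_sqrt (of_real x)"
  have s2: "s\<^sup>2 = of_real (1 - x\<^sup>2)" unfolding s_def joukowski_sqrt_power2 by simp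
  have x: "1 - x\<^sup>2 < 0" using assms by (simp add: abs_square_less_1 one_less_power[of "\<bar>x\<bar>" 2, simplified])
  have "Re (s\<^sup>2) < 0" "Im (s\<^sup>2) = 0" unfolding s2 using x by simp_all
  hence "(Re s)\<^sup>2 - (Im s)\<^sup>2 < 0" "2 * (Re s * Im s) = 0"
 by (auto simp: power2_eq_square)
  hence "Re s = 0" "s \<noteq> 0" by (auto simp: power2_eq_square not_less dest: leD)
  thus "Re (joukowski_sqrt (of_real x)) = 0" "joukowski_sqrt (of_real x) \<noteq> 0"
    unfolding s_def[symmetric] .
qed

definition cpt :: "real \<times> real \<Rightarrow> complex" where
  "cpt y = Complex (fst y) (snd y)"

lemma Re_cpt [simp]: "Re (cpt y) = fst y" and Im_cpt [simp]: "Im (cpt y) = snd y"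
  by (simp_all add: cpt_def)

lemma cpt_real [simp]: "cpt (x, 0) = of_real x"
  by (simp add: complex_eq_iff)

lemma norm_cpt [simp]: "cmod (cpt y) = norm y"
  by (simp add: cmod_def norm_prod_def)

lemma continuous_on_cpt [continuous_intros]:
  "continuous_on S f \<Longrightarrow> continuous_on S (\<lambda>y. cpt (f y))"
  unfolding cpt_def Complex_eq by (intro continuous_intros)

definition disc_pt :: "real \<times> real \<Rightarrow> complex" where
  "disc_pt y = joukowski_inv (cpt y)"

lemma disc_pt_nonzero [simp]: "disc_pt y \<noteq> 0"
  by (simp add: disc_pt_def joukowski_inv_nonzero)

lemma continuous_on_disc_pt: "continuous_on closed_halfplane disc_pt"
  unfolding disc_pt_def[abs_def]
  by (intro continuous_on_compose2[OF continuous_on_joukowski_inv] continuous_intros)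
    (auto simp: closed_halfplane_def)

lemma disc_pt_norm_le_1: "y \<in> closed_halfplane \<Longrightarrow> cmod (disc_pt y) \<le> 1"
  unfolding disc_pt_def by (intro joukowski_inv_norm_le_1) (simp add: closed_halfplane_def)

lemma disc_pt_norm_less_1: "y \<in> halfplane \<Longrightarrow> cmod (disc_pt y) < 1"
  unfolding disc_pt_def by (intro joukowski_inv_halfplane) (simp add: halfplane_def)

lemma disc_pt_cos: "\<theta> \<in> {0..pi} \<Longrightarrow> disc_pt (cos \<theta>, 0) = cis (- \<theta>)"
  by (simp add: disc_pt_def joukowski_inv_cos)

lemma eventually_halfplane_infinity:
  "eventually P halfplane_infinity \<longleftrightarrow> (\<exists>b. \<forall>y\<in>closed_halfplane. b \<le> norm y \<longrightarrow> P y)"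
  unfolding halfplane_infinity_def eventually_inf_principal eventually_at_infinity by blast

lemma halfplane_infinity_neq_bot [simp]: "halfplane_infinity \<noteq> bot"
proof
  assume "halfplane_infinity = bot"
  hence "eventually (\<lambda>_. False) halfplane_infinity" by simp
  then obtain b where "\<forall>y\<in>closed_halfplane. b \<le> norm y \<longrightarrow> False"
    unfolding eventually_halfplane_infinity by auto
  from this[rule_format, of "(0, \<bar>b\<bar>)"] show False
    using abs_ge_self[of b] by (simp add: closed_halfplane_def norm_Pair)
qed

lemma filterlim_norm_halfplane_infinity: "filterlim norm at_top halfplane_infinity"
  unfolding filterlim_at_top eventually_halfplane_infinity by auto

lemma eventually_closed_halfplane: "\<forall>\<^sub>F y in halfplane_infinity. y \<in> closed_halfplane"
  unfolding eventually_halfplane_infinity by auto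

lemma disc_pt_tendsto_0: "(disc_pt \<longlongrightarrow> 0) halfplane_infinity"
proof (rule tendsto_norm_zero_cancel, rule tendsto_sandwich)
  show "\<forall>\<^sub>F y in halfplane_infinity. 0 \<le> cmod (disc_pt y)" by simp
  show "\<forall>\<^sub>F y in halfplane_infinity. cmod (disc_pt y) \<le> inverse (2 * norm y + -1)"
    unfolding eventually_halfplane_infinity
  proof (intro exI ballI impI)
    fix y assume y: "y \<in> closed_halfplane" "1 \<le> norm y"
    have "2 * norm y - 1 \<le> cmod (2 * cpt y) - cmod (disc_pt y)"
      using disc_pt_norm_le_1[OF y(1)] by (simp add: norm_mult)
    also have "\<dots> \<le> cmod (2 * cpt y - disc_pt y)" by (rule norm_triangle_ineq2)
    finally have "cmod (disc_pt y) * (2 * norm y - 1) \<le> cmod (disc_pt y * (2 * cpt y - disc_pt y))"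
      unfolding norm_mult by (intro mult_left_mono) auto
    also have "\<dots> = 1" by (simp add: disc_pt_def joukowski_inv_equation)
    finally show "cmod (disc_pt y) \<le> inverse (2 * norm y + -1)" using y(2) by (simp add: field_simps)
  qed
  have "filterlim (\<lambda>y. 2 * norm y) at_top halfplane_infinity"
    by (intro filterlim_tendsto_pos_mult_at_top[OF tendsto_const] filterlim_norm_halfplane_infinity) auto
  hence "filterlim (\<lambda>y. - 1 + 2 * norm y) at_top halfplane_infinity"
    by (rule filterlim_tendsto_add_at_top[OF tendsto_const])
  thus "((\<lambda>y. inverse (2 * norm y + -1)) \<longlongrightarrow> 0) halfplane_infinity"
    by (intro tendsto_inverse_0_at_top) (simp add: add.commute)
qed (rule tendsto_const)

lemma ln_disc_pt_asymp:
  "((\<lambda>y. - ln (cmod (disc_pt y)) - ln (norm y)) \<longlongrightarrow> ln 2) halfplane_infinity"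
proof -
  have eq: "disc_pt y * cpt y = (1 + (disc_pt y)\<^sup>2) / 2" for y
  proof -
    have "disc_pt y * (2 * cpt y - disc_pt y) = 1" by (simp add: disc_pt_def joukowski_inv_equation)
    thus ?thesis by (simp add: power2_eq_square algebra_simps)
  qed
  have "((\<lambda>y. (1 + (disc_pt y)\<^sup>2) / 2) \<longlongrightarrow> (1 + 0\<^sup>2) / 2) halfplane_infinity"
    by (intro tendsto_intros disc_pt_tendsto_0) auto
  hence "((\<lambda>y. cmod (disc_pt y * cpt y)) \<longlongrightarrow> cmod (1 / 2)) halfplane_infinity"
    unfolding eq by (intro tendsto_norm) simp
  hence "((\<lambda>y. - ln (cmod (disc_pt y * cpt y))) \<longlongrightarrow> - ln (1 / 2)) halfplane_infinity"
    by (intro tendsto_minus tendsto_ln) auto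
  hence lim: "((\<lambda>y. - ln (cmod (disc_pt y * cpt y))) \<longlongrightarrow> ln 2) halfplane_infinity"
    by (simp add: ln_div)
  show ?thesis
  proof (rule Lim_transform_eventually[OF lim])
    show "\<forall>\<^sub>F y in halfplane_infinity. - ln (cmod (disc_pt y * cpt y)) = - ln (cmod (disc_pt y)) - ln (norm y)"
      unfolding eventually_halfplane_infinity
    proof (intro exI ballI impI)
      fix y :: "real \<times> real" assume "1 \<le> norm y"
      hence "norm y > 0" by linarith
      thus "- ln (cmod (disc_pt y * cpt y)) = - ln (cmod (disc_pt y)) - ln (norm y)"
        using ln_mult_pos[of "cmod (disc_pt y)" "norm y"] by (simp add: norm_mult)
    qed
  qed
qed

section \<open>Chebyshev series\<close>

definition cheb_coeff :: "(real \<Rightarrow> real) \<Rightarrow> nat \<Rightarrow> real" where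
  "cheb_coeff h m = integral {0..pi} (\<lambda>\<theta>. h (cos \<theta>) * sin \<theta> * cos (real m * \<theta>))"

lemma M_test_integral_sums:
  fixes f :: "nat \<Rightarrow> real \<Rightarrow> 'a::banach"
  assumes cont: "\<And>n. continuous_on {a..b} (f n)"
    and le: "\<And>n x. x \<in> {a..b} \<Longrightarrow> norm (f n x) \<le> B n" and B: "summable B"
  shows "(\<lambda>n. integral {a..b} (f n)) sums integral {a..b} (\<lambda>x. \<Sum>n. f n x)"
    and "continuous_on {a..b} (\<lambda>x. \<Sum>n. f n x)"
proof -
  have ul: "uniform_limit {a..b} (\<lambda>n x. \<Sum>i<n. f i x) (\<lambda>x. \<Sum>n. f n x) sequentially"
    by (rule Weierstrass_m_test[of "{a..b}" f B]) (use le B in auto)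
  have c: "continuous_on {a..b} (\<lambda>x. \<Sum>i<n. f i x)" for n
    using cont by (intro continuous_intros)
  show "continuous_on {a..b} (\<lambda>x. \<Sum>n. f n x)"
    by (rule uniform_limit_theorem[OF _ ul]) (use c in auto)
  obtain I J where I: "\<And>n. ((\<lambda>x. \<Sum>i<n. f i x) has_integral I n) {a..b}"
    and J: "((\<lambda>x. \<Sum>n. f n x) has_integral J) {a..b}" "(I \<longlongrightarrow> J) sequentially"
    using uniform_limit_integral[OF ul c] by auto
  have "I = (\<lambda>n. \<Sum>i<n. integral {a..b} (f i))"
  proof
    fix n
    have "I n = integral {a..b} (\<lambda>x. \<Sum>i<n. f i x)" by (rule integral_unique[OF I, symmetric])
    also have "\<dots> = (\<Sum>i<n. integral {a..b} (f i))"
      by (intro integral_sum) (auto intro: integrable_continuous_real cont)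
    finally show "I n = (\<Sum>i<n. integral {a..b} (f i))" .
  qed
  thus "(\<lambda>n. integral {a..b} (f n)) sums integral {a..b} (\<lambda>x. \<Sum>n. f n x)"
    using J unfolding sums_def by (simp add: integral_unique)
qed

lemma has_integral_cos_nat:
  "((\<lambda>\<theta>. cos (real k * \<theta>)) has_integral (if k = 0 then pi else 0)) {0..pi}"
proof (cases "k = 0")
  case True
  thus ?thesis using has_integral_const_real[of "1::real" 0 pi] by simp
next
  case False
  have "((\<lambda>\<theta>. cos (real k * \<theta>)) has_integral sin (real k * pi) / real k - sin (real k * 0) / real k) {0..pi}"
    by (rule fundamental_theorem_of_calculus)
      (use False in \<open>auto intro!: derivative_eq_intros simp flip: has_real_derivative_iff_has_vector_derivative\<close>)
  thus ?thesis using False by simp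
qed

lemma has_integral_cos_cos:
  assumes "m \<noteq> 0"
  shows "((\<lambda>\<theta>. cos (real m * \<theta>) * cos (real n * \<theta>)) has_integral (if m = n then pi / 2 else 0)) {0..pi}"
proof -
  define d where "d = (if m \<ge> n then m - n else n - m)"
  have eq: "cos (real m * \<theta>) * cos (real n * \<theta>) = (cos (real d * \<theta>) + cos (real (m + n) * \<theta>)) / 2" for \<theta>
  proof -
    have "cos (real d * \<theta>) = cos (real m * \<theta> - real n * \<theta>)"
      by (cases "m \<ge> n")
        (auto simp: d_def of_nat_diff left_diff_distrib cos_diff)
    thus ?thesis by (simp add: cos_diff cos_add distrib_right)
  qed
  have "((\<lambda>\<theta>. (cos (real d * \<theta>) + cos (real (m + n) * \<theta>)) / 2) has_integral
     ((if d = 0 then pi else 0) + (if m + n = 0 then pi else 0)) / 2) {0..pi}"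
    by (intro has_integral_divide has_integral_add has_integral_cos_nat)
  moreover have "((if d = 0 then pi else 0) + (if m + n = 0 then pi else 0)) / 2 = (if m = n then pi / 2 else 0)"
    using assms by (auto simp: d_def)
  ultimately show ?thesis unfolding eq by simp
qed

lemma Bessel_cos:
  fixes \<kappa> :: "real \<Rightarrow> real"
  assumes \<kappa>: "continuous_on {0..pi} \<kappa>"
  shows "summable (\<lambda>i. (integral {0..pi} (\<lambda>\<theta>. \<kappa> \<theta> * cos (real (Suc i) * \<theta>)))\<^sup>2)"
proof (rule summableI_nonneg_bounded)
  fix M
  define c where "c = (\<lambda>i. integral {0..pi} (\<lambda>\<theta>. \<kappa> \<theta> * cos (real (Suc i) * \<theta>)))"
  define S where "S = (\<lambda>\<theta>. \<Sum>i<M. (2 / pi * c i) * cos (real (Suc i) * \<theta>))"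
  have cS: "continuous_on {0..pi} S" unfolding S_def by (intro continuous_intros)
  have I1: "((\<lambda>\<theta>. \<kappa> \<theta> * S \<theta>) has_integral (\<Sum>i<M. (2 / pi * c i) * c i)) {0..pi}"
  proof -
    have "((\<lambda>\<theta>. \<Sum>i<M. (2 / pi * c i) * (\<kappa> \<theta> * cos (real (Suc i) * \<theta>)))
        has_integral (\<Sum>i<M. (2 / pi * c i) * c i)) {0..pi}"
      unfolding c_def
      by (intro has_integral_sum has_integral_mult_right integrable_integral integrable_continuous_real
          continuous_intros \<kappa>) auto
    thus ?thesis by (simp add: S_def sum_distrib_left mult_ac)
  qed
  have I2: "((\<lambda>\<theta>. S \<theta> * S \<theta>) has_integral (\<Sum>i<M. (2 / pi * c i) * c i)) {0..pi}"
  proof -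
    have "((\<lambda>\<theta>. \<Sum>i<M. \<Sum>j<M. (2 / pi * c i) * (2 / pi * c j) * (cos (real (Suc i) * \<theta>) * cos (real (Suc j) * \<theta>)))
        has_integral (\<Sum>i<M. \<Sum>j<M. (2 / pi * c i) * (2 / pi * c j) * (if Suc i = Suc j then pi / 2 else 0))) {0..pi}"
      by (intro has_integral_sum has_integral_mult_right has_integral_cos_cos) auto
    also have "(\<Sum>i<M. \<Sum>j<M. (2 / pi * c i) * (2 / pi * c j) * (if Suc i = Suc j then pi / 2 else 0))
        = (\<Sum>i<M. (2 / pi * c i) * c i)"
      by (intro sum.cong refl) (simp add: if_distrib[of "\<lambda>x. _ * x"] cong: if_cong)
    finally show ?thesis by (simp add: S_def sum_product mult_ac)
  qed
  have I3: "((\<lambda>\<theta>. \<kappa> \<theta> * \<kappa> \<theta>) has_integral integral {0..pi} (\<lambda>\<theta>. \<kappa> \<theta> * \<kappa> \<theta>)) {0..pi}"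
    by (intro integrable_integral integrable_continuous_real continuous_intros \<kappa>)
  have "((\<lambda>\<theta>. \<kappa> \<theta> * \<kappa> \<theta> - 2 * (\<kappa> \<theta> * S \<theta>) + S \<theta> * S \<theta>) has_integral
     integral {0..pi} (\<lambda>\<theta>. \<kappa> \<theta> * \<kappa> \<theta>) - 2 * (\<Sum>i<M. (2 / pi * c i) * c i) + (\<Sum>i<M. (2 / pi * c i) * c i)) {0..pi}"
    by (intro has_integral_add has_integral_diff has_integral_mult_right I1 I2 I3)
  hence "0 \<le> integral {0..pi} (\<lambda>\<theta>. \<kappa> \<theta> * \<kappa> \<theta>) - 2 * (\<Sum>i<M. (2 / pi * c i) * c i) + (\<Sum>i<M. (2 / pi * c i) * c i)"
  proof (rule has_integral_nonneg)
    fix \<theta>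
    have "\<kappa> \<theta> * \<kappa> \<theta> - 2 * (\<kappa> \<theta> * S \<theta>) + S \<theta> * S \<theta> = (\<kappa> \<theta> - S \<theta>)\<^sup>2"
      by (simp add: power2_eq_square algebra_simps)
    thus "0 \<le> \<kappa> \<theta> * \<kappa> \<theta> - 2 * (\<kappa> \<theta> * S \<theta>) + S \<theta> * S \<theta>" by simp
  qed
  moreover have "(\<Sum>i<M. (2 / pi * c i) * c i) = 2 / pi * (\<Sum>i<M. (c i)\<^sup>2)"
    by (simp add: sum_distrib_left power2_eq_square mult_ac)
  ultimately have "2 / pi * (\<Sum>i<M. (c i)\<^sup>2) \<le> integral {0..pi} (\<lambda>\<theta>. \<kappa> \<theta> * \<kappa> \<theta>)" by simp
  thus "(\<Sum>i<M. (integral {0..pi} (\<lambda>\<theta>. \<kappa> \<theta> * cos (real (Suc i) * \<theta>)))\<^sup>2) \<le>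
      pi / 2 * integral {0..pi} (\<lambda>\<theta>. \<kappa> \<theta> * \<kappa> \<theta>)"
    unfolding fun_cong[OF c_def, symmetric] by (simp add: field_simps del: of_nat_Suc)
qed simp

lemma continuous_on_compose_cos:
  fixes h :: "real \<Rightarrow> real"
  shows "continuous_on {-1..1} h \<Longrightarrow> continuous_on A (\<lambda>\<theta>. h (cos \<theta>))"
  by (erule continuous_on_compose2) (auto intro!: continuous_intros)

text \<open>For \<open>m = 0\<close> the weight is \<open>2 / 0 = 0\<close>, so the constant term of the series vanishes.\<close>

definition cheb_weight :: "nat \<Rightarrow> real" where
  "cheb_weight m = 2 / (pi * real m)"

lemma cheb_weight_0 [simp]: "cheb_weight 0 = 0"
  by (simp add: cheb_weight_def)

lemma cheb_weight_nonneg [simp]: "cheb_weight m \<ge> 0"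
  by (simp add: cheb_weight_def)

definition cheb_series :: "(real \<Rightarrow> real) \<Rightarrow> complex \<Rightarrow> complex" where
  "cheb_series h w = (\<Sum>m. of_real (cheb_weight m * cheb_coeff h m) * w ^ m)"

lemma summable_cheb_coeff_square:
  assumes "continuous_on {-1..1} h"
  shows "summable (\<lambda>m. (cheb_coeff h m)\<^sup>2)"
proof -
  have "summable (\<lambda>m. (cheb_coeff h (Suc m))\<^sup>2)"
    unfolding cheb_coeff_def
    by (rule Bessel_cos) (intro continuous_intros continuous_on_compose_cos assms)
  thus ?thesis by (subst (asm) summable_Suc_iff)
qed

lemma summable_cheb_weight_square: "summable (\<lambda>m. (cheb_weight m)\<^sup>2)"
proof -
  have "summable (\<lambda>m. (2 / pi)\<^sup>2 * inverse (real m ^ 2))"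
    by (intro summable_mult inverse_power_summable) simp
  thus ?thesis by (simp add: cheb_weight_def power_divide power_mult_distrib field_simps)
qed

lemma summable_abs_cheb:
  assumes "continuous_on {-1..1} h"
  shows "summable (\<lambda>m. \<bar>cheb_weight m * cheb_coeff h m\<bar>)"
proof (rule summable_comparison_test')
  show "summable (\<lambda>m. (cheb_weight m)\<^sup>2 + (cheb_coeff h m)\<^sup>2)"
    by (intro summable_add summable_cheb_weight_square summable_cheb_coeff_square assms)
  fix m
  have "2 * (\<bar>cheb_weight m\<bar> * \<bar>cheb_coeff h m\<bar>) \<le> (cheb_weight m)\<^sup>2 + (cheb_coeff h m)\<^sup>2"
    using zero_le_power2[of "\<bar>cheb_weight m\<bar> - \<bar>cheb_coeff h m\<bar>"] by (simp add: power2_diff)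
  moreover have "0 \<le> \<bar>cheb_weight m\<bar> * \<bar>cheb_coeff h m\<bar>" by simp
  ultimately show "norm \<bar>cheb_weight m * cheb_coeff h m\<bar> \<le> (cheb_weight m)\<^sup>2 + (cheb_coeff h m)\<^sup>2"
    unfolding abs_mult real_norm_def abs_abs by linarith
qed

lemma cheb_term_norm_le:
  "cmod w \<le> 1 \<Longrightarrow> cmod (of_real (cheb_weight m * cheb_coeff h m) * w ^ m) \<le> \<bar>cheb_weight m * cheb_coeff h m\<bar>"
  unfolding norm_mult norm_power norm_of_real by (intro mult_left_le power_le_one) auto

lemma summable_cheb_series:
  assumes "continuous_on {-1..1} h" "cmod w \<le> 1"
  shows "summable (\<lambda>m. of_real (cheb_weight m * cheb_coeff h m) * w ^ m)"
  by (rule summable_comparison_test'[OF summable_abs_cheb[OF assms(1)]])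
    (use cheb_term_norm_le[OF assms(2)] in auto)

lemma continuous_on_cheb_series:
  assumes "continuous_on {-1..1} h"
  shows "continuous_on (cball 0 1) (cheb_series h)"
  unfolding cheb_series_def[abs_def]
  by (rule uniform_limit_theorem[OF _ Weierstrass_m_test[OF _ summable_abs_cheb[OF assms]]])
    (auto intro!: continuous_intros always_eventually cheb_term_norm_le simp del: of_real_mult)

lemma cheb_series_0 [simp]: "cheb_series h 0 = 0"
  using powser_zero[of "\<lambda>m. of_real (cheb_weight m * cheb_coeff h m)"] by (simp add: cheb_series_def)

lemma geometric_cos_sums:
  fixes w :: complex
  assumes "cmod w < 1"
  shows "(\<lambda>n. w ^ n * of_real (cos (real (Suc n) * \<theta>))) sums
     ((of_real (cos \<theta>) - w) / (1 - 2 * w * of_real (cos \<theta>) + w\<^sup>2))"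
proof -
  define e where "e = cis \<theta>"
  have e: "cmod e = 1" "e * cnj e = 1" by (simp_all add: e_def cis_mult cis_cnj)
  have c: "of_real (cos \<theta>) = (e + cnj e) / 2" by (simp add: e_def complex_eq_iff)
  have c': "of_real (cos (real (Suc n) * \<theta>)) = (e ^ Suc n + cnj e ^ Suc n) / 2" for n
  proof -
    have a: "e ^ Suc n = cis (real (Suc n) * \<theta>)" unfolding e_def by (rule Complex.DeMoivre)
    have b: "cnj e ^ Suc n = cnj (cis (real (Suc n) * \<theta>))" unfolding a[symmetric] by simp
    show ?thesis unfolding a b by (simp add: complex_eq_iff)
  qed
  have n1: "cmod (w * e) < 1" "cmod (w * cnj e) < 1" using assms e by (simp_all add: norm_mult)
  have nz: "1 - w * e \<noteq> 0" "1 - w * cnj e \<noteq> 0" using n1 by (metis eq_iff_diff_eq_0 less_irrefl norm_one)+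
  have "(\<lambda>n. (e * (w * e) ^ n + cnj e * (w * cnj e) ^ n) / 2) sums
      ((e * (1 / (1 - w * e)) + cnj e * (1 / (1 - w * cnj e))) / 2)"
    by (intro sums_divide sums_add sums_mult geometric_sums n1)
  also have "(e * (1 / (1 - w * e)) + cnj e * (1 / (1 - w * cnj e))) / 2 =
      ((e + cnj e) / 2 - w * (e * cnj e)) / ((1 - w * e) * (1 - w * cnj e))"
    using nz by (simp add: divide_simps) (simp add: algebra_simps)
  also have "(1 - w * e) * (1 - w * cnj e) = 1 - w * (e + cnj e) + w\<^sup>2 * (e * cnj e)"
    by (simp add: algebra_simps power2_eq_square)
  also have "((e + cnj e) / 2 - w * (e * cnj e)) / (1 - w * (e + cnj e) + w\<^sup>2 * (e * cnj e)) =
     (of_real (cos \<theta>) - w) / (1 - 2 * w * of_real (cos \<theta>) + w\<^sup>2)"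
    unfolding e c by simp
  also have "(\<lambda>n. (e * (w * e) ^ n + cnj e * (w * cnj e) ^ n) / 2) =
     (\<lambda>n. w ^ n * of_real (cos (real (Suc n) * \<theta>)))"
    unfolding c' by (simp add: power_mult_distrib field_simps)
  finally show ?thesis .
qed

lemma has_field_derivative_cheb_series:
  assumes h: "continuous_on {-1..1} h" and w: "cmod w < 1"
  shows "(cheb_series h has_field_derivative (2 / of_real pi * integral {0..pi}
     (\<lambda>\<theta>. of_real (h (cos \<theta>) * sin \<theta>) * ((of_real (cos \<theta>) - w) / (1 - 2 * w * of_real (cos \<theta>) + w\<^sup>2))))) (at w)"
proof -
  define c :: "nat \<Rightarrow> complex" where "c = (\<lambda>m. of_real (cheb_weight m * cheb_coeff h m))"
  have D: "(cheb_series h has_field_derivative (\<Sum>n. diffs c n * w ^ n)) (at w)"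
    unfolding cheb_series_def[abs_def] fun_cong[OF c_def, symmetric]
    using summable_cheb_series[OF h, of 1] w by (intro termdiffs_strong[of c 1]) (auto simp: c_def)
  define \<kappa> where "\<kappa> = (\<lambda>\<theta>. h (cos \<theta>) * sin \<theta>)"
  have \<kappa>: "continuous_on {0..pi} \<kappa>"
    unfolding \<kappa>_def by (intro continuous_intros continuous_on_compose_cos h)
  obtain M where M: "\<forall>\<theta>\<in>{0..pi}. \<bar>\<kappa> \<theta>\<bar> \<le> M"
    using compact_imp_bounded[OF compact_continuous_image[OF \<kappa> compact_Icc]]
    unfolding bounded_iff by (auto simp: image_iff)
  have "(\<lambda>n. integral {0..pi} (\<lambda>\<theta>. of_real (\<kappa> \<theta>) * (w ^ n * of_real (cos (real (Suc n) * \<theta>))))) sums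
      integral {0..pi} (\<lambda>\<theta>. \<Sum>n. of_real (\<kappa> \<theta>) * (w ^ n * of_real (cos (real (Suc n) * \<theta>))))"
  proof (rule M_test_integral_sums)
    show "continuous_on {0..pi} (\<lambda>\<theta>. of_real (\<kappa> \<theta>) * (w ^ n * of_real (cos (real (Suc n) * \<theta>))))" for n
      by (intro continuous_intros \<kappa>)
    show "summable (\<lambda>n. M * cmod w ^ n)" using w by (intro summable_mult summable_geometric) auto
    show "cmod (of_real (\<kappa> \<theta>) * (w ^ n * of_real (cos (real (Suc n) * \<theta>)))) \<le> M * cmod w ^ n"
      if "\<theta> \<in> {0..pi}" for n \<theta>
    proof -
      have "cmod w ^ n * \<bar>cos (real (Suc n) * \<theta>)\<bar> \<le> cmod w ^ n" by (intro mult_left_le) auto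
      hence "\<bar>\<kappa> \<theta>\<bar> * (cmod w ^ n * \<bar>cos (real (Suc n) * \<theta>)\<bar>) \<le> M * cmod w ^ n"
        using bspec[OF M that] by (intro mult_mono) auto
      thus ?thesis by (simp only: norm_mult norm_power norm_of_real)
    qed
  qed
  also have "(\<lambda>\<theta>. \<Sum>n. of_real (\<kappa> \<theta>) * (w ^ n * of_real (cos (real (Suc n) * \<theta>)))) =
     (\<lambda>\<theta>. of_real (\<kappa> \<theta>) * ((of_real (cos \<theta>) - w) / (1 - 2 * w * of_real (cos \<theta>) + w\<^sup>2)))"
    by (intro ext sums_unique[symmetric] sums_mult geometric_cos_sums w)
  finally have s: "(\<lambda>n. 2 / of_real pi * integral {0..pi} (\<lambda>\<theta>. of_real (\<kappa> \<theta>) * (w ^ n * of_real (cos (real (Suc n) * \<theta>))))) sums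
    (2 / of_real pi * integral {0..pi} (\<lambda>\<theta>. of_real (\<kappa> \<theta>) * ((of_real (cos \<theta>) - w) / (1 - 2 * w * of_real (cos \<theta>) + w\<^sup>2))))"
    by (rule sums_mult)
  have "2 / of_real pi * integral {0..pi} (\<lambda>\<theta>. of_real (\<kappa> \<theta>) * (w ^ n * of_real (cos (real (Suc n) * \<theta>)))) =
     diffs c n * w ^ n" for n
  proof -
    have i: "(\<lambda>\<theta>. \<kappa> \<theta> * cos (real (Suc n) * \<theta>)) integrable_on {0..pi}"
      by (intro integrable_continuous_real continuous_intros \<kappa>)
    have "integral {0..pi} (\<lambda>\<theta>. of_real (\<kappa> \<theta>) * (w ^ n * of_real (cos (real (Suc n) * \<theta>)))) =
       integral {0..pi} (\<lambda>\<theta>. w ^ n * of_real (\<kappa> \<theta> * cos (real (Suc n) * \<theta>)))"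
      by (simp add: mult_ac)
    also have "\<dots> = w ^ n * integral {0..pi} (\<lambda>\<theta>. of_real (\<kappa> \<theta> * cos (real (Suc n) * \<theta>)))"
      by (rule integral_mult_right)
    also have "integral {0..pi} (\<lambda>\<theta>. complex_of_real (\<kappa> \<theta> * cos (real (Suc n) * \<theta>))) =
       of_real (cheb_coeff h (Suc n))"
      using integral_linear[OF i bounded_linear_of_real[where 'a = complex]]
      unfolding cheb_coeff_def \<kappa>_def o_def by simp
    finally have I: "integral {0..pi} (\<lambda>\<theta>. of_real (\<kappa> \<theta>) * (w ^ n * of_real (cos (real (Suc n) * \<theta>)))) =
       w ^ n * of_real (cheb_coeff h (Suc n))" .
    have "real (Suc n) * cheb_weight (Suc n) = 2 / pi"
      by (simp add: cheb_weight_def divide_simps del: of_nat_Suc)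
    hence "of_nat (Suc n) * complex_of_real (cheb_weight (Suc n)) = 2 / of_real pi"
      by (metis of_real_divide of_real_mult of_real_numeral of_real_of_nat_eq)
    hence "diffs c n = 2 / of_real pi * of_real (cheb_coeff h (Suc n))"
      unfolding diffs_def c_def of_real_mult mult.assoc[symmetric] by (rule arg_cong)
    thus ?thesis unfolding I by (simp only: mult_ac)
  qed
  with s have "(\<lambda>n. diffs c n * w ^ n) sums (2 / of_real pi * integral {0..pi} (\<lambda>\<theta>. of_real (\<kappa> \<theta>) * ((of_real (cos \<theta>) - w) / (1 - 2 * w * of_real (cos \<theta>) + w\<^sup>2))))"
    by simp
  from D[unfolded sums_unique[OF this, symmetric]] show ?thesis unfolding \<kappa>_def .
qed

section \<open>The logarithmic potential of a density on the interval\<close>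

definition potential :: "(real \<Rightarrow> real) \<Rightarrow> real \<times> real \<Rightarrow> real" where
  "potential h y = cheb_coeff h 0 / pi * ln (cmod (disc_pt y)) + Re (cheb_series h (disc_pt y))"

definition complex_potential :: "(real \<Rightarrow> real) \<Rightarrow> complex \<Rightarrow> complex" where
  "complex_potential h z = of_real (cheb_coeff h 0 / pi) * Ln (joukowski_inv z) + cheb_series h (joukowski_inv z)"

lemma Re_complex_potential: "potential h y = Re (complex_potential h (cpt y))"
  by (simp add: potential_def complex_potential_def disc_pt_def joukowski_inv_nonzero)

lemma continuous_on_cheb_series_disc_pt:
  assumes "continuous_on {-1..1} h"
  shows "continuous_on closed_halfplane (\<lambda>y. cheb_series h (disc_pt y))"
  by (rule continuous_on_compose2[OF continuous_on_cheb_series[OF assms] continuous_on_disc_pt])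
    (use disc_pt_norm_le_1 in auto)

lemma continuous_on_ln_disc_pt: "continuous_on closed_halfplane (\<lambda>y. ln (cmod (disc_pt y)))"
  by (intro continuous_intros continuous_on_disc_pt) auto

lemma continuous_on_potential:
  assumes "continuous_on {-1..1} h"
  shows "continuous_on closed_halfplane (potential h)"
  unfolding potential_def[abs_def]
  by (intro continuous_intros continuous_on_cheb_series_disc_pt continuous_on_ln_disc_pt assms)

lemma has_field_derivative_complex_potential:
  assumes h: "continuous_on {-1..1} h" and z: "Im z > 0"
  shows "(complex_potential h has_field_derivative - (1 / of_real pi) *
     integral {0..pi} (\<lambda>\<theta>. of_real (h (cos \<theta>) * sin \<theta>) / (z - of_real (cos \<theta>)))) (at z)"
proof -
  define w s where "w = joukowski_inv z" and "s = joukowski_sqrt z"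
  define \<kappa> where "\<kappa> = (\<lambda>\<theta>. h (cos \<theta>) * sin \<theta>)"
  have \<kappa>: "continuous_on {0..pi} \<kappa>"
    unfolding \<kappa>_def by (intro continuous_intros continuous_on_compose_cos h)
  have w0: "w \<noteq> 0" by (simp add: w_def joukowski_inv_nonzero)
  have s0: "s \<noteq> 0" using Re_joukowski_sqrt_pos[OF z] by (auto simp: s_def)
  have w1: "Im w < 0" "cmod w < 1" using joukowski_inv_halfplane[OF z] by (auto simp: w_def)
  have wnp: "w \<notin> \<real>\<^sub>\<le>\<^sub>0" using w1 by (auto simp: complex_nonpos_Reals_iff)
  have zw: "z - w = \<i> * s" by (simp add: w_def s_def joukowski_inv_def)
  have zc: "z - of_real u \<noteq> 0" for u using z by (auto simp: complex_eq_iff)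
  have quad: "1 - 2 * w * c + w\<^sup>2 = 2 * w * (z - c)" for c
    using joukowski_inv_equation[of z] by (simp add: w_def power2_eq_square algebra_simps)
  let ?I = "integral {0..pi} (\<lambda>\<theta>. of_real (\<kappa> \<theta>) * ((of_real (cos \<theta>) - w) / (1 - 2 * w * of_real (cos \<theta>) + w\<^sup>2)))"
  have i: "(\<lambda>\<theta>. \<kappa> \<theta>) integrable_on {0..pi}" by (intro integrable_continuous_real \<kappa>)
  have i': "(\<lambda>\<theta>. complex_of_real (\<kappa> \<theta>)) integrable_on {0..pi}"
    by (intro integrable_continuous_real continuous_intros \<kappa>)
  have c0: "of_real (cheb_coeff h 0) = integral {0..pi} (\<lambda>\<theta>. complex_of_real (\<kappa> \<theta>))"
    using integral_linear[OF i bounded_linear_of_real[where 'a = complex]]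
    unfolding cheb_coeff_def \<kappa>_def o_def by simp
  have "(complex_potential h has_field_derivative
      of_real (cheb_coeff h 0 / pi) * (1 / w * (\<i> * w / s)) + (2 / of_real pi * ?I) * (\<i> * w / s)) (at z)"
    unfolding complex_potential_def[abs_def] w_def s_def \<kappa>_def
    using wnp w1
    by (intro DERIV_add DERIV_cmult DERIV_chain'[OF has_field_derivative_joukowski_inv[OF z]]
        has_field_derivative_cheb_series h)
      (auto simp: w_def intro!: has_field_derivative_Ln[THEN DERIV_cong] simp: inverse_eq_divide)
  also have "of_real (cheb_coeff h 0 / pi) * (1 / w * (\<i> * w / s)) + (2 / of_real pi * ?I) * (\<i> * w / s) =
      \<i> / (of_real pi * s) * (of_real (cheb_coeff h 0) + (2 * w) * ?I)"
    using w0 s0 by (simp add: field_simps)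
  also have "(2 * w) * ?I = integral {0..pi} (\<lambda>\<theta>. of_real (\<kappa> \<theta>) * ((of_real (cos \<theta>) - w) / (z - of_real (cos \<theta>))))"
    unfolding integral_mult_right[symmetric] quad
    by (intro integral_cong) (use w0 zc in \<open>simp add: field_simps\<close>)
  also have "of_real (cheb_coeff h 0) + integral {0..pi} (\<lambda>\<theta>. of_real (\<kappa> \<theta>) * ((of_real (cos \<theta>) - w) / (z - of_real (cos \<theta>)))) =
     integral {0..pi} (\<lambda>\<theta>. of_real (\<kappa> \<theta>) + of_real (\<kappa> \<theta>) * ((of_real (cos \<theta>) - w) / (z - of_real (cos \<theta>))))"
    unfolding c0 by (intro integral_add[symmetric] i' integrable_continuous_real continuous_intros \<kappa>) (use zc in auto)
  also have "\<dots> = integral {0..pi} (\<lambda>\<theta>. (\<i> * s) * (of_real (\<kappa> \<theta>) / (z - of_real (cos \<theta>))))"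
    unfolding zw[symmetric] by (intro integral_cong) (use zc in \<open>simp add: field_simps\<close>)
  also have "\<dots> = (\<i> * s) * integral {0..pi} (\<lambda>\<theta>. of_real (\<kappa> \<theta>) / (z - of_real (cos \<theta>)))"
    by (rule integral_mult_right)
  also have "\<i> / (of_real pi * s) * ((\<i> * s) * integral {0..pi} (\<lambda>\<theta>. of_real (\<kappa> \<theta>) / (z - of_real (cos \<theta>)))) =
     - (1 / of_real pi) * integral {0..pi} (\<lambda>\<theta>. of_real (\<kappa> \<theta>) / (z - of_real (cos \<theta>)))"
    using s0 by (simp add: field_simps)
  finally show ?thesis unfolding \<kappa>_def .
qed

lemma potential_has_laplacian_on:
  assumes "continuous_on {-1..1} h"
  shows "has_laplacian_on halfplane (potential h) (\<lambda>_. 0)"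
proof -
  have "complex_potential h holomorphic_on {z. Im z > 0}"
    using has_field_derivative_complex_potential[OF assms] open_halfspace_Im_gt
    by (auto simp: holomorphic_on_open)
  from Re_holomorphic_has_laplacian_on[OF this] show ?thesis
    unfolding Re_complex_potential[abs_def] cpt_def .
qed

lemma potential_deriv2:
  assumes h: "continuous_on {-1..1} h" and t: "t > 0"
  shows "((\<lambda>t. potential h (x, t)) has_real_derivative
     - (1 / pi) * integral {0..pi} (\<lambda>\<theta>. h (cos \<theta>) * (sin \<theta> * t / ((x - cos \<theta>)\<^sup>2 + t\<^sup>2)))) (at t)"
proof -
  define z where "z = cpt (x, t)"
  have z: "Im z > 0" using t by (simp add: z_def)
  have zc: "z - of_real u \<noteq> 0" for u using z by (auto simp: complex_eq_iff)
  define J where "J = integral {0..pi} (\<lambda>\<theta>. of_real (h (cos \<theta>) * sin \<theta>) / (z - of_real (cos \<theta>)))"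
  have "((\<lambda>t. cpt (x, t)) has_vector_derivative \<i>) (at t)"
    unfolding cpt_def Complex_eq by (auto intro!: derivative_eq_intros)
  from field_vector_diff_chain_at[OF this, of "complex_potential h" "- (1 / of_real pi) * J"]
  have "((\<lambda>t. complex_potential h (cpt (x, t))) has_vector_derivative \<i> * (- (1 / of_real pi) * J)) (at t)"
    using has_field_derivative_complex_potential[OF h z] by (simp add: o_def z_def J_def)
  from bounded_linear.has_vector_derivative[OF bounded_linear_Re this]
  have D: "((\<lambda>t. potential h (x, t)) has_real_derivative Re (\<i> * (- (1 / of_real pi) * J))) (at t)"
    unfolding Re_complex_potential[symmetric] by (simp add: has_real_derivative_iff_has_vector_derivative)
  have i: "(\<lambda>\<theta>. of_real (h (cos \<theta>) * sin \<theta>) / (z - of_real (cos \<theta>))) integrable_on {0..pi}"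
    by (intro integrable_continuous_real continuous_intros continuous_on_compose_cos h) (use zc in auto)
  have "Im J = integral {0..pi} (\<lambda>\<theta>. Im (of_real (h (cos \<theta>) * sin \<theta>) / (z - of_real (cos \<theta>))))"
    unfolding J_def using integral_linear[OF i bounded_linear_Im] by (simp add: o_def)
  also have "\<dots> = integral {0..pi} (\<lambda>\<theta>. - (h (cos \<theta>) * (sin \<theta> * t / ((x - cos \<theta>)\<^sup>2 + t\<^sup>2))))"
    by (intro integral_cong) (simp add: Im_divide z_def)
  finally have "Re (\<i> * (- (1 / of_real pi) * J)) =
     - (1 / pi) * integral {0..pi} (\<lambda>\<theta>. h (cos \<theta>) * (sin \<theta> * t / ((x - cos \<theta>)\<^sup>2 + t\<^sup>2)))"
    by simp
  with D show ?thesis by simp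
qed

lemma one_sided_derivative_limit:
  fixes f :: "real \<Rightarrow> real"
  assumes cont: "continuous_on {0..} f"
    and f': "\<And>t. t > 0 \<Longrightarrow> (f has_real_derivative f' t) (at t)"
    and lim: "(f' \<longlongrightarrow> l) (at_right 0)"
  shows "(f has_real_derivative l) (at 0 within {0..})"
proof -
  have "((\<lambda>t. (f t - f 0) / (t - 0)) \<longlongrightarrow> l) (at_right 0)"
  proof (rule tendstoI)
    fix e :: real assume "e > 0"
    with lim have "\<forall>\<^sub>F t in at_right 0. dist (f' t) l < e" by (rule tendstoD)
    then obtain b where b: "b > 0" "\<And>t. t > 0 \<Longrightarrow> t < b \<Longrightarrow> dist (f' t) l < e"
      unfolding eventually_at_right_field by auto
    show "\<forall>\<^sub>F t in at_right 0. dist ((f t - f 0) / (t - 0)) l < e"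
      unfolding eventually_at_right_field
    proof (intro exI conjI allI impI)
      show "b > 0" by fact
      fix t :: real assume t: "0 < t" "t < b"
      have "\<exists>d z. 0 < z \<and> z < t \<and> (f has_real_derivative d) (at z) \<and> f t - f 0 = (t - 0) * d"
        by (rule MVT[OF t(1)])
          (use cont f' in \<open>auto intro: continuous_on_subset simp: real_differentiable_def\<close>)
      then obtain d z where z: "0 < z" "z < t" "(f has_real_derivative d) (at z)" "f t - f 0 = t * d" by auto
      hence "d = f' z" using f'[of z] DERIV_unique by blast
      thus "dist ((f t - f 0) / (t - 0)) l < e" using z t b(2)[of z] by simp
    qed
  qed
  moreover have "at 0 within {0..} = at_right (0::real)"
    using at_within_Icc_at_right at_within_Ici_at_right by blast
  ultimately show ?thesis by (simp add: has_field_derivative_iff)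
qed

lemma Poisson_kernel_has_integral:
  assumes "t > 0"
  shows "((\<lambda>\<theta>. sin \<theta> * t / ((x - cos \<theta>)\<^sup>2 + t\<^sup>2)) has_integral
    arctan ((1 + x) / t) + arctan ((1 - x) / t)) {0..pi}"
proof -
  have "((\<lambda>\<theta>. sin \<theta> * t / ((x - cos \<theta>)\<^sup>2 + t\<^sup>2)) has_integral
    arctan ((x - cos pi) / t) - arctan ((x - cos 0) / t)) {0..pi}"
  proof (rule fundamental_theorem_of_calculus)
    fix \<theta> :: real
    have pos: "t * t + (x - cos \<theta>) * (x - cos \<theta>) > 0" using assms by (simp add: add_pos_nonneg)
    have "((\<lambda>\<theta>. arctan ((x - cos \<theta>) / t)) has_real_derivative
       (sin \<theta> / t) * inverse (1 + ((x - cos \<theta>) / t)\<^sup>2)) (at \<theta> within {0..pi})"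
      using assms by (auto intro!: derivative_eq_intros)
    also have "(sin \<theta> / t) * inverse (1 + ((x - cos \<theta>) / t)\<^sup>2) = sin \<theta> * t / ((x - cos \<theta>)\<^sup>2 + t\<^sup>2)"
    proof -
      have "1 + ((x - cos \<theta>) / t)\<^sup>2 = ((x - cos \<theta>)\<^sup>2 + t\<^sup>2) / t\<^sup>2"
        using assms by (simp add: power_divide add_divide_distrib)
      thus ?thesis using assms by (simp add: power2_eq_square)
    qed
    finally show "((\<lambda>\<theta>. arctan ((x - cos \<theta>) / t)) has_vector_derivative sin \<theta> * t / ((x - cos \<theta>)\<^sup>2 + t\<^sup>2))
        (at \<theta> within {0..pi})"
      by (simp add: has_real_derivative_iff_has_vector_derivative)
  qed simp
  moreover have "arctan ((x - 1) / t) = - arctan ((1 - x) / t)"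
    by (metis arctan_minus minus_diff_eq minus_divide_left)
  ultimately show ?thesis by (simp add: add.commute)
qed

lemma arctan_div_tendsto_pi_half:
  fixes c :: real
  assumes "c > 0"
  shows "((\<lambda>t. arctan (c / t)) \<longlongrightarrow> pi / 2) (at_right 0)"
proof -
  have "filterlim (\<lambda>t::real. c * inverse t) at_top (at_right 0)"
    by (intro filterlim_tendsto_pos_mult_at_top[OF tendsto_const assms] filterlim_inverse_at_top_right)
  thus ?thesis unfolding divide_inverse[of c] by (rule filterlim_compose[OF tendsto_arctan_at_top])
qed

lemma Poisson_kernel_limit:
  fixes h :: "real \<Rightarrow> real"
  assumes h: "continuous_on {-1..1} h" and x: "\<bar>x\<bar> < 1"
  shows "((\<lambda>t. integral {0..pi} (\<lambda>\<theta>. h (cos \<theta>) * (sin \<theta> * t / ((x - cos \<theta>)\<^sup>2 + t\<^sup>2)))) \<longlongrightarrow> pi * h x) (at_right 0)"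
proof -
  define K where "K = (\<lambda>t \<theta>. sin \<theta> * t / ((x - cos \<theta>)\<^sup>2 + t\<^sup>2))"
  define A where "A = (\<lambda>t. arctan ((1 + x) / t) + arctan ((1 - x) / t))"
  have A: "(K t has_integral A t) {0..pi}" if "t > 0" for t
    using Poisson_kernel_has_integral[OF that] unfolding K_def A_def .
  have "((\<lambda>t. A t) \<longlongrightarrow> pi / 2 + pi / 2) (at_right 0)"
    unfolding A_def using x by (intro tendsto_add arctan_div_tendsto_pi_half) auto
  hence Al: "((\<lambda>t. h x * A t) \<longlongrightarrow> pi * h x) (at_right 0)"
    by (auto intro!: tendsto_eq_intros)
  obtain M where M: "\<forall>u\<in>{-1..1}. \<bar>h u\<bar> \<le> M"
    using compact_imp_bounded[OF compact_continuous_image[OF h compact_Icc]]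
    unfolding bounded_iff by auto
  have M0: "M \<ge> 0" using M x by (metis abs_ge_zero atLeastAtMost_iff abs_le_iff less_imp_le minus_le_iff order_trans)
  have "((\<lambda>t. integral {0..pi} (\<lambda>\<theta>. h (cos \<theta>) * K t \<theta>) - h x * A t) \<longlongrightarrow> 0) (at_right 0)"
  proof (rule tendstoI)
    fix e :: real assume e: "e > 0"
    define \<epsilon> where "\<epsilon> = e / (2 * pi)"
    have \<epsilon>: "\<epsilon> > 0" using e by (simp add: \<epsilon>_def)
    obtain d where d: "d > 0" "\<And>u. u \<in> {-1..1} \<Longrightarrow> \<bar>u - x\<bar> < d \<Longrightarrow> \<bar>h u - h x\<bar> < \<epsilon>"
      using h x \<epsilon> unfolding continuous_on_iff dist_real_def
      by (metis abs_le_iff atLeastAtMost_iff less_imp_le minus_le_iff)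
    define C where "C = 2 * M / d\<^sup>2"
    have C: "C \<ge> 0" using M0 by (simp add: C_def)
    have quad: "\<bar>h u - h x\<bar> \<le> \<epsilon> + C * (x - u)\<^sup>2" if "u \<in> {-1..1}" for u
    proof (cases "\<bar>u - x\<bar> < d")
      case True
      have "0 \<le> C * (x - u)\<^sup>2" using C by simp
      thus ?thesis using d(2)[OF that True] by linarith
    next
      case False
      hence "d\<^sup>2 \<le> (x - u)\<^sup>2" using d(1) by (metis abs_minus_commute linorder_not_less power2_abs power_mono less_imp_le)
      hence "C * d\<^sup>2 \<le> C * (x - u)\<^sup>2" using C by (intro mult_left_mono)
      moreover have "C * d\<^sup>2 = 2 * M" using d(1) by (simp add: C_def)
      moreover have "x \<in> {-1..1}" using x by auto
      hence "\<bar>h u\<bar> \<le> M" "\<bar>h x\<bar> \<le> M" using M that by blast+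
      ultimately show ?thesis using \<epsilon> by linarith
    qed
    define b where "b = e / (2 * (C * pi + 1))"
    have b: "b > 0" using e C by (simp add: b_def add_nonneg_pos)
    show "\<forall>\<^sub>F t in at_right 0. dist (integral {0..pi} (\<lambda>\<theta>. h (cos \<theta>) * K t \<theta>) - h x * A t) 0 < e"
      unfolding eventually_at_right_field
    proof (intro exI conjI allI impI)
      show "b > 0" by fact
      fix t :: real assume t: "0 < t" "t < b"
      have pos: "(x - c)\<^sup>2 + t\<^sup>2 > 0" for c using t by (simp add: add_nonneg_pos)
      have Kc: "continuous_on {0..pi} (K t)"
        unfolding K_def by (intro continuous_intros) (metis pos less_irrefl)
      have "(\<lambda>\<theta>. h (cos \<theta>) * K t \<theta>) integrable_on {0..pi}"
        by (intro integrable_continuous_real continuous_intros Kc continuous_on_compose_cos h)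
      hence I: "((\<lambda>\<theta>. h (cos \<theta>) * K t \<theta> - h x * K t \<theta>) has_integral
          integral {0..pi} (\<lambda>\<theta>. h (cos \<theta>) * K t \<theta>) - h x * A t) {0..pi}"
        by (intro has_integral_diff has_integral_mult_right A t integrable_integral)
      have U: "((\<lambda>\<theta>. \<epsilon> * K t \<theta> + C * t) has_integral \<epsilon> * A t + (pi - 0) *\<^sub>R (C * t)) {0..pi}"
        using has_integral_const_real[of "C * t" 0 pi]
        by (intro has_integral_add has_integral_mult_right A t) simp
      have bnd: "norm (h (cos \<theta>) * K t \<theta> - h x * K t \<theta>) \<le> \<epsilon> * K t \<theta> + C * t" if "\<theta> \<in> {0..pi}" for \<theta>
      proof -
        have s: "sin \<theta> \<ge> 0" using that by (simp add: sin_ge_zero)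
        have K0: "K t \<theta> \<ge> 0" unfolding K_def using s t pos[of "cos \<theta>"] by simp
        have "(x - cos \<theta>)\<^sup>2 * K t \<theta> = (sin \<theta> * t) * ((x - cos \<theta>)\<^sup>2 / ((x - cos \<theta>)\<^sup>2 + t\<^sup>2))"
          by (simp add: K_def)
        also have "\<dots> \<le> (1 * t) * 1"
          using s t pos[of "cos \<theta>"] by (intro mult_mono) auto
        finally have "C * ((x - cos \<theta>)\<^sup>2 * K t \<theta>) \<le> C * t" using C by (intro mult_left_mono) auto
        moreover have "\<bar>h (cos \<theta>) - h x\<bar> * K t \<theta> \<le> (\<epsilon> + C * (x - cos \<theta>)\<^sup>2) * K t \<theta>"
          using K0 by (intro mult_right_mono quad) auto
        ultimately have "\<bar>h (cos \<theta>) - h x\<bar> * K t \<theta> \<le> \<epsilon> * K t \<theta> + C * t"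
          by (simp add: algebra_simps)
        moreover have "norm (h (cos \<theta>) * K t \<theta> - h x * K t \<theta>) = \<bar>h (cos \<theta>) - h x\<bar> * K t \<theta>"
          using K0 by (simp add: left_diff_distrib[symmetric] abs_mult)
        ultimately show ?thesis by simp
      qed
      have "norm (integral {0..pi} (\<lambda>\<theta>. h (cos \<theta>) * K t \<theta> - h x * K t \<theta>)) \<le> integral {0..pi} (\<lambda>\<theta>. \<epsilon> * K t \<theta> + C * t)"
        using I U bnd by (intro integral_norm_bound_integral) (auto simp: has_integral_iff)
      hence "\<bar>integral {0..pi} (\<lambda>\<theta>. h (cos \<theta>) * K t \<theta>) - h x * A t\<bar> \<le> \<epsilon> * A t + pi * (C * t)"
        using integral_unique[OF I] integral_unique[OF U] by simp
      also have "A t < pi" unfolding A_def using arctan_ubound[of "(1 + x) / t"] arctan_ubound[of "(1 - x) / t"] by linarith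
      hence "\<epsilon> * A t + pi * (C * t) \<le> \<epsilon> * pi + (C * pi + 1) * t"
        using \<epsilon> t by (intro add_mono mult_left_mono) (auto simp: algebra_simps)
      also have "\<epsilon> * pi = e / 2" by (simp add: \<epsilon>_def)
      also have "(C * pi + 1) * t < (C * pi + 1) * b" using C t by (intro mult_strict_left_mono) (auto simp: add_nonneg_pos)
      also have "(C * pi + 1) * b = e / 2"
      proof -
        have "D * (e / (2 * D)) = e / 2" if "D > 0" for D :: real using that by simp
        moreover have "C * pi + 1 > 0" using C by (simp add: add_nonneg_pos)
        ultimately show ?thesis unfolding b_def .
      qed
      finally show "dist (integral {0..pi} (\<lambda>\<theta>. h (cos \<theta>) * K t \<theta>) - h x * A t) 0 < e" by simp
    qed
  qed
  from tendsto_add[OF this Al] show ?thesis by (simp add: K_def)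
qed

lemma Poisson_kernel_limit_outside:
  fixes h :: "real \<Rightarrow> real"
  assumes h: "continuous_on {-1..1} h" and x: "\<bar>x\<bar> > 1"
  shows "((\<lambda>t. integral {0..pi} (\<lambda>\<theta>. h (cos \<theta>) * (sin \<theta> * t / ((x - cos \<theta>)\<^sup>2 + t\<^sup>2)))) \<longlongrightarrow> 0) (at_right 0)"
proof -
  obtain M where M: "\<forall>u\<in>{-1..1}. \<bar>h u\<bar> \<le> M"
    using compact_imp_bounded[OF compact_continuous_image[OF h compact_Icc]]
    unfolding bounded_iff by auto
  define d where "d = \<bar>x\<bar> - 1"
  have d: "d > 0" using x by (simp add: d_def)
  have le: "\<bar>integral {0..pi} (\<lambda>\<theta>. h (cos \<theta>) * (sin \<theta> * t / ((x - cos \<theta>)\<^sup>2 + t\<^sup>2)))\<bar> \<le> M * t / d\<^sup>2 * (pi - 0)"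
    if t: "t > 0" for t
  proof -
    have pos: "(x - c)\<^sup>2 + t\<^sup>2 > 0" for c using t by (simp add: add_nonneg_pos)
    have "norm (integral {0..pi} (\<lambda>\<theta>. h (cos \<theta>) * (sin \<theta> * t / ((x - cos \<theta>)\<^sup>2 + t\<^sup>2)))) \<le> M * t / d\<^sup>2 * (pi - 0)"
    proof (rule integral_bound)
      show "continuous_on {0..pi} (\<lambda>\<theta>. h (cos \<theta>) * (sin \<theta> * t / ((x - cos \<theta>)\<^sup>2 + t\<^sup>2)))"
        by (intro continuous_intros continuous_on_compose_cos h)
          (metis pos less_irrefl)
      fix \<theta> :: real assume th: "\<theta> \<in> {0..pi}"
      have s: "sin \<theta> \<ge> 0" using th by (simp add: sin_ge_zero)
      have "d \<le> \<bar>x - cos \<theta>\<bar>" using abs_cos_le_one[of \<theta>] unfolding d_def by linarith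
      hence "d\<^sup>2 \<le> (x - cos \<theta>)\<^sup>2" using d by (metis power2_abs power_mono less_imp_le)
      hence "d\<^sup>2 \<le> (x - cos \<theta>)\<^sup>2 + t\<^sup>2" by (simp add: add_increasing2)
      hence "sin \<theta> * t / ((x - cos \<theta>)\<^sup>2 + t\<^sup>2) \<le> (1 * t) / d\<^sup>2"
        using s t d by (intro frac_le mult_mono) auto
      moreover have "0 \<le> sin \<theta> * t / ((x - cos \<theta>)\<^sup>2 + t\<^sup>2)" using s t by simp
      moreover have "\<bar>h (cos \<theta>)\<bar> \<le> M" using M by simp
      ultimately have "\<bar>h (cos \<theta>)\<bar> * (sin \<theta> * t / ((x - cos \<theta>)\<^sup>2 + t\<^sup>2)) \<le> M * (1 * t / d\<^sup>2)"
        by (intro mult_mono) auto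
      thus "norm (h (cos \<theta>) * (sin \<theta> * t / ((x - cos \<theta>)\<^sup>2 + t\<^sup>2))) \<le> M * t / d\<^sup>2"
        using \<open>0 \<le> sin \<theta> * t / ((x - cos \<theta>)\<^sup>2 + t\<^sup>2)\<close> unfolding real_norm_def abs_mult[of "h (cos \<theta>)"]
        by (metis abs_of_nonneg mult_1 times_divide_eq_right)
    qed simp
    thus ?thesis by simp
  qed
  show ?thesis
  proof (rule Lim_null_comparison)
    show "\<forall>\<^sub>F t in at_right 0. norm (integral {0..pi} (\<lambda>\<theta>. h (cos \<theta>) * (sin \<theta> * t / ((x - cos \<theta>)\<^sup>2 + t\<^sup>2)))) \<le> M * t / d\<^sup>2 * (pi - 0)"
      unfolding eventually_at_right_field using le by (intro exI[of _ 1]) auto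
    show "((\<lambda>t. M * t / d\<^sup>2 * (pi - 0)) \<longlongrightarrow> 0) (at_right 0)"
      using d by (auto intro!: tendsto_eq_intros)
  qed
qed

lemma has_normal_deriv_potential:
  assumes h: "continuous_on {-1..1} h" and x: "\<bar>x\<bar> \<noteq> 1"
  shows "has_normal_deriv (potential h) (if \<bar>x\<bar> < 1 then h x else 0) x"
  unfolding has_normal_deriv_def
proof (rule one_sided_derivative_limit)
  show "continuous_on {0..} (\<lambda>t. potential h (x, t))"
    by (rule continuous_on_compose2[OF continuous_on_potential[OF h]])
      (auto intro!: continuous_intros simp: closed_halfplane_def)
  show "((\<lambda>t. potential h (x, t)) has_real_derivative
     - (1 / pi) * integral {0..pi} (\<lambda>\<theta>. h (cos \<theta>) * (sin \<theta> * t / ((x - cos \<theta>)\<^sup>2 + t\<^sup>2)))) (at t)"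
    if "t > 0" for t
    using h that by (rule potential_deriv2)
  have "((\<lambda>t. integral {0..pi} (\<lambda>\<theta>. h (cos \<theta>) * (sin \<theta> * t / ((x - cos \<theta>)\<^sup>2 + t\<^sup>2))))
      \<longlongrightarrow> pi * (if \<bar>x\<bar> < 1 then h x else 0)) (at_right 0)"
    using Poisson_kernel_limit[OF h, of x] Poisson_kernel_limit_outside[OF h, of x] x by auto
  from tendsto_mult[OF tendsto_const[of "- (1 / pi)"] this]
  show "((\<lambda>t. - (1 / pi) * integral {0..pi} (\<lambda>\<theta>. h (cos \<theta>) * (sin \<theta> * t / ((x - cos \<theta>)\<^sup>2 + t\<^sup>2))))
      \<longlongrightarrow> - (if \<bar>x\<bar> < 1 then h x else 0)) (at_right 0)"
    by simp
qed

section \<open>Representation of solutions\<close>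

lemma closed_halfplane_bounded_aboveI:
  fixes E :: "real \<times> real \<Rightarrow> real"
  assumes cont: "continuous_on closed_halfplane E"
    and far: "\<And>y. y \<in> closed_halfplane \<Longrightarrow> b \<le> norm y \<Longrightarrow> E y \<le> C"
  obtains M where "\<And>y. y \<in> closed_halfplane \<Longrightarrow> E y \<le> M"
proof -
  have "compact (closed_halfplane \<inter> cball 0 b)"
    by (simp add: closed_Int_compact closed_closed_halfplane)
  moreover have "continuous_on (closed_halfplane \<inter> cball 0 b) E"
    using cont by (rule continuous_on_subset) auto
  ultimately have "bounded (E ` (closed_halfplane \<inter> cball 0 b))"
    by (intro compact_imp_bounded compact_continuous_image)
  then obtain M where M: "\<forall>y\<in>closed_halfplane \<inter> cball 0 b. \<bar>E y\<bar> \<le> M"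
    unfolding bounded_iff by auto
  show ?thesis
  proof (rule that)
    fix y :: "real \<times> real" assume y: "y \<in> closed_halfplane"
    show "E y \<le> max M C"
    proof (cases "b \<le> norm y")
      case True
      thus ?thesis using far[OF y] by simp
    next
      case False
      hence "\<bar>E y\<bar> \<le> M" using M y by simp
      thus ?thesis by simp
    qed
  qed
qed

lemma halfplane_bigo_oneE:
  fixes f :: "real \<times> real \<Rightarrow> real"
  assumes "f \<in> O[halfplane_infinity](\<lambda>_. 1)"
  obtains b C where "b \<ge> 1" "\<And>y. y \<in> closed_halfplane \<Longrightarrow> b \<le> norm y \<Longrightarrow> \<bar>f y\<bar> \<le> C"
proof -
  obtain C where "\<forall>\<^sub>F y in halfplane_infinity. norm (f y) \<le> C * norm (1::real)"
    using assms by (elim landau_o.bigE)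
  then obtain b where "\<forall>y\<in>closed_halfplane. b \<le> norm y \<longrightarrow> \<bar>f y\<bar> \<le> C"
    unfolding eventually_halfplane_infinity by auto
  thus ?thesis by (intro that[of "max b 1" C]) auto
qed

lemma has_normal_deriv_minus:
  "has_normal_deriv u d x \<Longrightarrow> has_normal_deriv (\<lambda>y. - u y) (- d) x"
  unfolding has_normal_deriv_def by (rule DERIV_minus)

lemma has_normal_deriv_diff:
  "has_normal_deriv u d x \<Longrightarrow> has_normal_deriv v e x \<Longrightarrow> has_normal_deriv (\<lambda>y. u y - v y) (d - e) x"
  unfolding has_normal_deriv_def using DERIV_diff by fastforce

lemma has_laplacian_on_minus:
  "has_laplacian_on S u (\<lambda>_. 0) \<Longrightarrow> has_laplacian_on S (\<lambda>y. - u y) (\<lambda>_. 0)"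
  using has_laplacian_on_cmult[of S u "\<lambda>_. 0" "-1"] by simp

lemma has_laplacian_on_diff:
  "has_laplacian_on S u (\<lambda>_. 0) \<Longrightarrow> has_laplacian_on S v (\<lambda>_. 0) \<Longrightarrow>
    has_laplacian_on S (\<lambda>y. u y - v y) (\<lambda>_. 0)"
  using has_laplacian_on_add[of S u "\<lambda>_. 0" "\<lambda>y. - v y" "\<lambda>_. 0"] has_laplacian_on_minus[of S v] by simp

lemma halfplane_Liouville_log:
  fixes E :: "real \<times> real \<Rightarrow> real"
  assumes cont: "continuous_on closed_halfplane E"
    and lap: "has_laplacian_on halfplane E (\<lambda>_. 0)"
    and bc: "\<And>x. \<bar>x\<bar> \<noteq> 1 \<Longrightarrow> has_normal_deriv E 0 x"
    and asymp: "(\<lambda>y. E y - \<alpha> * ln (norm y)) \<in> O[halfplane_infinity](\<lambda>_. 1)"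
  obtains c where "\<alpha> = 0" "\<And>y. y \<in> closed_halfplane \<Longrightarrow> E y = c"
proof -
  obtain b C where b: "b \<ge> 1" and C: "\<And>y. y \<in> closed_halfplane \<Longrightarrow> b \<le> norm y \<Longrightarrow> \<bar>E y - \<alpha> * ln (norm y)\<bar> \<le> C"
    using halfplane_bigo_oneE[OF asymp] by blast
  have ln: "ln (norm y) \<ge> 0" if "b \<le> norm y" for y :: "real \<times> real"
    using that b by (intro ln_ge_zero) linarith
  have "\<exists>c. \<forall>y\<in>closed_halfplane. E y = c"
  proof (cases "\<alpha> \<le> 0")
    case True
    have "E y \<le> C" if "y \<in> closed_halfplane" "b \<le> norm y" for y
      using C[OF that] mult_nonpos_nonneg[OF True ln[OF that(2)]] by linarith
    from closed_halfplane_bounded_aboveI[OF cont this]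
    obtain M where M: "\<And>y. y \<in> closed_halfplane \<Longrightarrow> E y \<le> M" by metis
    show ?thesis by (rule halfplane_Liouville[OF cont lap M bc]) blast+
  next
    case False
    have "- E y \<le> C" if "y \<in> closed_halfplane" "b \<le> norm y" for y
      using C[OF that] mult_nonneg_nonneg[OF _ ln[OF that(2)], of \<alpha>] False by linarith
    from closed_halfplane_bounded_aboveI[OF continuous_on_minus[OF cont] this]
    obtain M where M: "\<And>y. y \<in> closed_halfplane \<Longrightarrow> - E y \<le> M" by metis
    show ?thesis
    proof (rule halfplane_Liouville[OF continuous_on_minus[OF cont] has_laplacian_on_minus[OF lap] M])
      show "has_normal_deriv (\<lambda>y. - E y) 0 x" if "\<bar>x\<bar> \<noteq> 1" for x
        using has_normal_deriv_minus[OF bc[OF that]] by simp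
    next
      fix c assume c: "\<And>y. y \<in> closed_halfplane \<Longrightarrow> - E y = c"
      have "E y = - c" if "y \<in> closed_halfplane" for y using c[OF that] by simp
      thus ?thesis by blast
    qed
  qed
  then obtain c where c: "\<And>y. y \<in> closed_halfplane \<Longrightarrow> E y = c" by blast
  have "\<alpha> = 0"
  proof (rule ccontr)
    assume "\<alpha> \<noteq> 0"
    define s where "s = max b (exp ((\<bar>c\<bar> + C + 1) / \<bar>\<alpha>\<bar>))"
    have s: "s \<ge> b" "s > 0" using b by (auto simp: s_def)
    have "\<bar>c - \<alpha> * ln s\<bar> \<le> C"
      using C[of "(s, 0)"] c[of "(s, 0)"] s by (simp add: closed_halfplane_def norm_Pair)
    hence "\<bar>\<alpha>\<bar> * \<bar>ln s\<bar> \<le> \<bar>c\<bar> + C" unfolding abs_mult[symmetric] by linarith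
    moreover have "ln (exp ((\<bar>c\<bar> + C + 1) / \<bar>\<alpha>\<bar>)) \<le> ln s"
      by (intro ln_mono) (auto simp: s_def)
    hence "(\<bar>c\<bar> + C + 1) / \<bar>\<alpha>\<bar> \<le> \<bar>ln s\<bar>" by simp
    hence "\<bar>c\<bar> + C + 1 \<le> \<bar>\<alpha>\<bar> * \<bar>ln s\<bar>" using \<open>\<alpha> \<noteq> 0\<close> by (simp add: field_simps)
    ultimately show False by simp
  qed
  thus ?thesis using c by (rule that)
qed

lemma cheb_series_disc_pt_tendsto_0:
  assumes "continuous_on {-1..1} h"
  shows "((\<lambda>y. Re (cheb_series h (disc_pt y))) \<longlongrightarrow> 0) halfplane_infinity"
proof -
  have "isCont (cheb_series h) 0"
    using continuous_on_interior[OF continuous_on_cheb_series[OF assms]] by simp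
  hence "((\<lambda>y. cheb_series h (disc_pt y)) \<longlongrightarrow> cheb_series h 0) halfplane_infinity"
    by (rule isCont_tendsto_compose) (rule disc_pt_tendsto_0)
  from tendsto_Re[OF this] show ?thesis by simp
qed

lemma potential_representation:
  assumes cont: "continuous_on closed_halfplane u"
    and harm: "harmonic_on halfplane u"
    and h: "continuous_on {-1..1} h"
    and nd_in: "\<And>x. \<bar>x\<bar> < 1 \<Longrightarrow> has_normal_deriv u (h x) x"
    and nd_out: "\<And>x. \<bar>x\<bar> > 1 \<Longrightarrow> has_normal_deriv u 0 x"
    and asymp: "(\<lambda>y. u y - A * ln (norm y)) \<in> O[halfplane_infinity](\<lambda>_. 1)"
  obtains c where "cheb_coeff h 0 = - A * pi"
    "\<And>y. y \<in> closed_halfplane \<Longrightarrow> u y = c - A * ln (cmod (disc_pt y)) + Re (cheb_series h (disc_pt y))"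
proof -
  define H where "H = cheb_coeff h 0 / pi"
  define E where "E = (\<lambda>y. u y - potential h y)"
  have "((\<lambda>y. H * (- ln (cmod (disc_pt y)) - ln (norm y)) - Re (cheb_series h (disc_pt y)))
      \<longlongrightarrow> H * ln 2 - 0) halfplane_infinity"
    by (intro tendsto_intros ln_disc_pt_asymp cheb_series_disc_pt_tendsto_0 h)
  hence "(\<lambda>y. H * (- ln (cmod (disc_pt y)) - ln (norm y)) - Re (cheb_series h (disc_pt y)))
      \<in> O[halfplane_infinity](\<lambda>_. 1)"
    by (intro bigoI_tendsto[of _ _ "H * ln 2 - 0"]) auto
  from sum_in_bigo(1)[OF asymp this]
  have "(\<lambda>y. E y - (A + H) * ln (norm y)) \<in> O[halfplane_infinity](\<lambda>_. 1)"
    by (simp add: E_def potential_def H_def algebra_simps)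
  moreover have "continuous_on closed_halfplane E"
    unfolding E_def by (intro continuous_intros cont continuous_on_potential h)
  moreover have "has_laplacian_on halfplane E (\<lambda>_. 0)"
    unfolding E_def
    by (intro has_laplacian_on_diff harmonic_on_has_laplacian_on harm potential_has_laplacian_on h)
  moreover have "has_normal_deriv E 0 x" if "\<bar>x\<bar> \<noteq> 1" for x
  proof -
    have "has_normal_deriv u (if \<bar>x\<bar> < 1 then h x else 0) x"
      using nd_in[of x] nd_out[of x] that by auto
    from has_normal_deriv_diff[OF this has_normal_deriv_potential[OF h that]]
    show ?thesis by (simp add: E_def)
  qed
  ultimately obtain c where c: "A + H = 0" "\<And>y. y \<in> closed_halfplane \<Longrightarrow> E y = c"
    using halfplane_Liouville_log[of E "A + H"] by blast
  show ?thesis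
  proof (rule that)
    show "cheb_coeff h 0 = - A * pi" using c(1) by (simp add: H_def field_simps)
    show "u y = c - A * ln (cmod (disc_pt y)) + Re (cheb_series h (disc_pt y))" if "y \<in> closed_halfplane" for y
    proof -
      have "u y = c + potential h y" using c(2)[OF that] by (simp add: E_def)
      moreover have "H = - A" using c(1) by simp
      ultimately show ?thesis unfolding potential_def H_def[symmetric] by simp
    qed
  qed
qed

lemma Ln_joukowski_inv_has_field_derivative:
  assumes "Im z > 0"
  shows "((\<lambda>z. Ln (joukowski_inv z)) has_field_derivative \<i> / joukowski_sqrt z) (at z)"
proof -
  have "joukowski_inv z \<notin> \<real>\<^sub>\<le>\<^sub>0"
    using joukowski_inv_halfplane(1)[OF assms] by (auto simp: complex_nonpos_Reals_iff)
  from DERIV_chain'[OF has_field_derivative_joukowski_inv[OF assms] has_field_derivative_Ln[OF this]]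
  show ?thesis using joukowski_inv_nonzero[of z] by (simp add: field_simps)
qed

lemma ln_disc_pt_normal_deriv:
  assumes x: "\<bar>x\<bar> > 1"
  shows "has_normal_deriv (\<lambda>y. ln (cmod (disc_pt y))) 0 x"
  unfolding has_normal_deriv_def minus_zero
proof (rule one_sided_derivative_limit)
  show "continuous_on {0..} (\<lambda>t. ln (cmod (disc_pt (x, t))))"
    by (rule continuous_on_compose2[OF continuous_on_ln_disc_pt])
      (auto intro!: continuous_intros simp: closed_halfplane_def)
  show "((\<lambda>t. ln (cmod (disc_pt (x, t)))) has_real_derivative
      Re (\<i> * (\<i> / joukowski_sqrt (cpt (x, t))))) (at t)" if t: "t > 0" for t
  proof -
    have "((\<lambda>t. cpt (x, t)) has_vector_derivative \<i>) (at t)"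
      unfolding cpt_def Complex_eq by (auto intro!: derivative_eq_intros)
    from field_vector_diff_chain_at[OF this Ln_joukowski_inv_has_field_derivative[of "cpt (x, t)"]]
    have "((\<lambda>t. Ln (disc_pt (x, t))) has_vector_derivative \<i> * (\<i> / joukowski_sqrt (cpt (x, t)))) (at t)"
      using t by (simp add: o_def disc_pt_def)
    from bounded_linear.has_vector_derivative[OF bounded_linear_Re this]
    show ?thesis by (simp add: has_real_derivative_iff_has_vector_derivative)
  qed
  have "continuous_on {0..} (\<lambda>t. joukowski_sqrt (cpt (x, t)))"
    by (rule continuous_on_compose2[OF continuous_on_joukowski_sqrt]) (auto intro!: continuous_intros)
  hence "((\<lambda>t. joukowski_sqrt (cpt (x, t))) \<longlongrightarrow> joukowski_sqrt (cpt (x, 0))) (at 0 within {0..})"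
    unfolding continuous_on_def by (metis atLeast_iff order_refl)
  hence "((\<lambda>t. joukowski_sqrt (cpt (x, t))) \<longlongrightarrow> joukowski_sqrt (of_real x)) (at_right 0)"
    by (auto intro: tendsto_within_subset)
  hence "((\<lambda>t. Re (\<i> * (\<i> / joukowski_sqrt (cpt (x, t))))) \<longlongrightarrow> Re (\<i> * (\<i> / joukowski_sqrt (of_real x)))) (at_right 0)"
    using joukowski_sqrt_outside(2)[OF x] by (intro tendsto_intros)
  moreover have "Re (\<i> * (\<i> / joukowski_sqrt (of_real x))) = 0"
    using joukowski_sqrt_outside(1)[OF x] by (simp add: Re_divide)
  ultimately show "((\<lambda>t. Re (\<i> * (\<i> / joukowski_sqrt (cpt (x, t))))) \<longlongrightarrow> 0) (at_right 0)" by simp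
qed

lemma dirichlet_green_eq:
  assumes g: "dirichlet_green g" and y: "y \<in> closed_halfplane"
  shows "g y = - ln (cmod (disc_pt y))"
proof -
  define E where "E = (\<lambda>y. g y - - ln (cmod (disc_pt y)))"
  have gc: "continuous_on closed_halfplane g" and gh: "harmonic_on halfplane g"
    using g by (auto simp: dirichlet_green_def classical_harmonic_def)
  have cont: "continuous_on closed_halfplane E"
    unfolding E_def by (intro continuous_intros gc continuous_on_ln_disc_pt)
  have "(\<lambda>z. Ln (joukowski_inv z)) holomorphic_on {z. Im z > 0}"
    using Ln_joukowski_inv_has_field_derivative open_halfspace_Im_gt
    by (auto simp: holomorphic_on_open)
  from Re_holomorphic_has_laplacian_on[OF this]
  have "has_laplacian_on halfplane (\<lambda>y. ln (cmod (disc_pt y))) (\<lambda>_. 0)"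
    by (simp add: disc_pt_def cpt_def joukowski_inv_nonzero)
  hence lap: "has_laplacian_on halfplane E (\<lambda>_. 0)"
    unfolding E_def
    by (intro has_laplacian_on_diff[OF harmonic_on_has_laplacian_on[OF gh]] has_laplacian_on_minus)
  have out: "has_normal_deriv E 0 x" if "\<bar>x\<bar> > 1" for x
  proof -
    have "has_normal_deriv g 0 x" using g that by (auto simp: dirichlet_green_def)
    from has_normal_deriv_diff[OF this has_normal_deriv_minus[OF ln_disc_pt_normal_deriv[OF that]]]
    show ?thesis by (simp add: E_def)
  qed
  have ins: "E (x, 0) = 0" if "\<bar>x\<bar> < 1" for x
  proof -
    have "disc_pt (x, 0) = cis (- arccos x)"
      using disc_pt_cos[of "arccos x"] that arccos_bounded[of x] by (simp add: abs_le_iff)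
    thus ?thesis using g that by (simp add: E_def dirichlet_green_def)
  qed
  have "(\<lambda>y. - ln (cmod (disc_pt y)) - ln (norm y)) \<in> O[halfplane_infinity](\<lambda>_. 1)"
    by (rule bigoI_tendsto[of _ _ "ln 2"]) (use ln_disc_pt_asymp in auto)
  moreover have "(\<lambda>y. g y - ln (norm y)) \<in> O[halfplane_infinity](\<lambda>_. 1)"
    using g by (auto simp: dirichlet_green_def)
  ultimately have "E \<in> O[halfplane_infinity](\<lambda>_. 1)"
    using sum_in_bigo(2)[of "\<lambda>y. g y - ln (norm y)" halfplane_infinity "\<lambda>_. 1"
        "\<lambda>y. - ln (cmod (disc_pt y)) - ln (norm y)"] by (simp add: E_def)
  then obtain b C where "b \<ge> 1" and
    bC: "\<And>y. y \<in> closed_halfplane \<Longrightarrow> b \<le> norm y \<Longrightarrow> \<bar>E y\<bar> \<le> C"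
    using halfplane_bigo_oneE by blast
  have bC1: "E y \<le> C" and bC2: "- E y \<le> C" if "y \<in> closed_halfplane" "b \<le> norm y" for y
    using bC[OF that] by auto
  obtain M where M: "\<And>y. y \<in> closed_halfplane \<Longrightarrow> E y \<le> M"
    using closed_halfplane_bounded_aboveI[OF cont bC1] by metis
  obtain M' where M': "\<And>y. y \<in> closed_halfplane \<Longrightarrow> - E y \<le> M'"
    using closed_halfplane_bounded_aboveI[OF continuous_on_minus[OF cont] bC2] by metis
  have "E y = 0" if y: "y \<in> halfplane" for y
  proof (rule antisym)
    show "E y \<le> 0" using halfplane_Dirichlet_Neumann_nonpos[OF cont lap M out ins y] .
    have "- E y \<le> 0"
      by (rule halfplane_Dirichlet_Neumann_nonpos[OF continuous_on_minus[OF cont]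
            has_laplacian_on_minus[OF lap] M' _ _ y])
        (use has_normal_deriv_minus[OF out] ins in auto)
    thus "0 \<le> E y" by simp
  qed
  hence "E y = 0"
    using halfplane_closure_eqI[OF cont continuous_on_const _ y] by blast
  thus ?thesis by (simp add: E_def)
qed

section \<open>Expansions and their limits\<close>

definition arc_inner :: "(real \<Rightarrow> real) \<Rightarrow> (real \<Rightarrow> real) \<Rightarrow> real" where
  "arc_inner u v = integral {0..pi} (\<lambda>\<theta>. u (cos \<theta>) * v (cos \<theta>) * sin \<theta>)"

definition cheb_expansion :: "(real \<times> real \<Rightarrow> real) \<Rightarrow> real \<Rightarrow> (real \<Rightarrow> real) \<Rightarrow> bool" where
  "cheb_expansion U a h \<longleftrightarrow> continuous_on {-1..1} h \<and> continuous_on closed_halfplane U \<and>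
     (\<forall>y\<in>closed_halfplane. U y = a + Re (cheb_series h (disc_pt y)))"

lemma cheb_expansionD:
  assumes "cheb_expansion U a h"
  shows "continuous_on {-1..1} h" "continuous_on closed_halfplane U"
    "y \<in> closed_halfplane \<Longrightarrow> U y = a + Re (cheb_series h (disc_pt y))"
  using assms by (auto simp: cheb_expansion_def)

lemma continuous_on_boundary:
  "continuous_on closed_halfplane U \<Longrightarrow> continuous_on A (\<lambda>x. U (x, 0))"
  by (erule continuous_on_compose2) (auto intro!: continuous_intros simp: closed_halfplane_def)

lemma cheb_coeff_lincomb:
  assumes "continuous_on {-1..1} h" "continuous_on {-1..1} k"
  shows "cheb_coeff (\<lambda>x. h x + c * k x) m = cheb_coeff h m + c * cheb_coeff k m"
proof -
  have i: "(\<lambda>\<theta>. f (cos \<theta>) * sin \<theta> * cos (real m * \<theta>)) integrable_on {0..pi}"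
    if "continuous_on {-1..1} f" for f :: "real \<Rightarrow> real"
    by (intro integrable_continuous_real continuous_intros continuous_on_compose_cos that)
  have "cheb_coeff h m + c * cheb_coeff k m = integral {0..pi} (\<lambda>\<theta>.
      h (cos \<theta>) * sin \<theta> * cos (real m * \<theta>) + c * (k (cos \<theta>) * sin \<theta> * cos (real m * \<theta>)))"
    unfolding cheb_coeff_def integral_mult_right[symmetric]
    by (intro integral_add[symmetric] i assms integrable_on_mult_right)
  thus ?thesis unfolding cheb_coeff_def by (simp add: algebra_simps)
qed

lemma arc_inner_lincomb:
  assumes "continuous_on {-1..1} u" "continuous_on {-1..1} v" "continuous_on {-1..1} w"
  shows "arc_inner u (\<lambda>x. v x + c * w x) = arc_inner u v + c * arc_inner u w"
proof -
  have i: "(\<lambda>\<theta>. u (cos \<theta>) * f (cos \<theta>) * sin \<theta>) integrable_on {0..pi}"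
    if "continuous_on {-1..1} f" for f :: "real \<Rightarrow> real"
    by (intro integrable_continuous_real continuous_intros continuous_on_compose_cos that assms)
  have "arc_inner u v + c * arc_inner u w = integral {0..pi} (\<lambda>\<theta>.
      u (cos \<theta>) * v (cos \<theta>) * sin \<theta> + c * (u (cos \<theta>) * w (cos \<theta>) * sin \<theta>))"
    unfolding arc_inner_def integral_mult_right[symmetric]
    by (intro integral_add[symmetric] i assms integrable_on_mult_right)
  thus ?thesis unfolding arc_inner_def by (simp add: algebra_simps)
qed

lemma arc_inner_commute: "arc_inner u v = arc_inner v u"
  by (simp add: arc_inner_def mult_ac)

lemma arc_inner_cmult: "arc_inner u (\<lambda>x. c * v x) = c * arc_inner u v"
proof -
  have "arc_inner u (\<lambda>x. c * v x) = integral {0..pi} (\<lambda>\<theta>. c * (u (cos \<theta>) * v (cos \<theta>) * sin \<theta>))"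
    unfolding arc_inner_def by (simp add: mult_ac)
  thus ?thesis by (simp add: arc_inner_def)
qed

lemma cheb_expansion_lincomb:
  assumes U: "cheb_expansion U a h" and V: "cheb_expansion V b k"
  shows "cheb_expansion (\<lambda>y. U y + c * V y) (a + c * b) (\<lambda>x. h x + c * k x)"
proof -
  note h = cheb_expansionD(1)[OF U] and k = cheb_expansionD(1)[OF V]
  have "cheb_series (\<lambda>x. h x + c * k x) w = cheb_series h w + of_real c * cheb_series k w"
    if "cmod w \<le> 1" for w
  proof -
    note s = summable_cheb_series[OF h that] summable_cheb_series[OF k that]
    have "cheb_series h w + of_real c * cheb_series k w =
      (\<Sum>m. of_real (cheb_weight m * cheb_coeff h m) * w ^ m +
         of_real c * (of_real (cheb_weight m * cheb_coeff k m) * w ^ m))"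
      unfolding cheb_series_def suminf_mult[OF s(2), symmetric]
      by (rule suminf_add[OF s(1) summable_mult[OF s(2)]])
    thus ?thesis unfolding cheb_series_def cheb_coeff_lincomb[OF h k] by (simp add: algebra_simps)
  qed
  hence "Re (cheb_series (\<lambda>x. h x + c * k x) (disc_pt y)) =
      Re (cheb_series h (disc_pt y)) + c * Re (cheb_series k (disc_pt y))"
    if "y \<in> closed_halfplane" for y
    using disc_pt_norm_le_1[OF that] by simp
  thus ?thesis
    using cheb_expansionD[OF U] cheb_expansionD[OF V]
    by (auto simp: cheb_expansion_def algebra_simps
        intro!: continuous_intros continuous_on_cheb_series_disc_pt)
qed

lemma cheb_expansion_diff_sum:
  fixes n :: nat
  assumes U: "cheb_expansion U a h" and V: "\<And>k. cheb_expansion (V k) (b k) (f k)"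
  shows "cheb_expansion (\<lambda>y. U y - (\<Sum>k<n. c k * V k y)) (a - (\<Sum>k<n. c k * b k))
    (\<lambda>x. h x - (\<Sum>k<n. c k * f k x))"
proof (induction n)
  case 0
  thus ?case using U by simp
next
  case (Suc n)
  from cheb_expansion_lincomb[OF Suc V[of n], of "- c n"] show ?case
    by (simp add: algebra_simps)
qed

lemma cheb_expansion_cos:
  assumes "cheb_expansion U a h" "\<theta> \<in> {0..pi}"
  shows "U (cos \<theta>, 0) = a + (\<Sum>m. cheb_weight m * cheb_coeff h m * cos (real m * \<theta>))"
proof -
  have "Re (cheb_series h (cis (- \<theta>))) =
      (\<Sum>m. Re (of_real (cheb_weight m * cheb_coeff h m) * cis (- \<theta>) ^ m))"
    unfolding cheb_series_def
    by (rule Re_suminf) (intro summable_cheb_series cheb_expansionD[OF assms(1)], simp)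
  also have "\<dots> = (\<Sum>m. cheb_weight m * cheb_coeff h m * cos (real m * \<theta>))"
    by (simp add: Complex.DeMoivre)
  finally show ?thesis
    using cheb_expansionD(3)[OF assms(1), of "(cos \<theta>, 0)"] disc_pt_cos[OF assms(2)]
    by (simp add: closed_halfplane_def)
qed

lemma cheb_expansion_integral_sums:
  assumes U: "cheb_expansion U a h" and \<phi>: "continuous_on {0..pi} \<phi>"
  shows "(\<lambda>m. cheb_weight m * cheb_coeff h m * integral {0..pi} (\<lambda>\<theta>. \<phi> \<theta> * cos (real m * \<theta>)))
    sums (integral {0..pi} (\<lambda>\<theta>. U (cos \<theta>, 0) * \<phi> \<theta>) - a * integral {0..pi} \<phi>)"
proof -
  note h = cheb_expansionD(1)[OF U]
  obtain M where M: "\<forall>\<theta>\<in>{0..pi}. \<bar>\<phi> \<theta>\<bar> \<le> M"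
    using compact_imp_bounded[OF compact_continuous_image[OF \<phi> compact_Icc]]
    unfolding bounded_iff by auto
  let ?f = "\<lambda>m \<theta>. cheb_weight m * cheb_coeff h m * (\<phi> \<theta> * cos (real m * \<theta>))"
  have bnd: "norm (?f m \<theta>) \<le> \<bar>cheb_weight m * cheb_coeff h m\<bar> * M" if "\<theta> \<in> {0..pi}" for m \<theta>
  proof -
    have "\<bar>\<phi> \<theta>\<bar> * \<bar>cos (real m * \<theta>)\<bar> \<le> \<bar>\<phi> \<theta>\<bar>" by (intro mult_left_le) auto
    also have "\<dots> \<le> M" using M that by blast
    finally have "\<bar>\<phi> \<theta> * cos (real m * \<theta>)\<bar> \<le> M" by (simp add: abs_mult)
    thus ?thesis unfolding real_norm_def abs_mult[of "cheb_weight m * cheb_coeff h m"]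
      by (intro mult_left_mono) auto
  qed
  have c: "continuous_on {0..pi} (?f m)" for m by (intro continuous_intros \<phi>)
  have sB: "summable (\<lambda>m. \<bar>cheb_weight m * cheb_coeff h m\<bar> * M)"
    by (intro summable_mult2 summable_abs_cheb h)
  have "(\<lambda>m. integral {0..pi} (?f m)) sums integral {0..pi} (\<lambda>\<theta>. \<Sum>m. ?f m \<theta>)"
    by (rule M_test_integral_sums(1)[OF c bnd sB])
  moreover have "integral {0..pi} (?f m) =
      cheb_weight m * cheb_coeff h m * integral {0..pi} (\<lambda>\<theta>. \<phi> \<theta> * cos (real m * \<theta>))" for m
    by (rule integral_mult_right)
  moreover have "integral {0..pi} (\<lambda>\<theta>. \<Sum>m. ?f m \<theta>) =
      integral {0..pi} (\<lambda>\<theta>. U (cos \<theta>, 0) * \<phi> \<theta>) - a * integral {0..pi} \<phi>"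
  proof -
    have "(\<Sum>m. ?f m \<theta>) = U (cos \<theta>, 0) * \<phi> \<theta> - a * \<phi> \<theta>" if "\<theta> \<in> {0..pi}" for \<theta>
    proof -
      have "summable (\<lambda>m. cheb_weight m * cheb_coeff h m * cos (real m * \<theta>))"
      proof (rule summable_comparison_test'[OF summable_abs_cheb[OF h]])
        show "norm (cheb_weight m * cheb_coeff h m * cos (real m * \<theta>)) \<le> \<bar>cheb_weight m * cheb_coeff h m\<bar>" for m
          unfolding real_norm_def abs_mult[of "cheb_weight m * cheb_coeff h m"] by (intro mult_left_le) auto
      qed
      hence "(\<Sum>m. \<phi> \<theta> * (cheb_weight m * cheb_coeff h m * cos (real m * \<theta>))) = \<phi> \<theta> * (U (cos \<theta>, 0) - a)"
        unfolding cheb_expansion_cos[OF U that] by (simp add: suminf_mult)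
      thus ?thesis by (simp add: mult_ac right_diff_distrib)
    qed
    hence "integral {0..pi} (\<lambda>\<theta>. \<Sum>m. ?f m \<theta>) = integral {0..pi} (\<lambda>\<theta>. U (cos \<theta>, 0) * \<phi> \<theta> - a * \<phi> \<theta>)"
      by (intro integral_cong) auto
    also have "\<dots> = integral {0..pi} (\<lambda>\<theta>. U (cos \<theta>, 0) * \<phi> \<theta>) - integral {0..pi} (\<lambda>\<theta>. a * \<phi> \<theta>)"
    proof (intro integral_diff integrable_continuous_real continuous_intros \<phi>)
      have "continuous_on {-1..1} (\<lambda>x. U (x, 0))"
        by (rule continuous_on_boundary[OF cheb_expansionD(2)[OF U]])
      thus "continuous_on {0..pi} (\<lambda>\<theta>. U (cos \<theta>, 0))" by (rule continuous_on_compose_cos)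
    qed
    finally show ?thesis by simp
  qed
  ultimately show ?thesis by simp
qed

lemma cheb_expansion_pairing:
  assumes U: "cheb_expansion U a h" and f: "continuous_on {-1..1} f"
  shows "(\<lambda>m. cheb_weight m * cheb_coeff h m * cheb_coeff f m)
    sums (arc_inner (\<lambda>x. U (x, 0)) f - a * cheb_coeff f 0)"
proof -
  have "continuous_on {0..pi} (\<lambda>\<theta>. f (cos \<theta>) * sin \<theta>)"
    by (intro continuous_intros continuous_on_compose_cos f)
  from cheb_expansion_integral_sums[OF U this] show ?thesis
    by (simp add: arc_inner_def cheb_coeff_def mult_ac)
qed

lemma cheb_expansion_symmetric:
  assumes U: "cheb_expansion U a h" and V: "cheb_expansion V b k"
  shows "arc_inner (\<lambda>x. U (x, 0)) k - a * cheb_coeff k 0 = arc_inner (\<lambda>x. V (x, 0)) h - b * cheb_coeff h 0"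
proof -
  have "(\<lambda>m. cheb_weight m * cheb_coeff h m * cheb_coeff k m) =
      (\<lambda>m. cheb_weight m * cheb_coeff k m * cheb_coeff h m)" by (simp add: mult_ac)
  thus ?thesis
    using cheb_expansion_pairing[OF U cheb_expansionD(1)[OF V]]
      cheb_expansion_pairing[OF V cheb_expansionD(1)[OF U]] sums_unique2 by metis
qed

lemma tendsto_zero_of_AM_GM_bound:
  fixes b s :: "nat \<Rightarrow> real"
  assumes s: "s \<longlonglongrightarrow> 0" and bnd: "\<And>n \<tau>. \<tau> > 0 \<Longrightarrow> \<bar>b n\<bar> \<le> A * \<tau> + B * s n / \<tau>"
  shows "b \<longlonglongrightarrow> 0"
proof (rule tendstoI)
  fix e :: real assume e: "e > 0"
  define \<tau> where "\<tau> = e / (2 * (\<bar>A\<bar> + 1))"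
  have \<tau>: "\<tau> > 0" using e by (simp add: \<tau>_def)
  have "A * \<tau> \<le> (\<bar>A\<bar> + 1) * \<tau>" using \<tau> by (intro mult_right_mono) auto
  also have "\<dots> = e / 2" by (simp add: \<tau>_def field_simps)
  finally have A: "A * \<tau> \<le> e / 2" .
  have "(\<lambda>n. B * s n / \<tau>) \<longlonglongrightarrow> B * 0 / \<tau>" using \<tau> by (intro tendsto_intros s) auto
  hence "\<forall>\<^sub>F n in sequentially. B * s n / \<tau> < e / 2" using e by (intro order_tendstoD(2)) auto
  thus "\<forall>\<^sub>F n in sequentially. dist (b n) 0 < e"
  proof eventually_elim
    case (elim n)
    show ?case using bnd[OF \<tau>, of n] A elim unfolding dist_real_def by linarith
  qed
qed

lemma AM_GM_weighted: "\<tau> > 0 \<Longrightarrow> 2 * \<bar>x * y\<bar> \<le> \<tau> * x\<^sup>2 + y\<^sup>2 / (\<tau>::real)"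
proof -
  assume t: "\<tau> > 0"
  have "0 \<le> (\<tau> * \<bar>x\<bar> - \<bar>y\<bar>)\<^sup>2 / \<tau>" using t by simp
  also have "(\<tau> * \<bar>x\<bar> - \<bar>y\<bar>)\<^sup>2 / \<tau> = \<tau> * x\<^sup>2 + y\<^sup>2 / \<tau> - 2 * (\<bar>x\<bar> * \<bar>y\<bar>)"
    using t by (simp add: power2_diff power_mult_distrib field_simps power2_eq_square)
  finally show ?thesis by (simp add: abs_mult)
qed

lemma arc_L1_tendsto_0:
  fixes u :: "nat \<Rightarrow> real \<Rightarrow> real"
  assumes u: "\<And>n. continuous_on {-1..1} (u n)"
    and lim: "(\<lambda>n. arc_inner (u n) (u n)) \<longlonglongrightarrow> 0"
  shows "(\<lambda>n. integral {0..pi} (\<lambda>\<theta>. \<bar>u n (cos \<theta>)\<bar> * sin \<theta>)) \<longlonglongrightarrow> 0"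
proof (rule tendsto_zero_of_AM_GM_bound[OF lim, where A = "pi / 2" and B = "1 / 2"])
  fix n and \<tau> :: real assume t: "\<tau> > 0"
  have i1: "(\<lambda>\<theta>. \<bar>u n (cos \<theta>)\<bar> * sin \<theta>) integrable_on {0..pi}"
    by (intro integrable_continuous_real continuous_intros continuous_on_compose_cos u)
  have i2: "(\<lambda>\<theta>. u n (cos \<theta>) * u n (cos \<theta>) * sin \<theta>) integrable_on {0..pi}"
    by (intro integrable_continuous_real continuous_intros continuous_on_compose_cos u)
  have H: "((\<lambda>\<theta>. \<tau> / 2 + (1 / (2 * \<tau>)) * (u n (cos \<theta>) * u n (cos \<theta>) * sin \<theta>)) has_integral
      (pi - 0) *\<^sub>R (\<tau> / 2) + (1 / (2 * \<tau>)) * arc_inner (u n) (u n)) {0..pi}"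
    unfolding arc_inner_def using has_integral_const_real[of "\<tau> / 2" 0 pi]
    by (intro has_integral_add has_integral_mult_right integrable_integral i2) simp
  have s: "sin \<theta> \<ge> 0" "sin \<theta> \<le> 1" if "\<theta> \<in> {0..pi}" for \<theta> using that by (auto simp: sin_ge_zero)
  have "0 \<le> integral {0..pi} (\<lambda>\<theta>. \<bar>u n (cos \<theta>)\<bar> * sin \<theta>)"
    by (intro integral_nonneg i1 mult_nonneg_nonneg s) auto
  moreover have "integral {0..pi} (\<lambda>\<theta>. \<bar>u n (cos \<theta>)\<bar> * sin \<theta>) \<le>
      (pi - 0) *\<^sub>R (\<tau> / 2) + (1 / (2 * \<tau>)) * arc_inner (u n) (u n)"
  proof (rule has_integral_le[OF integrable_integral[OF i1] H])
    fix \<theta> assume th: "\<theta> \<in> {0..pi}"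
    have "2 * \<bar>1 * u n (cos \<theta>)\<bar> \<le> \<tau> * 1\<^sup>2 + (u n (cos \<theta>))\<^sup>2 / \<tau>" using t by (rule AM_GM_weighted)
    hence "\<bar>u n (cos \<theta>)\<bar> \<le> \<tau> / 2 + (1 / (2 * \<tau>)) * (u n (cos \<theta>) * u n (cos \<theta>))"
      using t by (simp add: field_simps power2_eq_square)
    from mult_right_mono[OF this s(1)[OF th]]
    have "\<bar>u n (cos \<theta>)\<bar> * sin \<theta> \<le> \<tau> / 2 * sin \<theta> + (1 / (2 * \<tau>)) * (u n (cos \<theta>) * u n (cos \<theta>) * sin \<theta>)"
      by (simp only: distrib_right mult.assoc)
    moreover have "\<tau> / 2 * sin \<theta> \<le> \<tau> / 2" using s[OF th] t by (intro mult_left_le) auto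
    ultimately show "\<bar>u n (cos \<theta>)\<bar> * sin \<theta> \<le> \<tau> / 2 + (1 / (2 * \<tau>)) * (u n (cos \<theta>) * u n (cos \<theta>) * sin \<theta>)"
      by linarith
  qed
  ultimately show "\<bar>integral {0..pi} (\<lambda>\<theta>. \<bar>u n (cos \<theta>)\<bar> * sin \<theta>)\<bar> \<le>
      pi / 2 * \<tau> + 1 / 2 * arc_inner (u n) (u n) / \<tau>"
    by simp
qed

lemma arc_integral_tendsto_0:
  fixes u :: "nat \<Rightarrow> real \<Rightarrow> real"
  assumes u: "\<And>n. continuous_on {-1..1} (u n)"
    and lim: "(\<lambda>n. arc_inner (u n) (u n)) \<longlonglongrightarrow> 0"
    and \<phi>: "continuous_on {0..pi} \<phi>" "\<And>\<theta>. \<theta> \<in> {0..pi} \<Longrightarrow> \<bar>\<phi> \<theta>\<bar> \<le> C * sin \<theta>"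
  shows "(\<lambda>n. integral {0..pi} (\<lambda>\<theta>. u n (cos \<theta>) * \<phi> \<theta>)) \<longlonglongrightarrow> 0"
proof (rule Lim_null_comparison)
  show "(\<lambda>n. C * integral {0..pi} (\<lambda>\<theta>. \<bar>u n (cos \<theta>)\<bar> * sin \<theta>)) \<longlonglongrightarrow> 0"
    using tendsto_mult_right_zero[OF arc_L1_tendsto_0[OF u lim]] .
  show "\<forall>\<^sub>F n in sequentially. norm (integral {0..pi} (\<lambda>\<theta>. u n (cos \<theta>) * \<phi> \<theta>)) \<le>
      C * integral {0..pi} (\<lambda>\<theta>. \<bar>u n (cos \<theta>)\<bar> * sin \<theta>)"
  proof (intro always_eventually allI)
    fix n
    have "norm (integral {0..pi} (\<lambda>\<theta>. u n (cos \<theta>) * \<phi> \<theta>)) \<le>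
      integral {0..pi} (\<lambda>\<theta>. C * (\<bar>u n (cos \<theta>)\<bar> * sin \<theta>))"
    proof (rule integral_norm_bound_integral)
      show "norm (u n (cos \<theta>) * \<phi> \<theta>) \<le> C * (\<bar>u n (cos \<theta>)\<bar> * sin \<theta>)" if "\<theta> \<in> {0..pi}" for \<theta>
        using mult_left_mono[OF \<phi>(2)[OF that] abs_ge_zero, of "u n (cos \<theta>)"]
        by (simp add: abs_mult mult_ac)
    qed (intro integrable_continuous_real continuous_intros continuous_on_compose_cos u \<phi>)+
    thus "norm (integral {0..pi} (\<lambda>\<theta>. u n (cos \<theta>) * \<phi> \<theta>)) \<le>
      C * integral {0..pi} (\<lambda>\<theta>. \<bar>u n (cos \<theta>)\<bar> * sin \<theta>)" by simp
  qed
qed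

lemma abs_sin_nat_le: "\<bar>sin (real n * \<theta>)\<bar> \<le> real n * \<bar>sin \<theta>\<bar>"
proof (induction n)
  case (Suc n)
  have "\<bar>sin (real (Suc n) * \<theta>)\<bar> = \<bar>sin (real n * \<theta>) * cos \<theta> + cos (real n * \<theta>) * sin \<theta>\<bar>"
  proof -
    have "real (Suc n) * \<theta> = real n * \<theta> + \<theta>" by (simp add: distrib_right)
    thus ?thesis by (simp only: sin_add)
  qed
  also have "\<dots> \<le> \<bar>sin (real n * \<theta>)\<bar> * \<bar>cos \<theta>\<bar> + \<bar>cos (real n * \<theta>)\<bar> * \<bar>sin \<theta>\<bar>"
    unfolding abs_mult[symmetric] by (rule abs_triangle_ineq)
  also have "\<dots> \<le> \<bar>sin (real n * \<theta>)\<bar> + \<bar>sin \<theta>\<bar>"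
    by (intro add_mono mult_left_le mult_left_le_one_le) auto
  finally show ?case using Suc by (simp add: distrib_right)
qed simp

lemma one_minus_cos_even_le:
  assumes "\<theta> \<in> {0..pi}"
  shows "\<bar>1 - cos (real (2 * n) * \<theta>)\<bar> \<le> 2 * (real n)\<^sup>2 * sin \<theta>"
proof -
  have s: "0 \<le> sin \<theta>" "sin \<theta> \<le> 1" using assms by (auto simp: sin_ge_zero)
  have "1 - cos (real (2 * n) * \<theta>) = 2 * \<bar>sin (real n * \<theta>)\<bar>\<^sup>2"
    using cos_double_sin[of "real n * \<theta>"] by (simp add: mult.assoc)
  also have "\<bar>sin (real n * \<theta>)\<bar>\<^sup>2 \<le> (real n * sin \<theta>)\<^sup>2"
    using abs_sin_nat_le[of n \<theta>] s by (intro power_mono) auto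
  also have "(real n * sin \<theta>)\<^sup>2 \<le> (real n)\<^sup>2 * sin \<theta>"
    unfolding power_mult_distrib using s
    by (intro mult_left_mono) (auto simp: power2_eq_square mult_left_le)
  finally have "1 - cos (real (2 * n) * \<theta>) \<le> 2 * (real n)\<^sup>2 * sin \<theta>" by simp
  thus ?thesis by simp
qed

text \<open>Testing against \<open>1 - cos (2 N \<theta>)\<close>, which vanishes at both end points, relates the constant
  term to the coefficient of index \<open>2 N\<close>; large \<open>N\<close> then makes the energy identity
  \<open>\<Sum> w\<^sub>m \<eta>\<^sub>m\<^sup>2 = \<pi> x + o(1)\<close> incompatible with a constant term \<open>x\<close> bounded away from 0.\<close>

lemma cheb_expansion_null_sequence:
  fixes U :: "nat \<Rightarrow> real \<times> real \<Rightarrow> real"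
  assumes U: "\<And>n. cheb_expansion (U n) (x n) (\<eta> n)"
    and H0: "\<And>n. cheb_coeff (\<eta> n) 0 = - pi"
    and L2: "(\<lambda>n. arc_inner (\<lambda>s. U n (s, 0)) (\<lambda>s. U n (s, 0))) \<longlonglongrightarrow> 0"
    and en: "(\<lambda>n. arc_inner (\<lambda>s. U n (s, 0)) (\<eta> n)) \<longlonglongrightarrow> 0"
  shows "x \<longlonglongrightarrow> 0" and "y \<in> halfplane \<Longrightarrow> (\<lambda>n. U n y) \<longlonglongrightarrow> 0"
proof -
  define \<epsilon> where "\<epsilon> = (\<lambda>n. arc_inner (\<lambda>s. U n (s, 0)) (\<eta> n))"
  have \<eta>: "continuous_on {-1..1} (\<eta> n)" for n using cheb_expansionD(1)[OF U] .
  have u: "continuous_on {-1..1} (\<lambda>s. U n (s, 0))" for n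
    by (rule continuous_on_boundary[OF cheb_expansionD(2)[OF U]])
  have S: "(\<lambda>m. cheb_weight m * (cheb_coeff (\<eta> n) m)\<^sup>2) sums (\<epsilon> n + pi * x n)" for n
    using cheb_expansion_pairing[OF U \<eta>, of n n]
    by (simp add: H0 \<epsilon>_def power2_eq_square mult_ac)
  have term_le: "cheb_weight m * (cheb_coeff (\<eta> n) m)\<^sup>2 \<le> \<epsilon> n + pi * x n" for n m
    using sum_le_suminf[OF sums_summable[OF S], of "{m}" n] sums_unique[OF S, of n] by simp
  define J where "J = (\<lambda>N n. integral {0..pi} (\<lambda>\<theta>. U n (cos \<theta>, 0) * (1 - cos (real (2 * N) * \<theta>))))"
  have J0: "J N \<longlonglongrightarrow> 0" for N
    unfolding J_def
    by (rule arc_integral_tendsto_0[OF u L2 _ one_minus_cos_even_le]) (intro continuous_intros)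
  have J: "J N n = pi * x n - cheb_weight (2 * N) * cheb_coeff (\<eta> n) (2 * N) * (pi / 2)" if N: "N > 0" for N n
  proof -
    have I1: "((\<lambda>\<theta>. 1 - cos (real (2 * N) * \<theta>)) has_integral pi) {0..pi}"
      using has_integral_diff[OF has_integral_cos_nat[of 0] has_integral_cos_nat[of "2 * N"]] N by simp
    have I2: "((\<lambda>\<theta>. (1 - cos (real (2 * N) * \<theta>)) * cos (real m * \<theta>)) has_integral
        - (if m = 2 * N then pi / 2 else 0)) {0..pi}" if "m \<noteq> 0" for m
    proof -
      have "((\<lambda>\<theta>. cos (real m * \<theta>) - cos (real m * \<theta>) * cos (real (2 * N) * \<theta>)) has_integral
        (if m = 0 then pi else 0) - (if m = 2 * N then pi / 2 else 0)) {0..pi}"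
        by (intro has_integral_diff has_integral_cos_nat has_integral_cos_cos that)
      thus ?thesis using that by (simp add: algebra_simps)
    qed
    have "(\<lambda>m. cheb_weight m * cheb_coeff (\<eta> n) m *
        integral {0..pi} (\<lambda>\<theta>. (1 - cos (real (2 * N) * \<theta>)) * cos (real m * \<theta>))) sums (J N n - x n * pi)"
      using cheb_expansion_integral_sums[OF U, of "\<lambda>\<theta>. 1 - cos (real (2 * N) * \<theta>)" n]
      unfolding J_def integral_unique[OF I1] by (simp add: continuous_intros)
    also have "(\<lambda>m. cheb_weight m * cheb_coeff (\<eta> n) m *
        integral {0..pi} (\<lambda>\<theta>. (1 - cos (real (2 * N) * \<theta>)) * cos (real m * \<theta>))) =
      (\<lambda>m. if m = 2 * N then - cheb_weight (2 * N) * cheb_coeff (\<eta> n) (2 * N) * (pi / 2) else 0)"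
    proof
      fix m
      show "cheb_weight m * cheb_coeff (\<eta> n) m *
        integral {0..pi} (\<lambda>\<theta>. (1 - cos (real (2 * N) * \<theta>)) * cos (real m * \<theta>)) =
        (if m = 2 * N then - cheb_weight (2 * N) * cheb_coeff (\<eta> n) (2 * N) * (pi / 2) else 0)"
        using N integral_unique[OF I2, of m] by (cases "m = 0") auto
    qed
    finally have "J N n - x n * pi = - cheb_weight (2 * N) * cheb_coeff (\<eta> n) (2 * N) * (pi / 2)"
      using sums_single[of "2 * N" "\<lambda>_. - cheb_weight (2 * N) * cheb_coeff (\<eta> n) (2 * N) * (pi / 2)"]
        sums_unique2 by blast
    thus ?thesis by (simp add: mult_ac)
  qed
  have key: "4 * real N * (x n - J N n / pi)\<^sup>2 \<le> x n + \<epsilon> n / pi" if N: "N > 0" for N n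
  proof -
    define c where "c = cheb_coeff (\<eta> n) (2 * N)"
    have w: "cheb_weight (2 * N) = 1 / (pi * real N)" by (simp add: cheb_weight_def)
    have eq: "x n - J N n / pi = c / (2 * (pi * real N))"
      unfolding J[OF N] w c_def using N by (simp add: field_simps)
    have "4 * real N * (x n - J N n / pi)\<^sup>2 = (1 / (pi * real N) * c\<^sup>2) / pi"
      unfolding eq using N by (simp add: power_divide power2_eq_square field_simps)
    also have "\<dots> \<le> (\<epsilon> n + pi * x n) / pi"
      using term_le[of "2 * N" n] unfolding w c_def by (intro divide_right_mono) auto
    finally show ?thesis by (simp add: add_divide_distrib)
  qed
  have e0: "\<epsilon> \<longlonglongrightarrow> 0" using en by (simp add: \<epsilon>_def)
  show x0: "x \<longlonglongrightarrow> 0"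
  proof (rule tendstoI)
    fix e :: real assume e: "e > 0"
    obtain N :: nat where N: "real N > 2 / e" using reals_Archimedean2 by blast
    have Np: "N > 0" using N e by (metis divide_pos_pos of_nat_0 gr0I less_asym zero_less_numeral)
    have "(\<lambda>n. \<bar>J N n / pi\<bar>) \<longlonglongrightarrow> \<bar>0 / pi\<bar>" by (intro tendsto_intros J0) auto
    hence "\<forall>\<^sub>F n in sequentially. \<bar>J N n / pi\<bar> < e / 2" by (rule order_tendstoD(2)) (use e in simp)
    moreover have "(\<lambda>n. \<bar>J N n / pi + \<epsilon> n / pi\<bar>) \<longlonglongrightarrow> \<bar>0 / pi + 0 / pi\<bar>" by (intro tendsto_intros J0 e0) auto
    hence "\<forall>\<^sub>F n in sequentially. \<bar>J N n / pi + \<epsilon> n / pi\<bar> < e / 2" by (rule order_tendstoD(2)) (use e in simp)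
    ultimately show "\<forall>\<^sub>F n in sequentially. dist (x n) 0 < e"
    proof eventually_elim
      case (elim n)
      define v where "v = x n - J N n / pi"
      have "\<bar>v\<bar> < e / 2"
      proof (rule ccontr)
        assume "\<not> \<bar>v\<bar> < e / 2"
        hence v: "\<bar>v\<bar> \<ge> e / 2" by simp
        have "2 = 4 * (2 / e) * (e / 4)" using e by simp
        also have "\<dots> \<le> 4 * real N * (e / 2)" using N e by (intro mult_mono) auto
        finally have "2 * \<bar>v\<bar> \<le> (4 * real N * (e / 2)) * \<bar>v\<bar>" by (intro mult_right_mono) auto
        also have "\<dots> \<le> 4 * real N * \<bar>v\<bar> * \<bar>v\<bar>" using v by (intro mult_right_mono mult_left_mono) auto
        also have "\<dots> = 4 * real N * v\<^sup>2" by (simp add: power2_eq_square)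
        also have "\<dots> \<le> x n + \<epsilon> n / pi" unfolding v_def by (rule key[OF Np])
        also have "\<dots> = v + (J N n / pi + \<epsilon> n / pi)" by (simp add: v_def)
        finally show False using elim(2) v by linarith
      qed
      moreover have "x n = v + J N n / pi" by (simp add: v_def)
      ultimately show ?case using elim(1) unfolding dist_real_def by linarith
    qed
  qed
  assume y: "y \<in> halfplane"
  define r where "r = cmod (disc_pt y)"
  have r: "0 \<le> r" "r < 1" using disc_pt_norm_less_1[OF y] by (auto simp: r_def)
  have yc: "y \<in> closed_halfplane" using y halfplane_subset_closed by blast
  have "summable (\<lambda>m. cheb_weight m * (r ^ m)\<^sup>2)"
  proof (rule summable_comparison_test')
    show "summable (\<lambda>m. 2 / pi * r ^ m)" using r by (intro summable_mult summable_geometric) auto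
    fix m :: nat
    have "cheb_weight m \<le> 2 / pi"
    proof (cases "m = 0")
      case False
      hence "2 / (pi * real m) \<le> 2 / (pi * 1)" by (intro divide_left_mono mult_left_mono mult_pos_pos) auto
      thus ?thesis by (simp add: cheb_weight_def)
    qed simp
    moreover have "(r ^ m)\<^sup>2 \<le> r ^ m"
      using r by (simp add: power2_eq_square mult_left_le power_le_one)
    ultimately have "cheb_weight m * (r ^ m)\<^sup>2 \<le> 2 / pi * r ^ m"
      using r by (intro mult_mono) auto
    thus "norm (cheb_weight m * (r ^ m)\<^sup>2) \<le> 2 / pi * r ^ m" by simp
  qed
  then obtain C where C: "(\<lambda>m. cheb_weight m * (r ^ m)\<^sup>2) sums C" by (auto simp: summable_def)
  have "(\<lambda>n. \<epsilon> n + pi * x n) \<longlonglongrightarrow> 0 + pi * 0" by (intro tendsto_intros e0 x0)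
  hence s0: "(\<lambda>n. \<epsilon> n + pi * x n) \<longlonglongrightarrow> 0" by simp
  have "(\<lambda>n. Re (cheb_series (\<eta> n) (disc_pt y))) \<longlonglongrightarrow> 0"
  proof (rule tendsto_zero_of_AM_GM_bound[OF s0])
    fix n and \<tau> :: real assume t: "\<tau> > 0"
    have "(\<lambda>m. (\<tau> * (cheb_weight m * (r ^ m)\<^sup>2) + cheb_weight m * (cheb_coeff (\<eta> n) m)\<^sup>2 / \<tau>) / 2) sums
       ((\<tau> * C + (\<epsilon> n + pi * x n) / \<tau>) / 2)"
      by (intro sums_divide sums_add sums_mult C S)
    hence sm: "summable (\<lambda>m. (\<tau> * (cheb_weight m * (r ^ m)\<^sup>2) + cheb_weight m * (cheb_coeff (\<eta> n) m)\<^sup>2 / \<tau>) / 2)"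
      and sv: "(\<Sum>m. (\<tau> * (cheb_weight m * (r ^ m)\<^sup>2) + cheb_weight m * (cheb_coeff (\<eta> n) m)\<^sup>2 / \<tau>) / 2) =
        (\<tau> * C + (\<epsilon> n + pi * x n) / \<tau>) / 2"
      by (simp_all add: sums_iff)
    have "\<bar>Re (cheb_series (\<eta> n) (disc_pt y))\<bar> \<le> cmod (cheb_series (\<eta> n) (disc_pt y))"
      by (rule abs_Re_le_cmod)
    also have "\<dots> \<le> (\<tau> * C + (\<epsilon> n + pi * x n) / \<tau>) / 2"
      unfolding cheb_series_def sv[symmetric]
    proof (rule norm_suminf_le[OF _ sm])
      fix m
      have "2 * \<bar>r ^ m * cheb_coeff (\<eta> n) m\<bar> \<le> \<tau> * (r ^ m)\<^sup>2 + (cheb_coeff (\<eta> n) m)\<^sup>2 / \<tau>"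
        using t by (rule AM_GM_weighted)
      hence "cheb_weight m * \<bar>r ^ m * cheb_coeff (\<eta> n) m\<bar> \<le>
          cheb_weight m * ((\<tau> * (r ^ m)\<^sup>2 + (cheb_coeff (\<eta> n) m)\<^sup>2 / \<tau>) / 2)"
        by (intro mult_left_mono) auto
      also have "\<dots> = (\<tau> * (cheb_weight m * (r ^ m)\<^sup>2) + cheb_weight m * (cheb_coeff (\<eta> n) m)\<^sup>2 / \<tau>) / 2"
        by (simp add: algebra_simps)
      finally show "cmod (of_real (cheb_weight m * cheb_coeff (\<eta> n) m) * disc_pt y ^ m) \<le>
          (\<tau> * (cheb_weight m * (r ^ m)\<^sup>2) + cheb_weight m * (cheb_coeff (\<eta> n) m)\<^sup>2 / \<tau>) / 2"
        using r by (simp add: norm_mult norm_power abs_mult r_def[symmetric] mult_ac)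
    qed
    finally show "\<bar>Re (cheb_series (\<eta> n) (disc_pt y))\<bar> \<le> C / 2 * \<tau> + 1 / 2 * (\<epsilon> n + pi * x n) / \<tau>"
      by (simp add: add_divide_distrib mult_ac)
  qed
  from tendsto_add[OF x0 this] show "(\<lambda>n. U n y) \<longlonglongrightarrow> 0"
    using cheb_expansionD(3)[OF U yc] by simp
qed

section \<open>The spectral expansion\<close>

lemma has_integral_cos_substitution:
  fixes F :: "real \<Rightarrow> real"
  assumes "continuous_on {-1..1} F"
  shows "integral {-1..1} F = integral {0..pi} (\<lambda>\<theta>. F (cos \<theta>) * sin \<theta>)"
proof -
  have "((\<lambda>\<theta>. - sin \<theta> *\<^sub>R F (cos \<theta>)) has_integral
      (integral {cos 0..cos pi} F - integral {cos pi..cos 0} F)) {0..pi}"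
    by (rule has_integral_substitution_general[where s = "{}" and c = "-1" and d = 1])
      (use assms in \<open>auto intro!: derivative_eq_intros continuous_intros\<close>)
  from has_integral_neg[OF this] show ?thesis
    by (simp add: mult.commute has_integral_iff)
qed

lemma
  fixes F :: "real \<Rightarrow> real"
  assumes F: "continuous_on {-1..1} F"
  shows set_integrable_open_interval: "set_integrable lborel {-1<..<1} F"
    and set_integral_open_interval: "(LINT x:{-1<..<1}|lborel. F x) = integral {-1..1} F"
proof -
  show i: "set_integrable lborel {-1<..<1} F"
    by (rule set_integrable_subset[OF borel_integrable_atLeastAtMost'[OF F]]) auto
  show "(LINT x:{-1<..<1}|lborel. F x) = integral {-1..1} F"
    using set_borel_integral_eq_integral(2)[OF i] by (simp add: integral_open_interval_real)
qed

lemma arc_inner_eq_set_integral: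
  assumes "continuous_on {-1..1} u" "continuous_on {-1..1} v"
  shows "arc_inner u v = (LINT x:{-1<..<1}|lborel. u x * v x)"
proof -
  have "continuous_on {-1..1} (\<lambda>x. u x * v x)" using assms by (intro continuous_intros)
  from set_integral_open_interval[OF this] has_integral_cos_substitution[OF this] show ?thesis
    by (simp add: arc_inner_def)
qed

lemma arc_inner_diff_sum:
  fixes n :: nat
  assumes "continuous_on {-1..1} u" "continuous_on {-1..1} v" "\<And>k. continuous_on {-1..1} (w k)"
  shows "arc_inner u (\<lambda>x. v x - (\<Sum>k<n. c k * w k x)) = arc_inner u v - (\<Sum>k<n. c k * arc_inner u (w k))"
proof (induction n)
  case (Suc n)
  have "continuous_on {-1..1} (\<lambda>x. v x - (\<Sum>k<n. c k * w k x))"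
    using assms by (intro continuous_intros)
  from arc_inner_lincomb[OF assms(1) this assms(3)[of n], of "- c n"] Suc show ?case
    by (simp add: algebra_simps)
qed simp

lemma cheb_coeff_0: "cheb_coeff h 0 = arc_inner (\<lambda>_. 1) h"
  by (simp add: cheb_coeff_def arc_inner_def)

lemma robin_green_expansion:
  assumes g_inf: "dirichlet_green g_inf" and g: "robin_green \<mu> g"
  obtains K where
    "cheb_expansion (\<lambda>y. g y - g_inf y) K (\<lambda>x. - \<mu> * (g (x, 0) - g_inf (x, 0)))"
    "cheb_coeff (\<lambda>x. - \<mu> * (g (x, 0) - g_inf (x, 0))) 0 = - pi"
    "((\<lambda>y. g y - ln (norm y)) \<longlongrightarrow> K + ln 2) halfplane_infinity"
proof -
  define h where "h = (\<lambda>x. - \<mu> * (g (x, 0) - g_inf (x, 0)))"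
  have gc: "continuous_on closed_halfplane g" and gh: "harmonic_on halfplane g"
    and out: "\<And>x. \<bar>x\<bar> > 1 \<Longrightarrow> has_normal_deriv g 0 x"
    and ins: "\<And>x. \<bar>x\<bar> < 1 \<Longrightarrow> \<exists>d. has_normal_deriv g d x \<and> d + \<mu> * g (x, 0) = 0"
    and as: "(\<lambda>y. g y - ln (norm y)) \<in> O[halfplane_infinity](\<lambda>_. 1)"
    using g by (auto simp: robin_green_def classical_harmonic_def)
  have ic: "continuous_on closed_halfplane g_inf" and i0: "\<And>x. \<bar>x\<bar> < 1 \<Longrightarrow> g_inf (x, 0) = 0"
    using g_inf by (auto simp: dirichlet_green_def classical_harmonic_def)
  have hc: "continuous_on {-1..1} h"
    unfolding h_def by (intro continuous_intros continuous_on_boundary gc ic)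
  have nd: "has_normal_deriv g (h x) x" if x: "\<bar>x\<bar> < 1" for x
  proof -
    obtain d where d: "has_normal_deriv g d x" "d + \<mu> * g (x, 0) = 0" using ins[OF x] by blast
    have "h x = d" using d(2) i0[OF x] by (simp add: h_def)
    thus ?thesis using d(1) by simp
  qed
  have as': "(\<lambda>y. g y - 1 * ln (norm y)) \<in> O[halfplane_infinity](\<lambda>_. 1)" using as by simp
  obtain K where H0: "cheb_coeff h 0 = - 1 * pi" and
    K: "\<And>y. y \<in> closed_halfplane \<Longrightarrow> g y = K - 1 * ln (cmod (disc_pt y)) + Re (cheb_series h (disc_pt y))"
    using potential_representation[OF gc gh hc nd out as'] by blast
  show ?thesis
  proof (rule that[of K, folded h_def])
    show "cheb_expansion (\<lambda>y. g y - g_inf y) K h"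
      unfolding cheb_expansion_def using hc K dirichlet_green_eq[OF g_inf]
      by (auto intro!: continuous_intros gc ic continuous_on_cheb_series_disc_pt)
    show "cheb_coeff h 0 = - pi" using H0 by simp
    have "((\<lambda>y. K + (- ln (cmod (disc_pt y)) - ln (norm y)) + Re (cheb_series h (disc_pt y)))
        \<longlongrightarrow> K + ln 2 + 0) halfplane_infinity"
      by (intro tendsto_intros ln_disc_pt_asymp cheb_series_disc_pt_tendsto_0 hc)
    moreover have "\<forall>\<^sub>F y in halfplane_infinity.
        K + (- ln (cmod (disc_pt y)) - ln (norm y)) + Re (cheb_series h (disc_pt y)) = g y - ln (norm y)"
      using eventually_closed_halfplane by eventually_elim (use K in simp)
    ultimately have "((\<lambda>y. g y - ln (norm y)) \<longlongrightarrow> K + ln 2 + 0) halfplane_infinity"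
      by (rule Lim_transform_eventually)
    thus "((\<lambda>y. g y - ln (norm y)) \<longlongrightarrow> K + ln 2) halfplane_infinity" by simp
  qed
qed

lemma steklov_neumann_expansion:
  assumes "steklov_neumann \<mu> \<Psi>"
  shows "cheb_expansion \<Psi> (value_at_infinity \<Psi>) (\<lambda>x. \<mu> * \<Psi> (x, 0))"
    and "cheb_coeff (\<lambda>x. \<mu> * \<Psi> (x, 0)) 0 = 0"
    and "(\<Psi> \<longlongrightarrow> value_at_infinity \<Psi>) halfplane_infinity"
proof -
  define h where "h = (\<lambda>x. \<mu> * \<Psi> (x, 0))"
  have c: "continuous_on closed_halfplane \<Psi>" and harm: "harmonic_on halfplane \<Psi>"
    and out: "\<And>x. \<bar>x\<bar> > 1 \<Longrightarrow> has_normal_deriv \<Psi> 0 x"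
    and ins: "\<And>x. \<bar>x\<bar> < 1 \<Longrightarrow> has_normal_deriv \<Psi> (h x) x"
    and as: "(\<lambda>y. \<Psi> y - 0 * ln (norm y)) \<in> O[halfplane_infinity](\<lambda>_. 1)"
    using assms by (auto simp: steklov_neumann_def classical_harmonic_def h_def)
  have hc: "continuous_on {-1..1} h"
    unfolding h_def by (intro continuous_intros continuous_on_boundary c)
  obtain K where H0: "cheb_coeff h 0 = - 0 * pi" and
    K: "\<And>y. y \<in> closed_halfplane \<Longrightarrow> \<Psi> y = K - 0 * ln (cmod (disc_pt y)) + Re (cheb_series h (disc_pt y))"
    using potential_representation[OF c harm hc ins out as] by blast
  have "((\<lambda>y. K + Re (cheb_series h (disc_pt y))) \<longlongrightarrow> K + 0) halfplane_infinity"
    by (intro tendsto_intros cheb_series_disc_pt_tendsto_0 hc)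
  moreover have "\<forall>\<^sub>F y in halfplane_infinity. K + Re (cheb_series h (disc_pt y)) = \<Psi> y"
    using eventually_closed_halfplane by eventually_elim (use K in simp)
  ultimately have lim: "(\<Psi> \<longlongrightarrow> K) halfplane_infinity"
    using Lim_transform_eventually by fastforce
  hence KV: "value_at_infinity \<Psi> = K"
    unfolding value_at_infinity_def by (intro tendsto_Lim halfplane_infinity_neq_bot)
  show "cheb_expansion \<Psi> (value_at_infinity \<Psi>) (\<lambda>x. \<mu> * \<Psi> (x, 0))"
    unfolding KV h_def[symmetric] cheb_expansion_def using hc K c by auto
  show "cheb_coeff (\<lambda>x. \<mu> * \<Psi> (x, 0)) 0 = 0" using H0 by (simp add: h_def)
  show "(\<Psi> \<longlongrightarrow> value_at_infinity \<Psi>) halfplane_infinity" unfolding KV by (rule lim)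
qed

lemma odd_value_at_infinity:
  assumes "odd_in_y1 u" "(u \<longlongrightarrow> a) halfplane_infinity"
  shows "a = 0"
proof -
  have "filterlim (\<lambda>t::real. (0::real, t)) halfplane_infinity at_top"
    unfolding filterlim_iff eventually_halfplane_infinity eventually_at_top_linorder
  proof (intro allI impI)
    fix P :: "real \<times> real \<Rightarrow> bool"
    assume "\<exists>b. \<forall>y\<in>closed_halfplane. b \<le> norm y \<longrightarrow> P y"
    then obtain b where "\<forall>y\<in>closed_halfplane. b \<le> norm y \<longrightarrow> P y" by blast
    thus "\<exists>N. \<forall>t\<ge>N. P (0, t)"
      by (intro exI[of _ "\<bar>b\<bar>"]) (auto simp: closed_halfplane_def norm_Pair)
  qed
  hence "((\<lambda>t. u (0, t)) \<longlongrightarrow> a) at_top" by (rule filterlim_compose[OF assms(2)])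
  moreover have "\<forall>\<^sub>F t in at_top. u (0, t) = 0"
    using eventually_ge_at_top[of 0]
  proof eventually_elim
    case (elim t)
    have "u (- 0, t) = - u (0, t)" using assms(1) elim unfolding odd_in_y1_def by blast
    thus ?case by simp
  qed
  ultimately have "((\<lambda>t::real. 0::real) \<longlongrightarrow> a) at_top" by (rule Lim_transform_eventually)
  thus ?thesis by (simp add: tendsto_const_iff)
qed

lemma even_odd_arc_inner:
  assumes "continuous_on {-1..1} u" "continuous_on {-1..1} v"
    and u: "\<And>x. u (- x) = u x" and v: "\<And>x. v (- x) = - v x"
  shows "arc_inner u v = 0"
proof -
  have c: "continuous_on {-1..1} (\<lambda>x. u x * v x)" using assms by (intro continuous_intros)
  have "integral {-1..1} (\<lambda>x. u x * v x) = 0"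
    using Henstock_Kurzweil_Integration.integral_reflect_real[of 1 "-1" "\<lambda>x. u x * v x"] by (simp add: u v)
  thus ?thesis using has_integral_cos_substitution[OF c] by (simp add: arc_inner_def)
qed

lemma sums_even_terms:
  fixes f :: "nat \<Rightarrow> real"
  assumes "f sums s" "\<And>k. f (2 * k + 1) = 0"
  shows "(\<lambda>k. f (2 * k)) sums s"
proof (subst sums_mono_reindex)
  show "strict_mono (\<lambda>k::nat. 2 * k)" by (simp add: strict_mono_def)
  show "f n = 0" if "n \<notin> range (\<lambda>k. 2 * k)" for n
    using that assms(2) by (metis oddE rangeI dvdE)
qed (fact assms(1))

theorem mainTheorem1:
  fixes \<mu>s :: "nat \<Rightarrow> real" and \<Psi> :: "nat \<Rightarrow> real \<times> real \<Rightarrow> real"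
    and g_inf g :: "real \<times> real \<Rightarrow> real" and \<mu> :: real
  assumes "steklov_neumann_system \<mu>s \<Psi>"
    and "dirichlet_green g_inf"
    and "\<mu> \<notin> (\<Union>k. {- \<mu>s (2 * k)})"
    and "robin_green \<mu> g"
  shows "((\<mu> \<in> (\<Union>k. {- \<mu>s (2 * k + 1)}) \<longrightarrow> even_in_y1 g) \<longrightarrow>
      (\<forall>y\<in>halfplane.
        summable (\<lambda>k. value_at_infinity (\<Psi> (2 * k)) / (\<mu>s (2 * k) + \<mu>) * \<Psi> (2 * k) y) \<and>
        g y = g_inf y +
          pi * (\<Sum>k. value_at_infinity (\<Psi> (2 * k)) / (\<mu>s (2 * k) + \<mu>) * \<Psi> (2 * k) y))) \<and>
    summable (\<lambda>k. (value_at_infinity (\<Psi> (2 * Suc k)))\<^sup>2 / (\<mu>s (2 * Suc k) + \<mu>)) \<and>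
    ((\<lambda>y. g y - ln (norm y)) \<longlongrightarrow>
       ln 2 + pi / (2 * \<mu>) +
       pi * (\<Sum>k. (value_at_infinity (\<Psi> (2 * Suc k)))\<^sup>2 / (\<mu>s (2 * Suc k) + \<mu>)))
      halfplane_infinity"
proof -
  define a where "a = (\<lambda>k. value_at_infinity (\<Psi> k))"
  define G where "G = (\<lambda>y. g y - g_inf y)"
  define f where "f = (\<lambda>x. G (x, 0))"
  define \<psi> where "\<psi> = (\<lambda>k x. \<Psi> k (x, 0))"
  define c where "c = (\<lambda>k. arc_inner f (\<psi> k))"
  note sys = assms(1)[unfolded steklov_neumann_system_def]
  have sn: "steklov_neumann (\<mu>s k) (\<Psi> k)" for k using sys by blast
  note \<Psi>lim = steklov_neumann_expansion(3)[OF sn]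
  have \<Psi>e: "cheb_expansion (\<Psi> k) (a k) (\<lambda>x. \<mu>s k * \<psi> k x)" for k
    using steklov_neumann_expansion(1)[OF sn] by (simp add: a_def \<psi>_def)
  have \<Psi>0: "cheb_coeff (\<lambda>x. \<mu>s k * \<psi> k x) 0 = 0" for k
    using steklov_neumann_expansion(2)[OF sn] by (simp add: \<psi>_def)
  obtain K where Ge: "cheb_expansion G K (\<lambda>x. - \<mu> * f x)"
    and G0: "cheb_coeff (\<lambda>x. - \<mu> * f x) 0 = - pi"
    and glim: "((\<lambda>y. g y - ln (norm y)) \<longlongrightarrow> K + ln 2) halfplane_infinity"
    using robin_green_expansion[OF assms(2,4)] unfolding f_def G_def by blast
  have fc: "continuous_on {-1..1} f" and \<psi>c: "continuous_on {-1..1} (\<psi> k)" for k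
    unfolding f_def \<psi>_def
    by (intro continuous_on_boundary cheb_expansionD(2)[OF Ge] cheb_expansionD(2)[OF \<Psi>e])+
  have \<mu>\<psi>c: "continuous_on {-1..1} (\<lambda>x. \<mu>s k * \<psi> k x)" for k by (intro continuous_intros \<psi>c)

  have coeff: "(\<mu>s k + \<mu>) * c k = pi * a k" for k
  proof -
    have "arc_inner (\<psi> k) (\<lambda>x. - \<mu> * f x) - a k * (- pi) = arc_inner f (\<lambda>x. \<mu>s k * \<psi> k x) - K * 0"
      using cheb_expansion_symmetric[OF \<Psi>e Ge] unfolding G0 \<Psi>0 \<psi>_def[symmetric] f_def[symmetric]
      by (simp add: \<psi>_def f_def)
    thus ?thesis
      unfolding arc_inner_cmult arc_inner_commute[of "\<psi> k"] c_def by (simp add: algebra_simps)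
  qed

  have ON: "arc_inner (\<psi> j) (\<psi> k) = (if j = k then 1 else 0)" for j k
    using sys unfolding orthonormal_basis_def \<psi>_def[symmetric]
    by (subst arc_inner_eq_set_integral[OF \<psi>c \<psi>c]) (simp add: \<psi>_def)
  define U where "U = (\<lambda>n y. G y - (\<Sum>k<n. c k * \<Psi> k y))"
  define \<eta> where "\<eta> = (\<lambda>n x. - \<mu> * f x - (\<Sum>k<n. c k * (\<mu>s k * \<psi> k x)))"
  define u where "u = (\<lambda>n x. f x - (\<Sum>k<n. c k * \<psi> k x))"
  have Uu: "U n (x, 0) = u n x" for n x by (simp add: U_def u_def f_def \<psi>_def)
  have uc: "continuous_on {-1..1} (u n)" for n
    unfolding u_def by (intro continuous_intros fc \<psi>c)
  have Ue: "cheb_expansion (U n) (K - (\<Sum>k<n. c k * a k)) (\<eta> n)" for n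
    unfolding U_def \<eta>_def by (rule cheb_expansion_diff_sum[OF Ge \<Psi>e])
  have \<mu>fc: "continuous_on {-1..1} (\<lambda>x. - \<mu> * f x)" by (intro continuous_intros fc)
  have H0: "cheb_coeff (\<eta> n) 0 = - pi" for n
    using G0 \<Psi>0 unfolding \<eta>_def cheb_coeff_0
    by (subst arc_inner_diff_sum[OF _ \<mu>fc \<mu>\<psi>c]) auto
  have L2: "(\<lambda>n. arc_inner (u n) (u n)) \<longlonglongrightarrow> 0"
  proof -
    have "set_integrable lborel {-1<..<1} f" "set_integrable lborel {-1<..<1} (\<lambda>x. (f x)\<^sup>2)"
      by (intro set_integrable_open_interval continuous_intros fc)+
    hence "set_borel_measurable lborel {-1<..<1} f" "set_integrable lborel {-1<..<1} (\<lambda>x. (f x)\<^sup>2)"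
      unfolding set_integrable_def set_borel_measurable_def by auto
    hence "(\<lambda>n. LINT x:{-1<..<1}|lborel.
        (f x - (\<Sum>k<n. (LINT s:{-1<..<1}|lborel. f s * \<psi> k s) * \<psi> k x))\<^sup>2) \<longlonglongrightarrow> 0"
      using sys unfolding orthonormal_basis_def \<psi>_def by blast
    thus ?thesis
      unfolding arc_inner_eq_set_integral[OF fc \<psi>c, symmetric] c_def[symmetric]
        arc_inner_eq_set_integral[OF uc uc] by (simp add: u_def power2_eq_square c_def)
  qed
  have u\<psi>: "arc_inner (u n) (\<psi> k) = 0" if "k < n" for n k
  proof -
    have "arc_inner (\<psi> k) (u n) = arc_inner (\<psi> k) f - (\<Sum>j<n. c j * arc_inner (\<psi> k) (\<psi> j))"
      unfolding u_def by (rule arc_inner_diff_sum[OF \<psi>c fc \<psi>c])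
    also have "(\<Sum>j<n. c j * arc_inner (\<psi> k) (\<psi> j)) = c k"
      using that by (simp add: ON if_distrib[of "\<lambda>x. _ * x"] cong: if_cong)
    finally show ?thesis by (simp add: c_def arc_inner_commute)
  qed
  have u\<eta>: "arc_inner (u n) (\<eta> n) = - \<mu> * arc_inner (u n) f" for n
  proof -
    have "arc_inner (u n) (\<eta> n) = arc_inner (u n) (\<lambda>x. - \<mu> * f x) -
        (\<Sum>k<n. c k * arc_inner (u n) (\<lambda>x. \<mu>s k * \<psi> k x))"
      unfolding \<eta>_def by (rule arc_inner_diff_sum[OF uc \<mu>fc \<mu>\<psi>c])
    also have "(\<Sum>k<n. c k * arc_inner (u n) (\<lambda>x. \<mu>s k * \<psi> k x)) = 0"
      by (intro sum.neutral) (simp add: arc_inner_cmult u\<psi>)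
    finally show ?thesis unfolding arc_inner_cmult by simp
  qed
  have uf: "(\<lambda>n. arc_inner (u n) f) \<longlonglongrightarrow> 0"
  proof -
    obtain M where M: "\<forall>x\<in>{-1..1}. \<bar>f x\<bar> \<le> M"
      using compact_imp_bounded[OF compact_continuous_image[OF fc compact_Icc]]
      unfolding bounded_iff by auto
    have "(\<lambda>n. integral {0..pi} (\<lambda>\<theta>. u n (cos \<theta>) * (f (cos \<theta>) * sin \<theta>))) \<longlonglongrightarrow> 0"
    proof (rule arc_integral_tendsto_0[OF uc L2])
      show "continuous_on {0..pi} (\<lambda>\<theta>. f (cos \<theta>) * sin \<theta>)"
        by (intro continuous_intros continuous_on_compose_cos fc)
      show "\<bar>f (cos \<theta>) * sin \<theta>\<bar> \<le> M * sin \<theta>" if "\<theta> \<in> {0..pi}" for \<theta>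
        using M that by (auto simp: abs_mult sin_ge_zero intro!: mult_right_mono)
    qed
    thus ?thesis by (simp add: arc_inner_def mult.assoc)
  qed
  have en: "(\<lambda>n. arc_inner (u n) (\<eta> n)) \<longlonglongrightarrow> 0"
    unfolding u\<eta> by (rule tendsto_mult_right_zero[OF uf])
  note null = cheb_expansion_null_sequence[OF Ue H0, unfolded Uu, OF L2 en]

  have sumK: "(\<lambda>k. c k * a k) sums K"
    unfolding sums_def using tendsto_diff[OF tendsto_const[of K] null(1)] by simp
  have sumG: "(\<lambda>k. c k * \<Psi> k y) sums G y" if "y \<in> halfplane" for y
    unfolding sums_def using tendsto_diff[OF tendsto_const[of "G y"] null(2)[OF that]]
    by (simp add: U_def)
  have aodd: "a (2 * k + 1) = 0" for k
    using odd_value_at_infinity[OF _ \<Psi>lim] sys unfolding a_def by blast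
  have nz: "\<mu>s (2 * k) + \<mu> \<noteq> 0" for k
    using assms(3) by (auto simp: add_eq_0_iff2 add.commute)
  have ceven: "c (2 * k) = pi * (a (2 * k) / (\<mu>s (2 * k) + \<mu>))" for k
    using coeff[of "2 * k"] nz[of k] by (simp add: field_simps)

  have pointwise: "summable (\<lambda>k. a (2 * k) / (\<mu>s (2 * k) + \<mu>) * \<Psi> (2 * k) y) \<and>
      g y = g_inf y + pi * (\<Sum>k. a (2 * k) / (\<mu>s (2 * k) + \<mu>) * \<Psi> (2 * k) y)"
    if ev: "\<mu> \<in> (\<Union>k. {- \<mu>s (2 * k + 1)}) \<longrightarrow> even_in_y1 g" and y: "y \<in> halfplane" for y
  proof -
    have codd: "c (2 * k + 1) = 0" for k
    proof (cases "\<mu>s (2 * k + 1) + \<mu> = 0")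
      case False
      thus ?thesis using coeff[of "2 * k + 1"] aodd[of k] by simp
    next
      case True
      hence "\<mu> \<in> (\<Union>k. {- \<mu>s (2 * k + 1)})" by (auto simp: add_eq_0_iff)
      hence gev: "g (- x, 0) = g (x, 0)" for x using ev by (auto simp: even_in_y1_def)
      have c': "c (2 * k + 1) = arc_inner (\<lambda>x. g (x, 0)) (\<psi> (2 * k + 1))"
      proof -
        have "g_inf (cos \<theta>, 0) = 0" if "\<theta> \<in> {0..pi}" for \<theta>
          using dirichlet_green_eq[OF assms(2), of "(cos \<theta>, 0)"] disc_pt_cos[OF that]
          by (simp add: closed_halfplane_def)
        thus ?thesis unfolding c_def arc_inner_def f_def G_def by (intro integral_cong) simp
      qed
      have gc: "continuous_on closed_halfplane g"
        using assms(4) by (simp add: robin_green_def classical_harmonic_def)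
      have "odd_in_y1 (\<Psi> (2 * k + 1))" using sys by blast
      hence "\<psi> (2 * k + 1) (- x) = - \<psi> (2 * k + 1) x" for x by (simp add: odd_in_y1_def \<psi>_def)
      thus ?thesis unfolding c'
        by (intro even_odd_arc_inner continuous_on_boundary gc \<psi>c gev)
    qed
    have "(\<lambda>k. c (2 * k) * \<Psi> (2 * k) y) sums G y"
      by (rule sums_even_terms[OF sumG[OF y]]) (simp add: codd del: One_nat_def)
    hence "(\<lambda>k. c (2 * k) * \<Psi> (2 * k) y / pi) sums (G y / pi)" by (rule sums_divide)
    hence "(\<lambda>k. a (2 * k) / (\<mu>s (2 * k) + \<mu>) * \<Psi> (2 * k) y) sums (G y / pi)"
      unfolding ceven by simp
    thus ?thesis by (auto simp: sums_iff G_def)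
  qed

  have "(\<lambda>k. c (2 * k) * a (2 * k)) sums K"
    by (rule sums_even_terms[OF sumK]) (simp add: aodd del: One_nat_def)
  hence "(\<lambda>k. c (2 * k) * a (2 * k) / pi) sums (K / pi)" by (rule sums_divide)
  hence S: "(\<lambda>k. (a (2 * k))\<^sup>2 / (\<mu>s (2 * k) + \<mu>)) sums (K / pi)"
    unfolding ceven by (simp add: power2_eq_square)
  have a0: "a 0 = 1 / sqrt 2"
  proof -
    have "\<forall>\<^sub>F y in halfplane_infinity. \<Psi> 0 y = 1 / sqrt 2"
      using eventually_closed_halfplane by eventually_elim (use sys in blast)
    from Lim_transform_eventually[OF \<Psi>lim[of 0] this] show ?thesis
      by (simp add: a_def tendsto_const_iff)
  qed
  have \<mu>0: "\<mu>s 0 = 0" using sys by blast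
  have "(\<lambda>k. (a (2 * Suc k))\<^sup>2 / (\<mu>s (2 * Suc k) + \<mu>)) sums (K / pi - (a (2 * 0))\<^sup>2 / (\<mu>s (2 * 0) + \<mu>))"
    using sums_Suc_iff[of "\<lambda>k. (a (2 * k))\<^sup>2 / (\<mu>s (2 * k) + \<mu>)"] S by simp
  hence S': "(\<lambda>k. (a (2 * Suc k))\<^sup>2 / (\<mu>s (2 * Suc k) + \<mu>)) sums (K / pi - 1 / (2 * \<mu>))"
    by (simp add: a0 \<mu>0 power_divide)
  have "ln 2 + pi / (2 * \<mu>) + pi * (\<Sum>k. (a (2 * Suc k))\<^sup>2 / (\<mu>s (2 * Suc k) + \<mu>)) = K + ln 2"
    unfolding sums_unique[OF S', symmetric] by (simp add: right_diff_distrib)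
  hence "((\<lambda>y. g y - ln (norm y)) \<longlongrightarrow>
      ln 2 + pi / (2 * \<mu>) + pi * (\<Sum>k. (a (2 * Suc k))\<^sup>2 / (\<mu>s (2 * Suc k) + \<mu>))) halfplane_infinity"
    using glim by (simp only:)
  note lim = this[unfolded a_def]
  show ?thesis
    by (rule conjI[OF impI[OF ballI] conjI])
      (rule pointwise[unfolded a_def] sums_summable[OF S', unfolded a_def] lim; assumption)+
qed

end
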